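(* Suppose $R\in\{1,\dots,p\}$ divides $p$, $\frac{p}{4R}<s<\frac{p}{R}$ (with $p\ge 1$, $s\geq 1$ natural numbers), and $\gamma\in[0,1)$. Set $$\upsilon^2:=\begin{cases}\left[\frac{(1-\gamma)p}{p-Rs}\left(\sqrt{\frac{p}{R}\log(eR)}+\log(R)\right)\right]\wedge\left[\left(1-\gamma+\gamma\frac{p}{R}\right)\log(eR)\right]&\text{if }\frac{p}{4R}<s\leq\frac{p}{R}-\sqrt{\frac{p}{R}\log(eR)},\\ \left[\frac{(1-\gamma)p}{p-Rs}\left(\left(\frac{p}{R}-s\right)\log\left(1+\frac{Rp\log(eR)}{(p-Rs)^2}\right)+\log(R)\right)\right]\wedge\left[\left(1-\gamma+\gamma\frac{p}{R}\right)\log(eR)\right]&\text{if }\frac{p}{R}-\sqrt{\frac{p}{R}\log(eR)}<s<\frac{p}{R},\end{cases}$$ and $$\psi_1^2:=\begin{cases}(1-\gamma)s\log\left(1+\frac{p}{s^2}\right)&\text{if }s<\sqrt{p},\\(1-\gamma)\sqrt{p}&\text{if }s\geq\sqrt{p}.\end{cases}$$ Then $\varepsilon^*(p,s,\gamma,R)^2\asymp\psi_1^2+\upsilon^2$.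
   Context: Notation: $a\wedge b=\min(a,b)$; $\|\cdot\|$ is the Euclidean norm; $\|\theta\|_0$ is the number of nonzero coordinates. Let $R$ divide $p$ and let $B_1,\dots,B_R$ be a partition of $[p]=\{1,\dots,p\}$ into $R$ known groups of size $p/R$ each. $\mathbf{1}_{B_k}\in\mathbb{R}^p$ is the indicator vector of $B_k$. For $\theta\in\mathbb{R}^p$, $P_{\theta,\gamma,R}$ denotes the distribution $N\big(\theta,(1-\gamma)I_p+\gamma\sum_{k=1}^R\mathbf{1}_{B_k}\mathbf{1}_{B_k}^\intercal\big)$ of the observation $X$. For $\varepsilon>0$ let $\Theta(p,s,\varepsilon)=\{\theta\in\mathbb{R}^p:\|\theta\|\geq\varepsilon,\ \|\theta\|_0\leq s\}$. The minimax testing risk for $H_0:\theta=0$ against $H_1:\theta\in\Theta(p,s,\varepsilon)$ is $$\mathcal{R}(\varepsilon)=\inf_{\varphi}\Big\{P_{0,\gamma,R}\{\varphi=1\}+\sup_{\theta\in\Theta(p,s,\varepsilon)}P_{\theta,\gamma,R}\{\varphi=0\}\Big\},$$ the infimum being over all measurable $\varphi:\mathbb{R}^p\to\{0,1\}$ (this does not depend on the choice of the groups, only on $R$). Definition: $\varepsilon^*=\varepsilon^*(p,s,\gamma,R)$ is the minimax separation rate if (i) for every $\eta\in(0,1)$ there is $C_\eta>0$ depending only on $\eta$ such that $C>C_\eta$ implies $\mathcal{R}(C\varepsilon^* )\leq\eta$; and (ii) for every $\eta\in(0,1)$ there is $c_\eta>0$ depending only on $\eta$ such that $0<c<c_\eta$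 implies $\mathcal{R}(c\varepsilon^* )\geq1-\eta$. The constants do not depend on $(p,s,\gamma,R)$. The rate is unique only up to multiplication by universal constants, and $a\asymp b$ means equality up to universal positive multiplicative constants; thus $(\varepsilon^* )^2\asymp\psi^2$ means that $\psi$ satisfies (i) and (ii) in place of $\varepsilon^*$. *)

theory Defs
  imports
    "HOL-Probability.Probability"
    "Jordan_Normal_Form.Gauss_Jordan_Elimination"
    "Jordan_Normal_Form.Determinant"
begin

(* R^p is represented by the extensional functions on {..<p}, with the product Borel
   sigma-algebra, because the dimension p must be quantified inside the statement:
   the constants in the definition of the separation rate are uniform in p.
   Coordinates are numbered 0, ..., p - 1. *)

abbreviation euclid :: "nat \<Rightarrow> (nat \<Rightarrow> real) set" where
  "euclid p \<equiv> PiE {..<p} (\<lambda>_. UNIV)"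

abbreviation borel_euclid :: "nat \<Rightarrow> (nat \<Rightarrow> real) measure" where
  "borel_euclid p \<equiv> PiM {..<p} (\<lambda>_. borel)"

abbreviation lborel_euclid :: "nat \<Rightarrow> (nat \<Rightarrow> real) measure" where
  "lborel_euclid p \<equiv> PiM {..<p} (\<lambda>_. lborel)"

(* The normal law with mean m and covariance S, through its Lebesgue density; meaningful
   for symmetric positive definite S only. *)

definition normal_density_vec :: "nat \<Rightarrow> (nat \<Rightarrow> real) \<Rightarrow> real mat \<Rightarrow> (nat \<Rightarrow> real) \<Rightarrow> real" where
  "normal_density_vec p m S x =
     (let v = Matrix.vec p (\<lambda>i. x i - m i) in
      exp (- Matrix.scalar_prod v (the (mat_inverse S) *\<^sub>v v) / 2)
        / sqrt ((2 * pi) ^ p * Determinant.det S))"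

definition normal_law :: "nat \<Rightarrow> (nat \<Rightarrow> real) \<Rightarrow> real mat \<Rightarrow> (nat \<Rightarrow> real) measure" where
  "normal_law p m S = density (lborel_euclid p) (\<lambda>x. ennreal (normal_density_vec p m S x))"

(* The groups are the R blocks of a partition of the coordinates into sets of equal size;
   only the unordered collection of blocks enters the covariance. *)

definition equal_groups :: "nat \<Rightarrow> nat \<Rightarrow> nat set set \<Rightarrow> bool" where
  "equal_groups p R \<B> \<longleftrightarrow>
     partition_on {..<p} \<B> \<and> card \<B> = R \<and> (\<forall>B\<in>\<B>. card B = p div R)"

(* The (i,j) entry of the sum over the blocks of 1_B 1_B^T is the sum of 1_B(i) 1_B(j). *)

definition group_cov :: "nat \<Rightarrow> real \<Rightarrow> nat set set \<Rightarrow> real mat" where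
  "group_cov p \<gamma> \<B> =
     (1 - \<gamma>) \<cdot>\<^sub>m 1\<^sub>m p
       + \<gamma> \<cdot>\<^sub>m Matrix.mat p p (\<lambda>(i, j). \<Sum>B\<in>\<B>. indicator B i * indicator B j)"

definition obs_law :: "nat \<Rightarrow> real \<Rightarrow> nat set set \<Rightarrow> (nat \<Rightarrow> real) \<Rightarrow> (nat \<Rightarrow> real) measure" where
  "obs_law p \<gamma> \<B> \<theta> = normal_law p \<theta> (group_cov p \<gamma> \<B>)"

definition sparse_alt :: "nat \<Rightarrow> nat \<Rightarrow> real \<Rightarrow> (nat \<Rightarrow> real) set" where
  "sparse_alt p s \<epsilon> =
     {\<theta> \<in> euclid p. L2_set \<theta> {..<p} \<ge> \<epsilon> \<and> card {i \<in> {..<p}. \<theta> i \<noteq> 0} \<le> s}"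

definition tests :: "nat \<Rightarrow> ((nat \<Rightarrow> real) \<Rightarrow> nat) set" where
  "tests p = borel_euclid p \<rightarrow>\<^sub>M count_space {0, 1}"

(* The supremum and infimum are those of the reals: the alternative is nonempty as soon as
   p, s >= 1, and all the quantities involved lie between 0 and 2. *)

definition minimax_risk :: "nat \<Rightarrow> nat \<Rightarrow> real \<Rightarrow> nat set set \<Rightarrow> real \<Rightarrow> real" where
  "minimax_risk p s \<gamma> \<B> \<epsilon> =
     (INF \<phi>\<in>tests p.
        measure (obs_law p \<gamma> \<B> (\<lambda>i\<in>{..<p}. 0)) {x \<in> euclid p. \<phi> x = 1}
        + (SUP \<theta>\<in>sparse_alt p s \<epsilon>.
             measure (obs_law p \<gamma> \<B> \<theta>) {x \<in> euclid p. \<phi> x = 0}))"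

(* D is the range of the parameters (p, s, gamma, R) and r is a candidate for the rate.
   The constants are chosen before the parameters, and before the groups. *)

definition minimax_separation_rate ::
  "(nat \<Rightarrow> nat \<Rightarrow> real \<Rightarrow> nat \<Rightarrow> bool) \<Rightarrow> (nat \<Rightarrow> nat \<Rightarrow> real \<Rightarrow> nat \<Rightarrow> real) \<Rightarrow> bool" where
  "minimax_separation_rate D r \<longleftrightarrow>
     (\<forall>\<eta>\<in>{0<..<1}. \<exists>C\<^sub>\<eta>>0. \<forall>p s \<gamma> R \<B>. D p s \<gamma> R \<longrightarrow> equal_groups p R \<B> \<longrightarrow>
        (\<forall>C>C\<^sub>\<eta>. minimax_risk p s \<gamma> \<B> (C * r p s \<gamma> R) \<le> \<eta>)) \<and>
     (\<forall>\<eta>\<in>{0<..<1}. \<exists>c\<^sub>\<eta>>0. \<forall>p s \<gamma> R \<B>. D p s \<gamma> R \<longrightarrow> equal_groups p R \<B> \<longrightarrow>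
        (\<forall>c. 0 < c \<and> c < c\<^sub>\<eta> \<longrightarrow> minimax_risk p s \<gamma> \<B> (c * r p s \<gamma> R) \<ge> 1 - \<eta>))"

definition upsilon_sq :: "nat \<Rightarrow> nat \<Rightarrow> real \<Rightarrow> nat \<Rightarrow> real" where
  "upsilon_sq p' s' \<gamma> R' =
     (let p = real p'; s = real s'; R = real R'; L = ln (exp 1 * R) in
      if s \<le> p / R - sqrt (p / R * L)
      then min ((1 - \<gamma>) * p / (p - R * s) * (sqrt (p / R * L) + ln R))
               ((1 - \<gamma> + \<gamma> * (p / R)) * L)
      else min ((1 - \<gamma>) * p / (p - R * s)
                  * ((p / R - s) * ln (1 + R * p * L / (p - R * s)\<^sup>2) + ln R))
               ((1 - \<gamma> + \<gamma> * (p / R)) * L))"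

definition psi1_sq :: "nat \<Rightarrow> nat \<Rightarrow> real \<Rightarrow> real" where
  "psi1_sq p s \<gamma> =
     (if real s < sqrt (real p)
      then (1 - \<gamma>) * real s * ln (1 + real p / (real s)\<^sup>2)
      else (1 - \<gamma>) * sqrt (real p))"

end

theory Submission
  imports Defs
begin

text \<open>Write q = p/R for the size of a block, d = q - s for the number of coordinates that a signal inside one
block must leave at zero, L = 1 + ln R, and V = 1 - \<gamma> + \<gamma>q. Two facts about the covariance drive everything.
First, the observation is a common Gaussian shift of each block plus independent noise of variance
1 - \<gamma>; so any function of the differences of coordinates within blocks behaves as if the correlation were
absent. Second, the sum over a block has variance qV. A signal is thus seen either through the
differences, with noise 1 - \<gamma>, or through a block sum, with noise V in the direction of the block indicator.

Upper bound. Let E be the squared norm of the signal. Since the support has fewer than q points, either a quarter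
of E is orthogonal to the block indicators, or a single block has a mean that carries half of E (lemma
\<open>energy_dichotomy\<close>). In the first case the test statistic is the average, over random matchings inside the
blocks, of thresholded squares max (z^2 - \<tau>) 0 of the normalised differences. A difference of two
coordinates outside the support is pure noise, so sparsity survives the differencing. Within one matching
the summands are independent, and Jensen's inequality carries exponential moments and variances over to the
average; this gives the rate \<psi>_1. In the second case there are two options, whose minimum is \<upsilon>^2. The block
has at least d zero coordinates, and every pair formed by a zero and a nonzero coordinate reveals the
signal: this leaves the fraction d/q of E for the differences of that block, and the same statistic with
a threshold adapted to d zeros among q coordinates applies. Alternatively one compares the block sums with their
standard deviation. In both options a union bound over the R blocks costs the factor L (\<open>union_level\<close>).

Lower bound. By the second moment method (\<open>minimax_risk_ge\<close>) it suffices to find finite priors whose averaged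
exponential of the inner product given by the inverse covariance is at most 1 + \<eta>^2. For \<psi>_1 one
coordinate is chosen in each of n cells of equal size; for nonnegative signals the correlation only decreases the
inner product (\<open>minimax_risk_ge_independent\<close>). For \<upsilon> a block is chosen at random, and inside it a constant signal
is put on, or off, a random set with one point in each cell. Signals in different blocks are orthogonal, which
brings in the factor 1/R; in the same block the inner product splits into a small multiple of L that stems from the
block mean and the centred overlap of two random cell sets, whose exponential moment is
controlled in \<open>overlap_moment_le\<close>.\<close>

section \<open>The Gaussian density of an equicorrelated block model\<close>

text \<open>Sylvester's identity: both determinants are the determinant of one block matrix, multiplied by
unipotent matrices on either side.\<close>

lemma det_one_plus_mult_commute:
  fixes A B :: "real mat"
  assumes A: "A \<in> carrier_mat n m" and B: "B \<in> carrier_mat m n"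
  shows "Determinant.det (1\<^sub>m n + A * B) = Determinant.det (1\<^sub>m m + B * A)"
proof -
  define M where "M = four_block_mat (1\<^sub>m n) (- A) B (1\<^sub>m m)"
  define N where "N = four_block_mat (1\<^sub>m n) A (0\<^sub>m m n) (1\<^sub>m m)"
  have carrier: "M \<in> carrier_mat (n + m) (n + m)" "N \<in> carrier_mat (n + m) (n + m)"
    using A B by (auto simp: M_def N_def)
  have AA: "A - A = 0\<^sub>m n m" "- A + A = 0\<^sub>m n m" using A by auto
  have "M * N = four_block_mat (1\<^sub>m n) (0\<^sub>m n m) B (1\<^sub>m m + B * A)"
    unfolding M_def N_def
    by (subst mult_four_block_mat[of _ n n _ m _ m _ _ n _ m])
       (use A B in \<open>auto simp: AA comm_add_mat[of _ m m]\<close>)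
  then have "Determinant.det (M * N) = Determinant.det (1\<^sub>m m + B * A)"
    using A B by (simp, subst det_four_block_mat_upper_right_zero[of _ n _ m]) auto
  moreover have "N * M = four_block_mat (1\<^sub>m n + A * B) (0\<^sub>m n m) B (1\<^sub>m m)"
    unfolding M_def N_def
    by (subst mult_four_block_mat[of _ n n _ m _ m _ _ n _ m])
       (use A B in \<open>auto simp: AA\<close>)
  then have "Determinant.det (N * M) = Determinant.det (1\<^sub>m n + A * B)"
    using A B by (simp, subst det_four_block_mat_upper_right_zero[of _ n _ m]) auto
  ultimately show ?thesis
    using det_mult[OF carrier] det_mult[OF carrier(2,1)] by (simp add: mult.commute)
qed

lemma the_mat_inverse_eq:
  fixes A :: "real mat"
  assumes A: "A \<in> carrier_mat n n" and C: "C \<in> carrier_mat n n" and AC: "A * C = 1\<^sub>m n"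
  shows "the (mat_inverse A) = C"
proof (cases "mat_inverse A")
  case None
  have "C * A = 1\<^sub>m n"
    using mat_mult_left_right_inverse[OF A C AC] .
  then have "A \<in> Units (ring_mat TYPE(real) n ())"
    using A C AC by (auto simp: Units_def ring_mat_def)
  with mat_inverse(1)[OF A None, of "()"] show ?thesis by blast
next
  case (Some B)
  from mat_inverse(2)[OF A Some] have B: "B * A = 1\<^sub>m n" "B \<in> carrier_mat n n" by auto
  have "B = B * (A * C)" using AC B by simp
  also have "\<dots> = (B * A) * C" by (simp only: assoc_mult_mat[OF B(2) A C])
  also have "\<dots> = C" using B C by simp
  finally show ?thesis using Some by simp
qed

lemma smult_smult_times: "c \<cdot>\<^sub>m (d \<cdot>\<^sub>m A) = (c * d :: real) \<cdot>\<^sub>m A"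
  by (rule eq_matI) auto

lemma one_smult_mat: "(1 :: real) \<cdot>\<^sub>m A = A"
  by (rule eq_matI) auto

lemma smult_mat_vec:
  fixes A :: "real mat"
  assumes "dim_vec v = dim_col A"
  shows "(c \<cdot>\<^sub>m A) *\<^sub>v v = c \<cdot>\<^sub>v (A *\<^sub>v v)"
  using assms by (intro eq_vecI) (auto simp: row_smult)

locale block_model =
  fixes p R q :: nat and \<gamma> :: real and \<B> :: "nat set set"
  assumes groups: "equal_groups p R \<B>"
    and p_eq: "p = q * R" and q_pos: "1 \<le> q" and R_pos: "1 \<le> R"
    and \<gamma>_nonneg: "0 \<le> \<gamma>" and \<gamma>_less: "\<gamma> < 1"
begin

abbreviation a :: real where "a \<equiv> 1 - \<gamma>"

text \<open>The variance of the block sum divided by its length; the eigenvalue of the covariance on the indicator of a block.\<close>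

definition V :: real where "V = 1 - \<gamma> + \<gamma> * real q"

lemma a_pos: "0 < a" using \<gamma>_less by simp

lemma V_pos: "0 < V"
  unfolding V_def using \<gamma>_nonneg \<gamma>_less by (simp add: add_pos_nonneg)

lemma partition: "partition_on {..<p} \<B>" and card_blocks: "card \<B> = R"
  using groups by (auto simp: equal_groups_def)

lemma card_block: "B \<in> \<B> \<Longrightarrow> card B = q"
  using groups R_pos by (auto simp: equal_groups_def p_eq)

lemma finite_blocks: "finite \<B>"
  using partition by (auto intro: finite_elements)

lemma block_subset: "B \<in> \<B> \<Longrightarrow> B \<subseteq> {..<p}"
  using partition_onD1[OF partition] by auto

lemma finite_block: "B \<in> \<B> \<Longrightarrow> finite B"
  using block_subset finite_subset by blast

lemma sum_blocks: "(\<Sum>B\<in>\<B>. \<Sum>i\<in>B. f i) = (\<Sum>i<p. f i)" for f :: "nat \<Rightarrow> 'b::comm_monoid_add"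
  by (simp add: partition_onD1[OF partition])
     (rule sum.Union_disjoint[symmetric, unfolded comp_def],
       use partition_onD2[OF partition] finite_block in \<open>auto simp: disjoint_def\<close>)

lemma prod_blocks: "(\<Prod>B\<in>\<B>. \<Prod>i\<in>B. f i) = (\<Prod>i<p. f i)" for f :: "nat \<Rightarrow> 'b::comm_monoid_mult"
  by (simp add: partition_onD1[OF partition])
     (rule prod.Union_disjoint[symmetric, unfolded comp_def],
       use partition_onD2[OF partition] finite_block in \<open>auto simp: disjoint_def\<close>)

definition blk :: "nat \<Rightarrow> nat set" where
  "blk i = (THE B. B \<in> \<B> \<and> i \<in> B)"

lemma blk_eq: "B \<in> \<B> \<Longrightarrow> i \<in> B \<Longrightarrow> blk i = B"
  unfolding blk_def using partition_onD2[OF partition]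
  by (intro the_equality) (auto simp: disjoint_def)

lemma blk_in: "i < p \<Longrightarrow> blk i \<in> \<B> \<and> i \<in> blk i"
  using partition_onD1[OF partition] blk_eq by (metis UnionE lessThan_iff)

text \<open>The bilinear form of the inverse covariance, in the form that the identity J J = q J gives for it.\<close>

definition cinner :: "(nat \<Rightarrow> real) \<Rightarrow> (nat \<Rightarrow> real) \<Rightarrow> real" where
  "cinner x y = ((\<Sum>i<p. x i * y i) - \<gamma> / V * (\<Sum>B\<in>\<B>. (\<Sum>i\<in>B. x i) * (\<Sum>i\<in>B. y i))) / a"

abbreviation J :: "real mat" where
  "J \<equiv> Matrix.mat p p (\<lambda>(i, j). \<Sum>B\<in>\<B>. indicator B i * indicator B j)"

lemma J_entry:
  assumes "i < p" "j < p"
  shows "(\<Sum>B\<in>\<B>. indicator B i * indicator B j :: real) = (if j \<in> blk i then 1 else 0)"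
proof -
  have "(\<Sum>B\<in>\<B>. indicator B i * indicator B j :: real)
      = (\<Sum>B\<in>\<B>. if B = blk i then (if j \<in> B then 1 else 0) else 0)"
  proof (intro sum.cong refl)
    fix B assume "B \<in> \<B>"
    then have "i \<in> B \<longleftrightarrow> B = blk i" using blk_eq blk_in[OF assms(1)] by metis
    then show "(indicator B i * indicator B j :: real) = (if B = blk i then (if j \<in> B then 1 else 0) else 0)"
      by (simp add: indicator_def)
  qed
  then show ?thesis using blk_in[OF assms(1)] by (simp add: finite_blocks)
qed

lemma J_times_J: "J * J = real q \<cdot>\<^sub>m J"
proof (rule eq_matI)
  fix i j assume "i < dim_row (real q \<cdot>\<^sub>m J)" "j < dim_col (real q \<cdot>\<^sub>m J)"
  then have ij: "i < p" "j < p" by auto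
  have "(J * J) $$ (i, j) = (\<Sum>k<p. (if k \<in> blk i then 1 else 0) * (if j \<in> blk k then 1 else 0))"
    using ij by (simp add: scalar_prod_def atLeast0LessThan)
      (intro sum.cong refl, simp add: J_entry)
  also have "\<dots> = (\<Sum>k<p. if k \<in> blk i then (if j \<in> blk i then 1 else 0) else 0)"
  proof (intro sum.cong refl)
    fix k assume "k \<in> {..<p}"
    show "(if k \<in> blk i then 1 else 0) * (if j \<in> blk k then 1 else 0)
        = (if k \<in> blk i then if j \<in> blk i then 1 else 0 else (0 :: real))"
      using blk_eq[of "blk i" k] blk_in[OF ij(1)] by (cases "k \<in> blk i") auto
  qed
  also have "\<dots> = real (card (blk i)) * (if j \<in> blk i then 1 else 0)"
  proof -
    have "{..<p} \<inter> blk i = blk i" using ij blk_in block_subset by blast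
    then show ?thesis by (simp add: sum.If_cases)
  qed
  also have "\<dots> = (real q \<cdot>\<^sub>m J) $$ (i, j)"
    using ij blk_in[OF ij(1)] by (simp add: J_entry card_block)
  finally show "(J * J) $$ (i, j) = (real q \<cdot>\<^sub>m J) $$ (i, j)" .
qed auto

lemma group_cov_eq: "group_cov p \<gamma> \<B> = a \<cdot>\<^sub>m 1\<^sub>m p + \<gamma> \<cdot>\<^sub>m J"
  by (simp add: group_cov_def)

text \<open>On the span of 1 and J the relation J J = q J makes inversion a scalar computation.\<close>

lemma inverse_group_cov:
  "the (mat_inverse (group_cov p \<gamma> \<B>)) = (1 / a) \<cdot>\<^sub>m 1\<^sub>m p + (- \<gamma> / (a * V)) \<cdot>\<^sub>m J"
    (is "_ = ?C")
proof (rule the_mat_inverse_eq)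
  have "(a \<cdot>\<^sub>m 1\<^sub>m p + \<gamma> \<cdot>\<^sub>m J) * ?C
      = a \<cdot>\<^sub>m 1\<^sub>m p * ((1 / a) \<cdot>\<^sub>m 1\<^sub>m p) + a \<cdot>\<^sub>m 1\<^sub>m p * ((- \<gamma> / (a * V)) \<cdot>\<^sub>m J)
       + (\<gamma> \<cdot>\<^sub>m J * ((1 / a) \<cdot>\<^sub>m 1\<^sub>m p) + \<gamma> \<cdot>\<^sub>m J * ((- \<gamma> / (a * V)) \<cdot>\<^sub>m J))"
    by (subst add_mult_distrib_mat[of _ p p], auto, subst (1 2) mult_add_distrib_mat[of _ p p], auto)
  also have "\<dots> = 1\<^sub>m p + (- \<gamma> / V) \<cdot>\<^sub>m J + ((\<gamma> / a) \<cdot>\<^sub>m J + (\<gamma> * (- \<gamma> / (a * V)) * real q) \<cdot>\<^sub>m J)"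
    using a_pos
    by (simp add: mult_smult_assoc_mat[where nr = p and n = p and nc = p]
        mult_smult_distrib[where nr = p and n = p and nc = p] J_times_J smult_smult_times one_smult_mat
        mult.assoc left_mult_one_mat[of _ p p] right_mult_one_mat[of _ p p])
  also have "\<dots> = 1\<^sub>m p"
  proof (rule eq_matI)
    fix i j assume ij: "i < dim_row (1\<^sub>m p)" "j < dim_col (1\<^sub>m p)"
    have "- \<gamma> / V + (\<gamma> / a + \<gamma> * (- \<gamma> / (a * V)) * real q) = 0"
    proof -
      have "- g / v + (g / A + g * (- g / (A * v)) * Q) = (g * (v - A - g * Q)) / (A * v)"
        if "0 < A" "0 < v" for g v A Q :: real
        using that by (simp add: field_simps)
      from this[OF a_pos V_pos, of \<gamma> "real q"] show ?thesis by (simp add: V_def)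
    qed
    then have "(- \<gamma> / V + (\<gamma> / a + \<gamma> * (- \<gamma> / (a * V)) * real q)) * x = 0" for x by simp
    then have e: "- \<gamma> / V * x + (\<gamma> / a * x + \<gamma> * (- \<gamma> / (a * V)) * real q * x) = 0" for x
      by (simp only: distrib_right)
    show "(1\<^sub>m p + (- \<gamma> / V) \<cdot>\<^sub>m J + ((\<gamma> / a) \<cdot>\<^sub>m J + (\<gamma> * (- \<gamma> / (a * V)) * real q) \<cdot>\<^sub>m J)) $$ (i, j)
        = (1\<^sub>m p) $$ (i, j)"
      using ij e[of "J $$ (i, j)"] by simp
  qed auto
  finally show "group_cov p \<gamma> \<B> * ?C = 1\<^sub>m p" by (simp add: group_cov_eq)
qed (auto simp: group_cov_def)

text \<open>Sylvester's identity reduces the determinant to size R: the p by R matrix U of block indicators satisfies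
J = U U^T and U^T U = q 1.\<close>

lemma det_group_cov: "Determinant.det (group_cov p \<gamma> \<B>) = a ^ p * (V / a) ^ R"
proof -
  obtain f where f: "bij_betw f {..<R} \<B>"
    using ex_bij_betw_nat_finite[OF finite_blocks] card_blocks by (auto simp: atLeast0LessThan)
  define U :: "real mat" where "U = Matrix.mat p R (\<lambda>(i, k). indicator (f k) i)"
  have U: "U \<in> carrier_mat p R" by (simp add: U_def)
  have JU: "J = U * transpose_mat U"
  proof (rule eq_matI)
    fix i j assume "i < dim_row (U * transpose_mat U)" "j < dim_col (U * transpose_mat U)"
    then have ij: "i < p" "j < p" by (auto simp: U_def)
    then show "J $$ (i, j) = (U * transpose_mat U) $$ (i, j)"
      using sum.reindex_bij_betw[OF f, of "\<lambda>B. indicator B i * indicator B j :: real"]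
      by (simp add: U_def scalar_prod_def atLeast0LessThan)
  qed (auto simp: U_def)
  have fB: "k < R \<Longrightarrow> f k \<in> \<B>" for k using f by (auto simp: bij_betw_def)
  have UU: "transpose_mat U * U = real q \<cdot>\<^sub>m 1\<^sub>m R"
  proof (rule eq_matI)
    fix i j assume "i < dim_row (real q \<cdot>\<^sub>m 1\<^sub>m R)" "j < dim_col (real q \<cdot>\<^sub>m 1\<^sub>m R)"
    then have ij: "i < R" "j < R" by auto
    have "(transpose_mat U * U) $$ (i, j) = (\<Sum>k<p. indicator (f i) k * indicator (f j) k)"
      using ij by (simp add: U_def scalar_prod_def atLeast0LessThan)
    also have "\<dots> = real (card (f i \<inter> f j))"
    proof -
      have "f i \<inter> f j \<subseteq> {..<p}" using fB[OF ij(1)] block_subset by auto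
      then have "{..<p} \<inter> (f i \<inter> f j) = f i \<inter> f j" by auto
      moreover have "(\<Sum>k<p. indicator (f i) k * indicator (f j) k :: real)
          = (\<Sum>k<p. if k \<in> f i \<inter> f j then 1 else 0)"
        by (intro sum.cong) (auto simp: indicator_def)
      moreover have "\<dots> = real (card ({..<p} \<inter> (f i \<inter> f j)))"
        by (simp add: sum.If_cases Int_def)
      ultimately show ?thesis by simp
    qed
    also have "\<dots> = (if i = j then real q else 0)"
    proof (cases "i = j")
      case False
      then have "f i \<noteq> f j" using f ij by (auto simp: bij_betw_def inj_on_def)
      then have "f i \<inter> f j = {}"
        using fB ij partition_onD2[OF partition] by (auto simp: disjoint_def)
      then show ?thesis using False by simp
    qed (use fB ij card_block in auto)
    finally show "(transpose_mat U * U) $$ (i, j) = (real q \<cdot>\<^sub>m 1\<^sub>m R) $$ (i, j)"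
      using ij by simp
  qed (auto simp: U_def)
  have "group_cov p \<gamma> \<B> = a \<cdot>\<^sub>m (1\<^sub>m p + ((\<gamma> / a) \<cdot>\<^sub>m U) * transpose_mat U)"
    unfolding group_cov_eq JU using U a_pos
    by (subst add_smult_distrib_left_mat[of _ p p])
       (auto simp: mult_smult_assoc_mat[of _ p R] smult_smult_times)
  then have "Determinant.det (group_cov p \<gamma> \<B>)
      = a ^ p * Determinant.det (1\<^sub>m p + ((\<gamma> / a) \<cdot>\<^sub>m U) * transpose_mat U)"
    using U by simp
  also have "Determinant.det (1\<^sub>m p + ((\<gamma> / a) \<cdot>\<^sub>m U) * transpose_mat U)
      = Determinant.det (1\<^sub>m R + transpose_mat U * ((\<gamma> / a) \<cdot>\<^sub>m U))"
    using U by (intro det_one_plus_mult_commute) auto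
  also have "1\<^sub>m R + transpose_mat U * ((\<gamma> / a) \<cdot>\<^sub>m U) = (V / a) \<cdot>\<^sub>m 1\<^sub>m R"
    using U a_pos
    by (simp add: mult_smult_distrib[of _ R p] UU smult_smult_times)
       (rule eq_matI, auto simp: V_def field_simps)
  finally show ?thesis by simp
qed

lemma normal_density_vec_eq:
  "normal_density_vec p m (group_cov p \<gamma> \<B>) x
     = exp (- cinner (\<lambda>i. x i - m i) (\<lambda>i. x i - m i) / 2)
        / sqrt ((2 * pi) ^ p * (a ^ p * (V / a) ^ R))"
proof -
  define v where "v = Matrix.vec p (\<lambda>i. x i - m i)"
  let ?u = "\<lambda>i. x i - m i"
  have v: "v \<in> carrier_vec p" by (simp add: v_def)
  have Jv: "Matrix.scalar_prod v (J *\<^sub>v v) = (\<Sum>B\<in>\<B>. (\<Sum>i\<in>B. ?u i) * (\<Sum>i\<in>B. ?u i))"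
  proof -
    have "Matrix.scalar_prod v (J *\<^sub>v v)
        = (\<Sum>i<p. ?u i * (\<Sum>j<p. (if j \<in> blk i then 1 else 0) * ?u j))"
      by (simp add: scalar_prod_def v_def atLeast0LessThan)
        (intro sum.cong refl arg_cong2[of _ _ _ _ "(*)"], simp_all add: J_entry)
    also have "\<dots> = (\<Sum>i<p. ?u i * (\<Sum>j\<in>blk i. ?u j))"
    proof (intro sum.cong refl)
      fix i assume "i \<in> {..<p}"
      then have "{..<p} \<inter> blk i = blk i" using blk_in block_subset by blast
      then show "?u i * (\<Sum>j<p. (if j \<in> blk i then 1 else 0) * ?u j) = ?u i * (\<Sum>j\<in>blk i. ?u j)"
        by (simp add: if_distrib[of "\<lambda>c. c * _"] sum.If_cases cong: if_cong)
    qed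
    also have "\<dots> = (\<Sum>B\<in>\<B>. \<Sum>i\<in>B. ?u i * (\<Sum>j\<in>B. ?u j))"
      unfolding sum_blocks[symmetric] by (intro sum.cong refl) (simp add: blk_eq)
    finally show ?thesis by (simp add: sum_distrib_right)
  qed
  have "Matrix.scalar_prod v (((1 / a) \<cdot>\<^sub>m 1\<^sub>m p + (- \<gamma> / (a * V)) \<cdot>\<^sub>m J) *\<^sub>v v)
      = (1 / a) * Matrix.scalar_prod v v + (- \<gamma> / (a * V)) * Matrix.scalar_prod v (J *\<^sub>v v)"
    using v
    by (subst add_mult_distrib_mat_vec[of _ p p])
       (auto simp: smult_mat_vec scalar_prod_add_distrib[where n = p]
          scalar_prod_smult_distrib[where n = p] mult_mat_vec_carrier[of _ p p])
  also have "\<dots> = cinner ?u ?u"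
    unfolding Jv cinner_def using a_pos V_pos
    by (simp add: v_def scalar_prod_def atLeast0LessThan diff_divide_distrib mult.commute)
  finally show ?thesis
    by (simp add: normal_density_vec_def Let_def v_def[symmetric] inverse_group_cov det_group_cov)
qed

end

section \<open>The observation as a mixture of product laws\<close>

lemma product_sigma_finite_lborel: "product_sigma_finite (\<lambda>_::'i. lborel :: real measure)"
  by (simp add: product_sigma_finite_def lborel.sigma_finite_measure_axioms)

text \<open>Both measures are determined by their values on boxes, where each is the same product of one-dimensional integrals.\<close>

lemma PiM_density_lborel:
  fixes f :: "'i \<Rightarrow> real \<Rightarrow> ennreal"
  assumes I: "finite I" and f[measurable]: "\<And>i. f i \<in> borel_measurable borel"
    and prob: "\<And>i. prob_space (density lborel (f i))"
  shows "density (PiM I (\<lambda>_. lborel)) (\<lambda>x. \<Prod>i\<in>I. f i (x i)) = PiM I (\<lambda>i. density lborel (f i))"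
proof -
  interpret L: product_sigma_finite "\<lambda>_::'i. lborel :: real measure"
    by (rule product_sigma_finite_lborel)
  interpret N: product_sigma_finite "\<lambda>i. density lborel (f i)"
    unfolding product_sigma_finite_def using prob by (auto intro: prob_space_imp_sigma_finite)
  show ?thesis
  proof (rule N.PiM_eqI[OF I])
    show "sets (density (PiM I (\<lambda>_. lborel)) (\<lambda>x. \<Prod>i\<in>I. f i (x i)))
        = sets (PiM I (\<lambda>i. density lborel (f i)))"
      unfolding sets_density by (rule sets_PiM_cong) auto
    fix A :: "'i \<Rightarrow> real set"
    assume "\<And>i. i \<in> I \<Longrightarrow> A i \<in> sets (density lborel (f i))"
    then have A[measurable]: "\<And>i. i \<in> I \<Longrightarrow> A i \<in> sets borel" by simp
    have [measurable]: "PiE I A \<in> sets (PiM I (\<lambda>_. lborel))"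
      using I A by (intro sets_PiM_I_finite) auto
    have [measurable]: "i \<in> I \<Longrightarrow> (\<lambda>x. f i (x i)) \<in> borel_measurable (PiM I (\<lambda>_. lborel))" for i
      by (rule measurable_compose[OF measurable_component_singleton[of i I "\<lambda>_. lborel"]]) auto
    have "emeasure (density (PiM I (\<lambda>_. lborel)) (\<lambda>x. \<Prod>i\<in>I. f i (x i))) (PiE I A)
        = (\<integral>\<^sup>+x. (\<Prod>i\<in>I. f i (x i)) * indicator (PiE I A) x \<partial>PiM I (\<lambda>_. lborel))"
      by (subst emeasure_density) auto
    also have "\<dots> = (\<integral>\<^sup>+x. (\<Prod>i\<in>I. f i (x i) * indicator (A i) (x i)) \<partial>PiM I (\<lambda>_. lborel))"
    proof (intro nn_integral_cong)
      fix x :: "'i \<Rightarrow> real" assume "x \<in> space (PiM I (\<lambda>_. lborel))"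
      then have "indicator (PiE I A) x = (\<Prod>i\<in>I. indicator (A i) (x i) :: ennreal)"
        using I by (auto simp: indicator_def space_PiM PiE_iff prod_zero_iff)
      then show "(\<Prod>i\<in>I. f i (x i)) * indicator (PiE I A) x
          = (\<Prod>i\<in>I. f i (x i) * indicator (A i) (x i))"
        by (simp add: prod.distrib)
    qed
    also have "\<dots> = (\<Prod>i\<in>I. \<integral>\<^sup>+x. f i x * indicator (A i) x \<partial>lborel)"
      by (rule L.product_nn_integral_prod[OF I]) (use A in measurable)
    also have "\<dots> = (\<Prod>i\<in>I. emeasure (density lborel (f i)) (A i))"
      using A by (intro prod.cong) (auto simp: emeasure_density)
    finally show "emeasure (density (PiM I (\<lambda>_. lborel)) (\<lambda>x. \<Prod>i\<in>I. f i (x i))) (PiE I A)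
        = (\<Prod>i\<in>I. emeasure (density lborel (f i)) (A i))" .
  qed
qed

lemma PiM_distr:
  assumes I: "finite I" and prob: "\<And>i. prob_space (M i)"
    and f[measurable]: "\<And>i. f i \<in> M i \<rightarrow>\<^sub>M N i"
  shows "distr (PiM I M) (PiM I N) (\<lambda>x. \<lambda>i\<in>I. f i (x i)) = PiM I (\<lambda>i. distr (M i) (N i) (f i))"
proof -
  interpret M: product_sigma_finite M
    unfolding product_sigma_finite_def using prob by (auto intro: prob_space_imp_sigma_finite)
  interpret D: product_sigma_finite "\<lambda>i. distr (M i) (N i) (f i)"
    unfolding product_sigma_finite_def
    by (intro allI prob_space_imp_sigma_finite prob_space.prob_space_distr prob f)
  have m[measurable]: "(\<lambda>x. \<lambda>i\<in>I. f i (x i)) \<in> PiM I M \<rightarrow>\<^sub>M PiM I N"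
    by measurable
  show ?thesis
  proof (rule D.PiM_eqI[OF I])
    show "sets (distr (PiM I M) (PiM I N) (\<lambda>x. \<lambda>i\<in>I. f i (x i)))
        = sets (PiM I (\<lambda>i. distr (M i) (N i) (f i)))"
      unfolding sets_distr by (rule sets_PiM_cong) auto
    fix A
    assume "\<And>i. i \<in> I \<Longrightarrow> A i \<in> sets (distr (M i) (N i) (f i))"
    then have A: "\<And>i. i \<in> I \<Longrightarrow> A i \<in> sets (N i)" by simp
    have "(\<lambda>x. \<lambda>i\<in>I. f i (x i)) -` PiE I A \<inter> space (PiM I M)
        = PiE I (\<lambda>i. f i -` A i \<inter> space (M i))"
      by (auto simp: space_PiM PiE_iff extensional_def)
    then have "emeasure (distr (PiM I M) (PiM I N) (\<lambda>x. \<lambda>i\<in>I. f i (x i))) (PiE I A)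
        = emeasure (PiM I M) (PiE I (\<lambda>i. f i -` A i \<inter> space (M i)))"
      using A I by (subst emeasure_distr) auto
    also have "\<dots> = (\<Prod>i\<in>I. emeasure (M i) (f i -` A i \<inter> space (M i)))"
      using A by (intro M.emeasure_PiM[OF I]) (auto intro: measurable_sets[OF f])
    also have "\<dots> = (\<Prod>i\<in>I. emeasure (distr (M i) (N i) (f i)) (A i))"
      using A by (intro prod.cong) (auto simp: emeasure_distr)
    finally show "emeasure (distr (PiM I M) (PiM I N) (\<lambda>x. \<lambda>i\<in>I. f i (x i))) (PiE I A)
        = (\<Prod>i\<in>I. emeasure (distr (M i) (N i) (f i)) (A i))" .
  qed
qed

definition std_gauss :: "real measure" where
  "std_gauss = density lborel (\<lambda>x. ennreal (std_normal_density x))"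

definition gauss_prod :: "'i set \<Rightarrow> ('i \<Rightarrow> real) measure" where
  "gauss_prod I = PiM I (\<lambda>_. std_gauss)"

lemma prob_space_std_gauss: "prob_space std_gauss"
  unfolding std_gauss_def by (rule prob_space_normal_density) simp

lemma sets_std_gauss[measurable_cong]: "sets std_gauss = sets borel"
  by (simp add: std_gauss_def)

lemma space_std_gauss[simp]: "space std_gauss = UNIV"
  by (simp add: std_gauss_def)

lemma sets_gauss_prod[measurable_cong]: "sets (gauss_prod I) = sets (PiM I (\<lambda>_. borel))"
  unfolding gauss_prod_def by (rule sets_PiM_cong) (auto simp: sets_std_gauss)

lemma space_gauss_prod[simp]: "space (gauss_prod I) = PiE I (\<lambda>_. UNIV)"
  by (simp add: gauss_prod_def space_PiM)

lemma prob_space_gauss_prod: "prob_space (gauss_prod I)"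
  unfolding gauss_prod_def by (intro prob_space_PiM prob_space_std_gauss)

lemma normal_density_eq_distr_std_gauss:
  assumes "0 < \<sigma>"
  shows "density lborel (\<lambda>x. ennreal (normal_density \<mu> \<sigma> x)) = distr std_gauss borel (\<lambda>z. \<mu> + \<sigma> * z)"
proof -
  interpret prob_space std_gauss by (rule prob_space_std_gauss)
  have "distributed std_gauss lborel (\<lambda>x. x) (\<lambda>x. ennreal (std_normal_density x))"
    by (auto simp: distributed_def std_gauss_def intro!: distr_id2)
  from normal_density_affine[OF this, of \<sigma> \<mu>] assms
  have "distributed std_gauss lborel (\<lambda>z. \<mu> + \<sigma> * z) (\<lambda>x. ennreal (normal_density \<mu> \<sigma> x))"
    by simp
  then have "distr std_gauss lborel (\<lambda>z. \<mu> + \<sigma> * z) = density lborel (\<lambda>x. ennreal (normal_density \<mu> \<sigma> x))"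
    by (rule distributed_distr_eq_density)
  then show ?thesis by (metis distr_cong sets_lborel)
qed

lemma gauss_prod_affine:
  assumes I: "finite I" and \<sigma>: "0 < \<sigma>"
  shows "density (PiM I (\<lambda>_. lborel)) (\<lambda>x. \<Prod>i\<in>I. ennreal (normal_density (\<mu> i) \<sigma> (x i)))
    = distr (gauss_prod I) (PiM I (\<lambda>_. borel)) (\<lambda>z. \<lambda>i\<in>I. \<mu> i + \<sigma> * z i)"
proof -
  have "density (PiM I (\<lambda>_. lborel)) (\<lambda>x. \<Prod>i\<in>I. ennreal (normal_density (\<mu> i) \<sigma> (x i)))
      = PiM I (\<lambda>i. density lborel (\<lambda>x. ennreal (normal_density (\<mu> i) \<sigma> x)))"
    using \<sigma> by (intro PiM_density_lborel[OF I] prob_space_normal_density) auto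
  also have "\<dots> = PiM I (\<lambda>i. distr std_gauss borel (\<lambda>z. \<mu> i + \<sigma> * z))"
    using \<sigma> by (simp add: normal_density_eq_distr_std_gauss)
  also have "\<dots> = distr (gauss_prod I) (PiM I (\<lambda>_. borel)) (\<lambda>z. \<lambda>i\<in>I. \<mu> i + \<sigma> * z i)"
    unfolding gauss_prod_def
    by (rule PiM_distr[symmetric, OF I prob_space_std_gauss]) measurable
  finally show ?thesis .
qed

text \<open>The exponent of the joint density of the common shift w and of a block, as a square in w plus the exponent of the marginal density.\<close>

lemma complete_square:
  fixes a V w s :: real
  assumes "0 < a" "0 < V"
  shows "- w\<^sup>2 / 2 + - (S2 - 2 * (s * w) * S1 + (V - a) * w\<^sup>2) / (2 * a)
    = - ((S2 - (s * s) / V * (S1 * S1)) / a) / 2 + - (w - s * S1 / V)\<^sup>2 / (2 * (a / V))"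
  using assms by (simp add: power2_eq_square divide_simps) (simp add: algebra_simps)

context block_model
begin

definition dens_const :: real where
  "dens_const = sqrt ((2 * pi) ^ p * (a ^ p * (V / a) ^ R))"

definition dens :: "(nat \<Rightarrow> real) \<Rightarrow> (nat \<Rightarrow> real) \<Rightarrow> real" where
  "dens \<theta> x = exp (- cinner (\<lambda>i. x i - \<theta> i) (\<lambda>i. x i - \<theta> i) / 2) / dens_const"

lemma dens_const_pos: "0 < dens_const"
  unfolding dens_const_def using a_pos V_pos by simp

lemma dens_pos: "0 < dens \<theta> x"
  unfolding dens_def using dens_const_pos by simp

abbreviation obs :: "(nat \<Rightarrow> real) \<Rightarrow> (nat \<Rightarrow> real) measure" where
  "obs \<equiv> obs_law p \<gamma> \<B>"

lemma obs_law_eq: "obs \<theta> = density (lborel_euclid p) (\<lambda>x. ennreal (dens \<theta> x))"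
  by (simp add: obs_law_def normal_law_def normal_density_vec_eq dens_def dens_const_def)

lemma measurable_dens[measurable]: "dens \<theta> \<in> borel_measurable (borel_euclid p)"
proof -
  have [measurable]: "B \<in> \<B> \<Longrightarrow> i \<in> B \<Longrightarrow> (\<lambda>x. x i) \<in> borel_measurable (borel_euclid p)" for B i
    using block_subset by (intro measurable_component_singleton) auto
  show ?thesis unfolding dens_def cinner_def by measurable
qed

lemma measurable_dens_lborel[measurable]: "dens \<theta> \<in> borel_measurable (lborel_euclid p)"
proof -
  have "sets (lborel_euclid p) = sets (borel_euclid p)" by (intro sets_PiM_cong) auto
  then show ?thesis using measurable_dens measurable_cong_sets by blast
qed

lemma sets_obs_law[measurable_cong]: "sets (obs \<theta>) = sets (borel_euclid p)"
  unfolding obs_law_eq sets_density by (rule sets_PiM_cong) auto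

lemma space_obs_law[simp]: "space (obs \<theta>) = euclid p"
  by (simp add: obs_law_eq space_PiM)

lemma sets_Collect_euclid:
  assumes "Measurable.pred (borel_euclid p) P"
  shows "{x \<in> euclid p. P x} \<in> sets (borel_euclid p)"
  using assms unfolding pred_def by (simp add: space_PiM)

text \<open>Integrating the common shift out of one block: after completing the square, the integrand is a multiple of a normal density in w.\<close>

lemma nn_integral_block_density:
  fixes v :: "nat \<Rightarrow> real"
  assumes B: "finite B" "card B = q"
  shows "(\<integral>\<^sup>+w. (\<Prod>i\<in>B. ennreal (normal_density (sqrt \<gamma> * w) (sqrt a) (v i))) \<partial>std_gauss)
    = ennreal (sqrt (a / V) / sqrt (2 * pi * a) ^ q
        * exp (- (((\<Sum>i\<in>B. v i * v i) - \<gamma> / V * ((\<Sum>i\<in>B. v i) * (\<Sum>i\<in>B. v i))) / a) / 2))"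
    (is "_ = ennreal ?K")
proof -
  let ?S1 = "\<Sum>i\<in>B. v i" and ?S2 = "\<Sum>i\<in>B. v i * v i"
  have key: "std_normal_density w * (\<Prod>i\<in>B. normal_density (sqrt \<gamma> * w) (sqrt a) (v i))
      = ?K * normal_density (sqrt \<gamma> * ?S1 / V) (sqrt (a / V)) w" for w
  proof -
    have sq: "(\<Sum>i\<in>B. (v i - sqrt \<gamma> * w)\<^sup>2) = ?S2 - 2 * (sqrt \<gamma> * w) * ?S1 + real q * (\<gamma> * w\<^sup>2)"
    proof -
      have "(\<Sum>i\<in>B. (v i - sqrt \<gamma> * w)\<^sup>2)
          = (\<Sum>i\<in>B. v i * v i - 2 * (sqrt \<gamma> * w) * v i + \<gamma> * w\<^sup>2)"
      proof (intro sum.cong refl)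
        fix i
        have "(sqrt \<gamma> * w)\<^sup>2 = \<gamma> * w\<^sup>2"
          using \<gamma>_nonneg by (simp add: power_mult_distrib)
        moreover have "(v i - y)\<^sup>2 = v i * v i - 2 * y * v i + y\<^sup>2" for y
          by (simp add: power2_eq_square algebra_simps)
        ultimately show "(v i - sqrt \<gamma> * w)\<^sup>2 = v i * v i - 2 * (sqrt \<gamma> * w) * v i + \<gamma> * w\<^sup>2"
          by simp
      qed
      also have "\<dots> = ?S2 - 2 * (sqrt \<gamma> * w) * ?S1 + real q * (\<gamma> * w\<^sup>2)"
        by (simp add: sum.distrib sum_subtractf sum_distrib_left[symmetric] B)
      finally show ?thesis .
    qed
    have "(\<Prod>i\<in>B. normal_density (sqrt \<gamma> * w) (sqrt a) (v i))
        = (1 / sqrt (2 * pi * a)) ^ q * exp (\<Sum>i\<in>B. - (v i - sqrt \<gamma> * w)\<^sup>2 / (2 * a))"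
      using a_pos B by (simp add: normal_density_def prod_dividef exp_sum power_divide)
    also have "(\<Sum>i\<in>B. - (v i - sqrt \<gamma> * w)\<^sup>2 / (2 * a)) = - (\<Sum>i\<in>B. (v i - sqrt \<gamma> * w)\<^sup>2) / (2 * a)"
      by (simp add: sum_divide_distrib[symmetric] sum_negf)
    finally have 1: "(\<Prod>i\<in>B. normal_density (sqrt \<gamma> * w) (sqrt a) (v i))
        = (1 / sqrt (2 * pi * a)) ^ q * exp (- (?S2 - 2 * (sqrt \<gamma> * w) * ?S1 + real q * (\<gamma> * w\<^sup>2)) / (2 * a))"
      unfolding sq .
    have expo: "- w\<^sup>2 / 2 + - (?S2 - 2 * (sqrt \<gamma> * w) * ?S1 + real q * (\<gamma> * w\<^sup>2)) / (2 * a)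
      = - ((?S2 - \<gamma> / V * (?S1 * ?S1)) / a) / 2 + - (w - sqrt \<gamma> * ?S1 / V)\<^sup>2 / (2 * (a / V))"
    proof -
      have "real q * (\<gamma> * w\<^sup>2) = (V - a) * w\<^sup>2" by (simp add: V_def)
      moreover have "sqrt \<gamma> * sqrt \<gamma> = \<gamma>" using \<gamma>_nonneg by simp
      ultimately show ?thesis
        using complete_square[OF a_pos V_pos, of w ?S2 "sqrt \<gamma>" ?S1] by (simp only:)
    qed
    have c: "1 / sqrt (2 * pi) = sqrt (a / V) * (1 / sqrt (2 * pi * (a / V)))"
      using a_pos V_pos by (simp add: real_sqrt_mult real_sqrt_divide)
    have "std_normal_density w * (\<Prod>i\<in>B. normal_density (sqrt \<gamma> * w) (sqrt a) (v i))
      = 1 / sqrt (2 * pi) * (1 / sqrt (2 * pi * a)) ^ q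
        * exp (- w\<^sup>2 / 2 + - (?S2 - 2 * (sqrt \<gamma> * w) * ?S1 + real q * (\<gamma> * w\<^sup>2)) / (2 * a))"
      unfolding 1 exp_add by (simp add: std_normal_density_def)
    also have "\<dots> = ?K * normal_density (sqrt \<gamma> * ?S1 / V) (sqrt (a / V)) w"
      unfolding expo c exp_add using a_pos V_pos
      by (simp add: normal_density_def power_divide mult_ac)
    finally show ?thesis .
  qed
  have K: "0 \<le> ?K" using a_pos V_pos by simp
  have s: "0 < sqrt (a / V)" using a_pos V_pos by simp
  have "(\<integral>\<^sup>+w. (\<Prod>i\<in>B. ennreal (normal_density (sqrt \<gamma> * w) (sqrt a) (v i))) \<partial>std_gauss)
      = (\<integral>\<^sup>+w. ennreal (std_normal_density w) * (\<Prod>i\<in>B. ennreal (normal_density (sqrt \<gamma> * w) (sqrt a) (v i))) \<partial>lborel)"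
    unfolding std_gauss_def by (subst nn_integral_density) (auto, unfold normal_density_def, measurable)
  also have "\<dots> = (\<integral>\<^sup>+w. ennreal ?K * ennreal (normal_density (sqrt \<gamma> * ?S1 / V) (sqrt (a / V)) w) \<partial>lborel)"
  proof (intro nn_integral_cong)
    fix w
    have "ennreal (std_normal_density w) * (\<Prod>i\<in>B. ennreal (normal_density (sqrt \<gamma> * w) (sqrt a) (v i)))
        = ennreal (std_normal_density w * (\<Prod>i\<in>B. normal_density (sqrt \<gamma> * w) (sqrt a) (v i)))"
      by (simp add: prod_ennreal ennreal_mult prod_nonneg)
    then show "ennreal (std_normal_density w) * (\<Prod>i\<in>B. ennreal (normal_density (sqrt \<gamma> * w) (sqrt a) (v i)))
        = ennreal ?K * ennreal (normal_density (sqrt \<gamma> * ?S1 / V) (sqrt (a / V)) w)"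
      unfolding key by (simp only: ennreal_mult[OF K normal_density_nonneg])
  qed
  also have "\<dots> = ennreal ?K * (\<integral>\<^sup>+w. ennreal (normal_density (sqrt \<gamma> * ?S1 / V) (sqrt (a / V)) w) \<partial>lborel)"
    by (rule nn_integral_cmult) auto
  also have "(\<integral>\<^sup>+w. ennreal (normal_density (sqrt \<gamma> * ?S1 / V) (sqrt (a / V)) w) \<partial>lborel) = 1"
    using s by (subst nn_integral_eq_integral) auto
  finally show ?thesis by simp
qed

text \<open>The blocks are independent, so the marginal density is a product of the integrals over the individual shifts.\<close>

lemma dens_mixture:
  "ennreal (dens \<theta> x)
    = (\<integral>\<^sup>+w. (\<Prod>i<p. ennreal (normal_density (\<theta> i + sqrt \<gamma> * w (blk i)) (sqrt a) (x i))) \<partial>gauss_prod \<B>)"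
proof -
  interpret product_sigma_finite "\<lambda>_::nat set. std_gauss"
    unfolding product_sigma_finite_def using prob_space_std_gauss by (auto intro: prob_space_imp_sigma_finite)
  let ?v = "\<lambda>i. x i - \<theta> i"
  have shift: "normal_density (m + c) s y = normal_density c s (y - m)" for m c s y :: real
    by (simp add: normal_density_def algebra_simps)
  have "(\<integral>\<^sup>+w. (\<Prod>i<p. ennreal (normal_density (\<theta> i + sqrt \<gamma> * w (blk i)) (sqrt a) (x i))) \<partial>gauss_prod \<B>)
    = (\<integral>\<^sup>+w. (\<Prod>B\<in>\<B>. \<Prod>i\<in>B. ennreal (normal_density (sqrt \<gamma> * w B) (sqrt a) (?v i))) \<partial>gauss_prod \<B>)"
    unfolding prod_blocks[symmetric]
    by (intro nn_integral_cong prod.cong refl) (simp add: blk_eq shift)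
  also have "\<dots> = (\<Prod>B\<in>\<B>. \<integral>\<^sup>+w. (\<Prod>i\<in>B. ennreal (normal_density (sqrt \<gamma> * w) (sqrt a) (?v i))) \<partial>std_gauss)"
    unfolding gauss_prod_def
    by (rule product_nn_integral_prod[OF finite_blocks]) (unfold std_gauss_def normal_density_def, measurable)
  also have "\<dots> = (\<Prod>B\<in>\<B>. ennreal (sqrt (a / V) / sqrt (2 * pi * a) ^ q
        * exp (- (((\<Sum>i\<in>B. ?v i * ?v i) - \<gamma> / V * ((\<Sum>i\<in>B. ?v i) * (\<Sum>i\<in>B. ?v i))) / a) / 2)))"
    by (intro prod.cong refl nn_integral_block_density finite_block card_block)
  also have "\<dots> = ennreal ((\<Prod>B\<in>\<B>. sqrt (a / V) / sqrt (2 * pi * a) ^ q)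
        * exp (\<Sum>B\<in>\<B>. - (((\<Sum>i\<in>B. ?v i * ?v i) - \<gamma> / V * ((\<Sum>i\<in>B. ?v i) * (\<Sum>i\<in>B. ?v i))) / a) / 2))"
  proof -
    have "0 \<le> sqrt (a / V) / sqrt (2 * pi * a) ^ q * exp y" for y
      using a_pos V_pos by simp
    then show ?thesis by (simp only: prod_ennreal prod.distrib exp_sum[OF finite_blocks])
  qed
  also have "(\<Prod>B\<in>\<B>. sqrt (a / V) / sqrt (2 * pi * a) ^ q) = 1 / dens_const"
  proof -
    have "sqrt ((2 * pi) ^ p * (a ^ p * (V / a) ^ R)) = (sqrt (2 * pi * a) ^ q) ^ R * sqrt (V / a) ^ R"
      by (simp add: p_eq power_mult real_sqrt_mult real_sqrt_power power_mult_distrib)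
    then show ?thesis
      unfolding dens_const_def using a_pos V_pos
      by (simp add: card_blocks power_divide real_sqrt_divide power_mult_distrib)
  qed
  also have "(\<Sum>B\<in>\<B>. - (((\<Sum>i\<in>B. ?v i * ?v i) - \<gamma> / V * ((\<Sum>i\<in>B. ?v i) * (\<Sum>i\<in>B. ?v i))) / a) / 2)
     = - cinner ?v ?v / 2"
    unfolding cinner_def
    by (simp add: sum_negf sum_divide_distrib[symmetric] sum_subtractf sum_distrib_left[symmetric] sum_blocks)
  finally show ?thesis by (simp add: dens_def)
qed

text \<open>The representation of the observation as signal, plus a common shift of each block, plus independent noise.
It shows in particular that the density has total mass one, and it is the reason why differences within blocks do not feel the
correlation.\<close>

lemma nn_integral_obs_law:
  assumes F[measurable]: "F \<in> borel_measurable (borel_euclid p)"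
  shows "(\<integral>\<^sup>+x. F x \<partial>obs \<theta>)
    = (\<integral>\<^sup>+w. \<integral>\<^sup>+z. F (\<lambda>i\<in>{..<p}. \<theta> i + sqrt \<gamma> * w (blk i) + sqrt a * z i) \<partial>gauss_prod {..<p} \<partial>gauss_prod \<B>)"
proof -
  let ?G = "\<lambda>w x. \<Prod>i<p. ennreal (normal_density (\<theta> i + sqrt \<gamma> * w (blk i)) (sqrt a) (x i))"
  have s: "sets (lborel_euclid p) = sets (borel_euclid p)" by (intro sets_PiM_cong) auto
  have F'[measurable]: "F \<in> borel_measurable (lborel_euclid p)"
    using F measurable_cong_sets[OF s refl] by blast
  interpret W: prob_space "gauss_prod \<B>" by (rule prob_space_gauss_prod)
  interpret L: product_sigma_finite "\<lambda>_::nat. lborel :: real measure"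
    by (rule product_sigma_finite_lborel)
  interpret L': sigma_finite_measure "lborel_euclid p"
    by (rule L.sigma_finite) simp
  interpret pair_sigma_finite "lborel_euclid p" "gauss_prod \<B>" ..
  have wblk[measurable]: "i \<in> {..<p} \<Longrightarrow> (\<lambda>w. w (blk i)) \<in> borel_measurable (gauss_prod \<B>)" for i
    unfolding measurable_cong_sets[OF sets_gauss_prod refl]
    using blk_in by (intro measurable_component_singleton) auto
  have xi[measurable]: "i \<in> {..<p} \<Longrightarrow> (\<lambda>x. x i) \<in> borel_measurable (lborel_euclid p)" for i
    using measurable_component_singleton[of i "{..<p}" "\<lambda>_. lborel :: real measure"] by simp
  have G[measurable]: "(\<lambda>(x, w). ?G w x) \<in> borel_measurable (lborel_euclid p \<Otimes>\<^sub>M gauss_prod \<B>)"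
    unfolding normal_density_def split_beta by measurable
  have "(\<integral>\<^sup>+x. F x \<partial>obs \<theta>) = (\<integral>\<^sup>+x. ennreal (dens \<theta> x) * F x \<partial>lborel_euclid p)"
    unfolding obs_law_eq by (rule nn_integral_density) auto
  also have "\<dots> = (\<integral>\<^sup>+x. \<integral>\<^sup>+w. ?G w x * F x \<partial>gauss_prod \<B> \<partial>lborel_euclid p)"
  proof (rule nn_integral_cong)
    fix x assume "x \<in> space (lborel_euclid p)"
    then have "(\<lambda>w. ?G w x) \<in> borel_measurable (gauss_prod \<B>)"
      using measurable_compose[OF measurable_Pair1' G] by simp
    then show "ennreal (dens \<theta> x) * F x = (\<integral>\<^sup>+w. ?G w x * F x \<partial>gauss_prod \<B>)"
      unfolding dens_mixture by (rule nn_integral_multc[symmetric])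
  qed
  also have "\<dots> = (\<integral>\<^sup>+w. \<integral>\<^sup>+x. ?G w x * F x \<partial>lborel_euclid p \<partial>gauss_prod \<B>)"
  proof -
    have "(\<lambda>(x, w). ?G w x * F x) \<in> borel_measurable (lborel_euclid p \<Otimes>\<^sub>M gauss_prod \<B>)"
      using G by (simp add: split_beta) measurable
    from Fubini'[OF this] show ?thesis by simp
  qed
  also have "\<dots> = (\<integral>\<^sup>+w. \<integral>\<^sup>+z. F (\<lambda>i\<in>{..<p}. \<theta> i + sqrt \<gamma> * w (blk i) + sqrt a * z i) \<partial>gauss_prod {..<p} \<partial>gauss_prod \<B>)"
  proof (rule nn_integral_cong)
    fix w
    let ?\<mu> = "\<lambda>i. \<theta> i + sqrt \<gamma> * w (blk i)"
    have "(\<integral>\<^sup>+x. ?G w x * F x \<partial>lborel_euclid p) = (\<integral>\<^sup>+x. F x \<partial>density (lborel_euclid p) (?G w))"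
      by (subst nn_integral_density) (auto simp: normal_density_def)
    also have "\<dots> = (\<integral>\<^sup>+x. F x \<partial>distr (gauss_prod {..<p}) (borel_euclid p) (\<lambda>z. \<lambda>i\<in>{..<p}. ?\<mu> i + sqrt a * z i))"
      using a_pos by (subst gauss_prod_affine) auto
    also have "\<dots> = (\<integral>\<^sup>+z. F (\<lambda>i\<in>{..<p}. ?\<mu> i + sqrt a * z i) \<partial>gauss_prod {..<p})"
      by (rule nn_integral_distr) auto
    finally show "(\<integral>\<^sup>+x. ?G w x * F x \<partial>lborel_euclid p) = (\<integral>\<^sup>+z. F (\<lambda>i\<in>{..<p}. ?\<mu> i + sqrt a * z i) \<partial>gauss_prod {..<p})" .
  qed
  finally show ?thesis .
qed

lemma prob_space_obs_law: "prob_space (obs \<theta>)"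
proof
  interpret W: prob_space "gauss_prod \<B>" by (rule prob_space_gauss_prod)
  interpret Z: prob_space "gauss_prod {..<p}" by (rule prob_space_gauss_prod)
  have "emeasure (obs \<theta>) (space (obs \<theta>)) = (\<integral>\<^sup>+x. 1 \<partial>obs \<theta>)"
    by simp
  also have "\<dots> = 1"
    by (subst nn_integral_obs_law) (auto simp: W.emeasure_space_1[simplified] Z.emeasure_space_1[simplified])
  finally show "emeasure (obs \<theta>) (space (obs \<theta>)) = 1" .
qed

text \<open>Events that are invariant under a shift of every block do not see the common noise, hence have the same
probability as under independent noise of variance 1 - \<gamma>.\<close>

lemma measure_obs_law_shift_invariant:
  assumes A[measurable]: "A \<in> sets (borel_euclid p)"
    and inv: "\<And>x y c. x \<in> euclid p \<Longrightarrow> y \<in> euclid p \<Longrightarrow> (\<And>i. i < p \<Longrightarrow> y i = x i + c (blk i)) \<Longrightarrow> x \<in> A \<Longrightarrow> y \<in> A"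
  shows "measure (obs \<theta>) A
    = measure (gauss_prod {..<p}) {z \<in> euclid p. (\<lambda>i\<in>{..<p}. \<theta> i + sqrt a * z i) \<in> A}"
proof -
  interpret W: prob_space "gauss_prod \<B>" by (rule prob_space_gauss_prod)
  let ?f = "\<lambda>z. \<lambda>i\<in>{..<p}. \<theta> i + sqrt a * z i"
  have f: "?f \<in> gauss_prod {..<p} \<rightarrow>\<^sub>M borel_euclid p" by measurable
  have "emeasure (obs \<theta>) A = (\<integral>\<^sup>+x. indicator A x \<partial>obs \<theta>)"
    by (simp add: sets_obs_law)
  also have "\<dots> = (\<integral>\<^sup>+w. \<integral>\<^sup>+z. indicator A (\<lambda>i\<in>{..<p}. \<theta> i + sqrt \<gamma> * w (blk i) + sqrt a * z i) \<partial>gauss_prod {..<p} \<partial>gauss_prod \<B>)"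
    by (rule nn_integral_obs_law) auto
  also have "\<dots> = (\<integral>\<^sup>+w. \<integral>\<^sup>+z. indicator {z \<in> euclid p. ?f z \<in> A} z \<partial>gauss_prod {..<p} \<partial>gauss_prod \<B>)"
  proof (intro nn_integral_cong)
    fix w z assume "z \<in> space (gauss_prod {..<p})"
    then have z: "z \<in> euclid p" by simp
    let ?y = "\<lambda>i\<in>{..<p}. \<theta> i + sqrt \<gamma> * w (blk i) + sqrt a * z i"
    have "?y \<in> A \<longleftrightarrow> ?f z \<in> A"
      using inv[of ?y "?f z" "\<lambda>B. - sqrt \<gamma> * w B"] inv[of "?f z" ?y "\<lambda>B. sqrt \<gamma> * w B"] by auto
    then show "indicator A ?y = (indicator {z \<in> euclid p. ?f z \<in> A} z :: ennreal)"
      using z by (simp add: indicator_def)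
  qed
  also have "\<dots> = emeasure (gauss_prod {..<p}) {z \<in> euclid p. ?f z \<in> A}"
  proof -
    have "?f -` A \<inter> space (gauss_prod {..<p}) \<in> sets (gauss_prod {..<p})"
      using f A by (rule measurable_sets)
    moreover have "?f -` A \<inter> space (gauss_prod {..<p}) = {z \<in> euclid p. ?f z \<in> A}" by auto
    ultimately show ?thesis by (simp add: W.emeasure_space_1[simplified])
  qed
  finally show ?thesis by (simp add: measure_def)
qed


section \<open>Second moments of likelihood ratios\<close>

abbreviation origin :: "nat \<Rightarrow> real" where "origin \<equiv> \<lambda>i\<in>{..<p}. 0"

lemma cinner_cong:
  assumes "\<And>i. i < p \<Longrightarrow> x i = x' i" "\<And>i. i < p \<Longrightarrow> y i = y' i"
  shows "cinner x y = cinner x' y'"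
proof -
  have "i \<in> B \<Longrightarrow> B \<in> \<B> \<Longrightarrow> i < p" for i B using block_subset by auto
  with assms show ?thesis unfolding cinner_def by (intro arg_cong2[of _ _ _ _ "(/)"] arg_cong2[of _ _ _ _ "(-)"]
      arg_cong2[of _ _ _ _ "(*)"] sum.cong refl) auto
qed

lemma cinner_diff_left: "cinner (\<lambda>i. x i - y i) z = cinner x z - cinner y z"
  by (simp add: cinner_def sum_subtractf left_diff_distrib right_diff_distrib diff_divide_distrib)

lemma cinner_commute: "cinner x y = cinner y x"
  by (simp add: cinner_def mult.commute)

lemma cinner_diff_right: "cinner z (\<lambda>i. x i - y i) = cinner z x - cinner z y"
  by (metis cinner_commute cinner_diff_left)

lemma cinner_add_left: "cinner (\<lambda>i. x i + y i) z = cinner x z + cinner y z"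
  by (simp add: cinner_def sum.distrib distrib_left distrib_right add_divide_distrib diff_divide_distrib)

lemma cinner_add_right: "cinner z (\<lambda>i. x i + y i) = cinner z x + cinner z y"
  by (metis cinner_commute cinner_add_left)

text \<open>Completing the square: the product of two shifted densities is a multiple of a third one. With it, second moments of
likelihood ratios become total masses of Gaussian densities.\<close>

lemma dens_mult:
  "dens \<theta> x * dens \<theta>' x = exp (cinner \<theta> \<theta>') * dens (\<lambda>i. \<theta> i + \<theta>' i) x * dens origin x"
proof -
  have 0: "cinner (\<lambda>i. x i - origin i) (\<lambda>i. x i - origin i) = cinner x x"
    by (rule cinner_cong) auto
  have 1: "cinner (\<lambda>i. x i - (\<theta> i + \<theta>' i)) (\<lambda>i. x i - (\<theta> i + \<theta>' i))
      = cinner (\<lambda>i. x i - \<theta> i - \<theta>' i) (\<lambda>i. x i - \<theta> i - \<theta>' i)"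
    by (rule cinner_cong) auto
  have 2: "- cinner (\<lambda>i. x i - \<theta> i) (\<lambda>i. x i - \<theta> i) / 2 + - cinner (\<lambda>i. x i - \<theta>' i) (\<lambda>i. x i - \<theta>' i) / 2
    = cinner \<theta> \<theta>' + - cinner (\<lambda>i. x i - \<theta> i - \<theta>' i) (\<lambda>i. x i - \<theta> i - \<theta>' i) / 2 + - cinner x x / 2"
    by (simp add: cinner_diff_left cinner_diff_right cinner_add_left cinner_add_right cinner_commute[of x \<theta>] cinner_commute[of x \<theta>']
        cinner_commute[of \<theta>' \<theta>] field_simps)
  have "dens \<theta> x * dens \<theta>' x = exp (cinner \<theta> \<theta>' + - cinner (\<lambda>i. x i - \<theta> i - \<theta>' i) (\<lambda>i. x i - \<theta> i - \<theta>' i) / 2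
     + - cinner x x / 2) / (dens_const * dens_const)"
    unfolding dens_def 2[symmetric] exp_add by simp
  then show ?thesis unfolding dens_def 0 1 exp_add by simp
qed

lemma integrable_dens: "integrable (lborel_euclid p) (dens \<theta>)"
  and integral_dens: "(\<integral>x. dens \<theta> x \<partial>lborel_euclid p) = 1"
proof -
  interpret prob_space "obs \<theta>" by (rule prob_space_obs_law)
  have "(\<integral>\<^sup>+x. ennreal (dens \<theta> x) \<partial>lborel_euclid p) = emeasure (obs \<theta>) (space (obs \<theta>))"
    unfolding obs_law_eq by (subst emeasure_density) (auto intro!: nn_integral_cong)
  also have "\<dots> = ennreal 1" using emeasure_space_1 by simp
  finally have *: "(\<integral>\<^sup>+x. ennreal (dens \<theta> x) \<partial>lborel_euclid p) = ennreal 1" .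
  show i: "integrable (lborel_euclid p) (dens \<theta>)"
    using * dens_pos by (intro integrableI_nn_integral_finite[of _ _ 1]) (auto simp: less_imp_le)
  show "(\<integral>x. dens \<theta> x \<partial>lborel_euclid p) = 1"
    using * dens_pos by (intro integral_eq_nn_integral[THEN trans]) (auto simp: less_imp_le)
qed

lemma measure_obs_law:
  assumes [measurable]: "A \<in> sets (borel_euclid p)"
  shows "measure (obs \<theta>) A = (\<integral>x. indicator A x * dens \<theta> x \<partial>lborel_euclid p)"
proof -
  have s: "sets (lborel_euclid p) = sets (borel_euclid p)" by (intro sets_PiM_cong) auto
  have [measurable]: "A \<in> sets (lborel_euclid p)" using assms s by simp
  have "measure (obs \<theta>) A = (\<integral>x. indicator A x \<partial>obs \<theta>)"
    using sets.sets_into_space[OF assms] by (simp add: space_PiM Int_absorb2)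
  also have "\<dots> = (\<integral>x. dens \<theta> x *\<^sub>R indicator A x \<partial>lborel_euclid p)"
    unfolding obs_law_eq using dens_pos by (intro integral_density) (auto simp: less_imp_le)
  finally show ?thesis by (simp add: mult.commute)
qed

lemma sparse_alt_nonempty:
  assumes "1 \<le> s" "1 \<le> p"
  shows "sparse_alt p s \<epsilon> \<noteq> {}"
proof -
  let ?t = "\<lambda>i\<in>{..<p}. if i = 0 then \<bar>\<epsilon>\<bar> else 0"
  have "L2_set ?t {..<p} = L2_set (\<lambda>i. if i = 0 then \<bar>\<epsilon>\<bar> else 0) {..<p}"
    by (rule L2_set_cong) auto
  also have "\<dots> = \<bar>\<epsilon>\<bar>"
    using assms by (simp add: L2_set_def if_distrib[of "\<lambda>c. c\<^sup>2"] sum.delta cong: if_cong)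
  finally have "\<epsilon> \<le> L2_set ?t {..<p}" by simp
  moreover have "{i \<in> {..<p}. ?t i \<noteq> 0} \<subseteq> {0}" by auto
  then have "card {i \<in> {..<p}. ?t i \<noteq> 0} \<le> s"
    using assms card_mono[OF _ \<open>{i \<in> {..<p}. ?t i \<noteq> 0} \<subseteq> {0}\<close>] by simp
  ultimately have "?t \<in> sparse_alt p s \<epsilon>" by (auto simp: sparse_alt_def)
  then show ?thesis by blast
qed

text \<open>The second moment method. Against a uniform prior on the signals, the sum of the two errors falls short of one by at
most the integral of 1 - l over the acceptance region, where l is the averaged likelihood ratio; and the mean square of l - 1 is the
average of the exponentials minus one.\<close>

lemma minimax_risk_ge:
  assumes \<Omega>: "finite \<Omega>" "\<Omega> \<noteq> {}" and \<theta>: "\<And>\<omega>. \<omega> \<in> \<Omega> \<Longrightarrow> \<theta> \<omega> \<in> sparse_alt p s \<epsilon>"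
    and \<eta>: "0 < \<eta>"
    and second: "(\<Sum>\<omega>\<in>\<Omega>. \<Sum>\<omega>'\<in>\<Omega>. exp (cinner (\<theta> \<omega>) (\<theta> \<omega>'))) \<le> (1 + \<eta>\<^sup>2) * (real (card \<Omega>))\<^sup>2"
  shows "1 - \<eta> \<le> minimax_risk p s \<gamma> \<B> \<epsilon>"
  unfolding minimax_risk_def
proof (rule cINF_greatest)
  have "(\<lambda>_. 0) \<in> tests p" by (simp add: tests_def)
  then show "tests p \<noteq> {}" by blast
next
  fix \<phi> assume \<phi>: "\<phi> \<in> tests p"
  interpret P0: prob_space "obs origin" by (rule prob_space_obs_law)
  let ?L = "lborel_euclid p"
  have s: "sets ?L = sets (borel_euclid p)" by (intro sets_PiM_cong) auto
  define A where "A = {x \<in> euclid p. \<phi> x = 0}"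
  have phi: "\<phi> \<in> borel_euclid p \<rightarrow>\<^sub>M count_space {0, 1}" using \<phi> by (simp add: tests_def)
  have "\<phi> -` {0} \<inter> space (borel_euclid p) \<in> sets (borel_euclid p)"
    using measurable_sets[OF phi, of "{0}"] by simp
  moreover have "\<phi> -` {0} \<inter> space (borel_euclid p) = A" by (auto simp: A_def space_PiM)
  ultimately have A[measurable]: "A \<in> sets (borel_euclid p)" by simp
  then have A'[measurable]: "A \<in> sets ?L" using s by simp
  have "{x \<in> euclid p. \<phi> x = 1} = space (obs origin) - A"
  proof -
    have "\<phi> x = 0 \<or> \<phi> x = 1" if "x \<in> euclid p" for x
      using measurable_space[OF phi, of x] that by (simp add: space_PiM)
    then show ?thesis unfolding A_def space_obs_law by fastforce
  qed
  then have P1: "measure (obs origin) {x \<in> euclid p. \<phi> x = 1} = 1 - measure (obs origin) A"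
    by (simp add: P0.prob_compl sets_obs_law del: space_obs_law)
  let ?n = "real (card \<Omega>)"
  have n: "0 < ?n" using \<Omega> by (simp add: card_gt_0_iff)
  define f0 where "f0 = dens origin"
  define f where "f x = (\<Sum>\<omega>\<in>\<Omega>. dens (\<theta> \<omega>) x) / ?n" for x
  define G where "G x = (\<Sum>\<omega>\<in>\<Omega>. \<Sum>\<omega>'\<in>\<Omega>. exp (cinner (\<theta> \<omega>) (\<theta> \<omega>')) * dens (\<lambda>i. \<theta> \<omega> i + \<theta> \<omega>' i) x) / ?n\<^sup>2" for x
  have f0_pos: "0 < f0 x" for x unfolding f0_def by (rule dens_pos)
  have fG: "(f x)\<^sup>2 = G x * f0 x" for x
  proof -
    have "(f x)\<^sup>2 = (\<Sum>\<omega>\<in>\<Omega>. \<Sum>\<omega>'\<in>\<Omega>. dens (\<theta> \<omega>) x * dens (\<theta> \<omega>') x) / ?n\<^sup>2"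
      by (simp add: f_def power_divide power2_eq_square[of "sum _ _"] sum_product)
    then show ?thesis by (simp add: dens_mult G_def f0_def sum_distrib_right)
  qed
  have int[simp]: "integrable ?L f0" "integrable ?L f" "integrable ?L G"
    unfolding f0_def f_def G_def by (auto intro!: integrable_sum integrable_mult_right integrable_divide integrable_dens)
  have I: "(\<integral>x. f0 x \<partial>?L) = 1" "(\<integral>x. f x \<partial>?L) = 1"
      "(\<integral>x. G x \<partial>?L) = (\<Sum>\<omega>\<in>\<Omega>. \<Sum>\<omega>'\<in>\<Omega>. exp (cinner (\<theta> \<omega>) (\<theta> \<omega>'))) / ?n\<^sup>2"
    using n unfolding f0_def f_def G_def by (simp_all add: integrable_dens integral_dens)
  \<comment> \<open>1 - l is at most \<eta>/2 + (1 - l)^2 / (2\<eta>), multiplied through by the density f0 of the null law; the right-hand side is nonnegative, so the restriction to A can be dropped.\<close>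
  have "measure (obs origin) A - (\<Sum>\<omega>\<in>\<Omega>. measure (obs (\<theta> \<omega>)) A) / ?n
      = (\<integral>x. indicator A x * (f0 x - f x) \<partial>?L)"
  proof -
    have i: "integrable ?L (\<lambda>x. indicator A x * dens t x)" for t
      using integrable_mult_indicator[OF A' integrable_dens[of t]] by simp
    have "(\<integral>x. indicator A x * (f0 x - f x) \<partial>?L)
        = (\<integral>x. indicator A x * dens origin x - (\<Sum>\<omega>\<in>\<Omega>. indicator A x * dens (\<theta> \<omega>) x) / ?n \<partial>?L)"
      by (intro Bochner_Integration.integral_cong refl)
         (simp add: f0_def f_def right_diff_distrib sum_distrib_left)
    also have "\<dots> = (\<integral>x. indicator A x * dens origin x \<partial>?L) - (\<Sum>\<omega>\<in>\<Omega>. \<integral>x. indicator A x * dens (\<theta> \<omega>) x \<partial>?L) / ?n"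
      by (simp add: i)
    finally show ?thesis by (simp add: measure_obs_law)
  qed
  also have "\<dots> \<le> (\<integral>x. \<eta> / 2 * f0 x + (G x - 2 * f x + f0 x) / (2 * \<eta>) \<partial>?L)"
  proof (rule integral_mono)
    show "integrable ?L (\<lambda>x. indicator A x * (f0 x - f x))"
      using integrable_mult_indicator[OF A', of "\<lambda>x. f0 x - f x"] by simp
    show "integrable ?L (\<lambda>x. \<eta> / 2 * f0 x + (G x - 2 * f x + f0 x) / (2 * \<eta>))" by simp
    fix x
    have sq: "G x - 2 * f x + f0 x = (f x - f0 x)\<^sup>2 / f0 x"
      using f0_pos[of x] fG[of x] by (simp add: field_simps power2_eq_square)
    have "\<eta> / 2 * f0 x + (f x - f0 x)\<^sup>2 / f0 x / (2 * \<eta>) - (f0 x - f x)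
        = (\<eta> * f0 x + (f x - f0 x))\<^sup>2 / (2 * \<eta> * f0 x)"
      using f0_pos[of x] \<eta> by (simp add: field_simps power2_eq_square)
    moreover have "0 \<le> (\<eta> * f0 x + (f x - f0 x))\<^sup>2 / (2 * \<eta> * f0 x)"
      using f0_pos[of x] \<eta> by simp
    moreover have "0 \<le> \<eta> / 2 * f0 x + (f x - f0 x)\<^sup>2 / f0 x / (2 * \<eta>)"
      using f0_pos[of x] \<eta> by simp
    ultimately show "indicator A x * (f0 x - f x) \<le> \<eta> / 2 * f0 x + (G x - 2 * f x + f0 x) / (2 * \<eta>)"
      unfolding sq by (auto simp: indicator_def)
  qed
  also have "\<dots> = \<eta> / 2 + ((\<Sum>\<omega>\<in>\<Omega>. \<Sum>\<omega>'\<in>\<Omega>. exp (cinner (\<theta> \<omega>) (\<theta> \<omega>'))) / ?n\<^sup>2 - 1) / (2 * \<eta>)"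
    by (simp add: I)
  also have "\<dots> \<le> \<eta> / 2 + \<eta>\<^sup>2 / (2 * \<eta>)"
    using second n \<eta> by (intro add_left_mono divide_right_mono) (auto simp: field_simps)
  also have "\<dots> = \<eta>" using \<eta> by (simp add: power2_eq_square)
  finally have diff: "measure (obs origin) A - (\<Sum>\<omega>\<in>\<Omega>. measure (obs (\<theta> \<omega>)) A) / ?n \<le> \<eta>" .
  have "(\<Sum>\<omega>\<in>\<Omega>. measure (obs (\<theta> \<omega>)) A)
      \<le> (\<Sum>\<omega>\<in>\<Omega>. SUP \<theta>\<in>sparse_alt p s \<epsilon>. measure (obs \<theta>) A)"
  proof (intro sum_mono cSUP_upper \<theta>)
    show "bdd_above ((\<lambda>\<theta>. measure (obs \<theta>) A) ` sparse_alt p s \<epsilon>)"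
      by (intro bdd_aboveI[of _ 1]) (auto intro: prob_space.prob_le_1 prob_space_obs_law)
  qed
  then have "(\<Sum>\<omega>\<in>\<Omega>. measure (obs (\<theta> \<omega>)) A) / ?n
      \<le> (SUP \<theta>\<in>sparse_alt p s \<epsilon>. measure (obs \<theta>) A)"
    using n by (simp add: field_simps)
  with diff P1 show "1 - \<eta> \<le> measure (obs origin) {x \<in> euclid p. \<phi> x = 1}
      + (SUP \<theta>\<in>sparse_alt p s \<epsilon>. measure (obs \<theta>) {x \<in> euclid p. \<phi> x = 0})"
    unfolding A_def by linarith
qed

end

section \<open>Random cell sets\<close>

text \<open>Choosing the points of the cells independently makes the size of the overlap of two
such sets a sum of independent indicators, so that its exponential moment is an exact product; for uniformly random subsets
it would be hypergeometric.\<close>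

definition cell_set :: "nat \<Rightarrow> nat \<Rightarrow> (nat \<Rightarrow> nat) \<Rightarrow> nat set" where
  "cell_set n m \<omega> = (\<lambda>l. l * m + \<omega> l) ` {..<n}"

abbreviation choices :: "nat \<Rightarrow> nat \<Rightarrow> (nat \<Rightarrow> nat) set" where
  "choices n m \<equiv> PiE {..<n} (\<lambda>_. {..<m})"

lemma cell_eqD:
  assumes "l * m + x = l' * m + y" "x < m" "y < (m::nat)"
  shows "l = l' \<and> x = y"
proof -
  have "(l * m + x) div m = l" "(l' * m + y) div m = l'" using assms(2,3) by auto
  then have "l = l'" using assms(1) by simp
  then show ?thesis using assms(1) by simp
qed

lemma cell_set_subset: "\<omega> \<in> choices n m \<Longrightarrow> cell_set n m \<omega> \<subseteq> {..<n * m}"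
proof
  fix i assume \<omega>: "\<omega> \<in> choices n m" and "i \<in> cell_set n m \<omega>"
  then obtain l where l: "l < n" "i = l * m + \<omega> l" by (auto simp: cell_set_def)
  have "\<omega> l < m" using \<omega> l by auto
  then have "i < l * m + m" using l by simp
  also have "\<dots> = Suc l * m" by simp
  also have "\<dots> \<le> n * m" using l by (intro mult_le_mono1) auto
  finally show "i \<in> {..<n * m}" by simp
qed

lemma finite_cell_set[simp]: "finite (cell_set n m \<omega>)"
  by (simp add: cell_set_def)

lemma card_cell_set: "\<omega> \<in> choices n m \<Longrightarrow> card (cell_set n m \<omega>) = n"
  unfolding cell_set_def
proof (subst card_image)
  assume \<omega>: "\<omega> \<in> choices n m"
  show "inj_on (\<lambda>l. l * m + \<omega> l) {..<n}"
  proof (rule inj_onI)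
    fix l l' assume l: "l \<in> {..<n}" "l' \<in> {..<n}" and eq: "l * m + \<omega> l = l' * m + \<omega> l'"
    have "l = l' \<and> \<omega> l = \<omega> l'" using l \<omega> by (intro cell_eqD[OF eq]) auto
    then show "l = l'" ..
  qed
qed simp

lemma card_cell_set_Int:
  assumes "\<omega> \<in> choices n m" "\<omega>' \<in> choices n m"
  shows "card (cell_set n m \<omega> \<inter> cell_set n m \<omega>') = card {l \<in> {..<n}. \<omega> l = \<omega>' l}"
proof -
  have "cell_set n m \<omega> \<inter> cell_set n m \<omega>' = (\<lambda>l. l * m + \<omega> l) ` {l \<in> {..<n}. \<omega> l = \<omega>' l}"
  proof (intro equalityI subsetI)
    fix i assume "i \<in> cell_set n m \<omega> \<inter> cell_set n m \<omega>'"
    then obtain l l' where l: "l < n" "i = l * m + \<omega> l" and l': "l' < n" "i = l' * m + \<omega>' l'"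
      by (auto simp: cell_set_def)
    have "l * m + \<omega> l = l' * m + \<omega>' l'" using l(2) l'(2) by (rule subst)
    moreover have "\<omega> l < m" "\<omega>' l' < m" using assms l(1) l'(1) by (auto simp: PiE_iff)
    ultimately have "l = l' \<and> \<omega> l = \<omega>' l'" by (rule cell_eqD)
    then have "\<omega> l = \<omega>' l" by metis
    then show "i \<in> (\<lambda>l. l * m + \<omega> l) ` {l \<in> {..<n}. \<omega> l = \<omega>' l}"
      unfolding l(2) using l(1) by (intro imageI) simp
  next
    fix i assume "i \<in> (\<lambda>l. l * m + \<omega> l) ` {l \<in> {..<n}. \<omega> l = \<omega>' l}"
    then obtain l where l: "l < n" "\<omega> l = \<omega>' l" "i = l * m + \<omega> l" by blast
    have "i \<in> cell_set n m \<omega>" unfolding cell_set_def l(3) using l(1) by (intro imageI) simp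
    moreover have "i \<in> cell_set n m \<omega>'"
      unfolding cell_set_def l(3) l(2) using l(1) by (rule_tac image_eqI[where x = l]) simp_all
    ultimately show "i \<in> cell_set n m \<omega> \<inter> cell_set n m \<omega>'" by simp
  qed
  moreover have "inj_on (\<lambda>l. l * m + \<omega> l) {l \<in> {..<n}. \<omega> l = \<omega>' l}"
  proof (rule inj_onI)
    fix l l' assume l: "l \<in> {l \<in> {..<n}. \<omega> l = \<omega>' l}" "l' \<in> {l \<in> {..<n}. \<omega> l = \<omega>' l}"
      and eq: "l * m + \<omega> l = l' * m + \<omega> l'"
    have "l = l' \<and> \<omega> l = \<omega> l'" using l assms by (intro cell_eqD[OF eq]) auto
    then show "l = l'" ..
  qed
  ultimately show ?thesis by (simp only: card_image)
qed

text \<open>In each cell the two choices agree with probability 1/m, independently of the other cells.\<close>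

lemma sum_exp_overlap:
  assumes \<omega>: "\<omega> \<in> choices n m" and m: "1 \<le> m"
  shows "(\<Sum>\<omega>'\<in>choices n m. exp (\<beta> * real (card (cell_set n m \<omega> \<inter> cell_set n m \<omega>'))))
    = (real m * (1 + (exp \<beta> - 1) / real m)) ^ n"
proof -
  have "(\<Sum>\<omega>'\<in>choices n m. exp (\<beta> * real (card (cell_set n m \<omega> \<inter> cell_set n m \<omega>'))))
      = (\<Sum>\<omega>'\<in>choices n m. \<Prod>l<n. if \<omega> l = \<omega>' l then exp \<beta> else 1)"
  proof (intro sum.cong refl)
    fix \<omega>' assume "\<omega>' \<in> choices n m"
    then show "exp (\<beta> * real (card (cell_set n m \<omega> \<inter> cell_set n m \<omega>')))
        = (\<Prod>l<n. if \<omega> l = \<omega>' l then exp \<beta> else 1)"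
      unfolding card_cell_set_Int[OF \<omega> \<open>\<omega>' \<in> choices n m\<close>]
      by (simp add: prod.If_cases exp_of_nat2_mult Int_def)
  qed
  also have "\<dots> = (\<Prod>l<n. \<Sum>y<m. if \<omega> l = y then exp \<beta> else 1)"
    by (rule prod_sum_PiE[symmetric]) auto
  also have "\<dots> = (\<Prod>l<n. real m * (1 + (exp \<beta> - 1) / real m))"
  proof (intro prod.cong refl)
    fix l assume "l \<in> {..<n}"
    then have "\<omega> l < m" using \<omega> by auto
    have "(\<Sum>y<m. if \<omega> l = y then exp \<beta> else 1) = (\<Sum>y<m. 1 + (if y = \<omega> l then exp \<beta> - 1 else 0))"
      by (intro sum.cong) auto
    also have "\<dots> = real m + (exp \<beta> - 1)" using \<open>\<omega> l < m\<close> by (simp add: sum.distrib)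
    also have "\<dots> = real m * (1 + (exp \<beta> - 1) / real m)" using m by (simp add: field_simps)
    finally show "(\<Sum>y<m. if \<omega> l = y then exp \<beta> else 1) = real m * (1 + (exp \<beta> - 1) / real m)" .
  qed
  finally show ?thesis by simp
qed

lemma card_choices: "real (card (choices n m)) = real m ^ n"
  by (simp add: card_PiE)

lemma finite_choices: "finite (choices n m)"
  by (intro finite_PiE) auto

lemma choices_nonempty: "1 \<le> m \<Longrightarrow> choices n m \<noteq> {}"
  by (auto simp: PiE_eq_empty_iff lessThan_empty_iff)

lemma one_plus_power_le_exp:
  assumes "0 \<le> (x::real)" shows "(1 + x) ^ n \<le> exp (real n * x)"
proof -
  have "(1 + x) ^ n \<le> exp x ^ n" using assms by (intro power_mono) auto
  then show ?thesis by (simp add: exp_of_nat_mult)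
qed

section \<open>Lower bound from sparse signals in all blocks\<close>

context block_model
begin

definition spike :: "real \<Rightarrow> nat set \<Rightarrow> nat \<Rightarrow> real" where
  "spike b S = (\<lambda>i\<in>{..<p}. if i \<in> S then b else 0)"

lemma spike_sparse_alt:
  assumes S: "S \<subseteq> {..<p}" "card S \<le> s" and b: "0 \<le> b" and e: "\<epsilon> \<le> b * sqrt (real (card S))"
  shows "spike b S \<in> sparse_alt p s \<epsilon>"
proof -
  have fin: "finite S" using S finite_subset by blast
  have "(\<Sum>i<p. (spike b S i)\<^sup>2) = (\<Sum>i<p. if i \<in> S then b\<^sup>2 else 0)"
    by (intro sum.cong) (auto simp: spike_def)
  also have "\<dots> = b\<^sup>2 * real (card S)"
    using S by (simp add: sum.If_cases Int_absorb1)
  finally have "L2_set (spike b S) {..<p} = b * sqrt (real (card S))"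
    using b by (simp add: L2_set_def real_sqrt_mult)
  moreover have "card {i \<in> {..<p}. spike b S i \<noteq> 0} \<le> card S"
    using fin by (intro card_mono) (auto simp: spike_def split: if_splits)
  ultimately show ?thesis using assms by (auto simp: sparse_alt_def spike_def)
qed

lemma sum_spike_mult:
  assumes "S \<subseteq> {..<p}"
  shows "(\<Sum>i<p. spike b S i * spike b S' i) = b\<^sup>2 * real (card (S \<inter> S'))"
proof -
  have "(\<Sum>i<p. spike b S i * spike b S' i) = (\<Sum>i<p. if i \<in> S \<inter> S' then b\<^sup>2 else 0)"
    by (intro sum.cong) (auto simp: spike_def power2_eq_square)
  moreover have "{..<p} \<inter> (S \<inter> S') = S \<inter> S'" using assms by auto
  ultimately show ?thesis by (simp add: sum.If_cases del: Int_iff)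
qed

lemma sum_spike_block:
  assumes "B \<in> \<B>" "S \<subseteq> {..<p}"
  shows "(\<Sum>i\<in>B. spike b S i) = b * real (card (S \<inter> B))"
proof -
  have "(\<Sum>i\<in>B. spike b S i) = (\<Sum>i\<in>B. if i \<in> S then b else 0)"
    using block_subset[OF assms(1)] by (intro sum.cong) (auto simp: spike_def)
  then show ?thesis using finite_block[OF assms(1)] by (simp add: sum.If_cases Int_commute)
qed

text \<open>For signals with nonnegative coordinates the correction for the block means has a favourable sign.\<close>

lemma cinner_spike_le:
  assumes "S \<subseteq> {..<p}" "S' \<subseteq> {..<p}"
  shows "cinner (spike b S) (spike b S') \<le> b\<^sup>2 / a * real (card (S \<inter> S'))"
proof -
  have "0 \<le> (\<Sum>B\<in>\<B>. (\<Sum>i\<in>B. spike b S i) * (\<Sum>i\<in>B. spike b S' i))"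
  proof (intro sum_nonneg)
    fix B assume "B \<in> \<B>"
    then have "(\<Sum>i\<in>B. spike b S i) * (\<Sum>i\<in>B. spike b S' i)
        = b\<^sup>2 * (real (card (S \<inter> B)) * real (card (S' \<inter> B)))"
      using assms by (simp add: sum_spike_block power2_eq_square)
    then show "0 \<le> (\<Sum>i\<in>B. spike b S i) * (\<Sum>i\<in>B. spike b S' i)" by simp
  qed
  then have "0 \<le> \<gamma> / V * (\<Sum>B\<in>\<B>. (\<Sum>i\<in>B. spike b S i) * (\<Sum>i\<in>B. spike b S' i))"
    using \<gamma>_nonneg V_pos by simp
  then have "cinner (spike b S) (spike b S') \<le> (\<Sum>i<p. spike b S i * spike b S' i) / a"
    unfolding cinner_def using a_pos by (intro divide_right_mono) auto
  then show ?thesis using assms by (simp add: sum_spike_mult)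
qed

text \<open>One coordinate in each of n cells of size m = p div n. The amplitude is such that the exponential
moment of the overlap is at most exp (2 c).\<close>

lemma minimax_risk_ge_independent:
  assumes n: "1 \<le> n" "n \<le> s" "real n \<le> sqrt (real p)"
    and c: "0 < c" "2 * c \<le> ln (1 + \<eta>\<^sup>2)" and \<eta>: "0 < \<eta>"
    and \<epsilon>: "0 \<le> \<epsilon>" "\<epsilon>\<^sup>2 \<le> a * real n * ln (1 + c * real p / (real n)\<^sup>2)"
  shows "1 - \<eta> \<le> minimax_risk p s \<gamma> \<B> \<epsilon>"
proof -
  define m where "m = p div n"
  \<comment> \<open>The amplitude b is measured in units of the noise, so that \<beta> = b^2/a is the exponent in the overlap.\<close>
  define \<beta> where "\<beta> = ln (1 + c * real p / (real n)\<^sup>2)"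
  define b where "b = sqrt (a * \<beta>)"
  have p: "1 \<le> p" using p_eq q_pos R_pos by simp
  have n2: "real n ^ 2 \<le> real p"
    using power_mono[OF n(3), of 2] by simp
  have "real n \<le> real n ^ 2" using n(1) by (simp add: self_le_power)
  then have np: "n \<le> p" using n2 by linarith
  have m1: "1 \<le> m" using np n by (simp add: m_def div_greater_zero_iff Suc_le_eq)
  have nm: "n * m \<le> p" by (simp add: m_def)
  have m2: "real p \<le> 2 * real n * real m"
  proof -
    have "p < n * m + n" unfolding m_def using n(1)
      by (metis add.commute dividend_less_times_div less_eq_Suc_le One_nat_def mult.commute)
    moreover have "n \<le> n * m" using m1 by simp
    ultimately have "p \<le> 2 * n * m" by linarith
    then show ?thesis by (metis of_nat_le_iff of_nat_mult of_nat_numeral)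
  qed
  have \<beta>0: "0 \<le> \<beta>" unfolding \<beta>_def using c by (intro ln_ge_zero) simp
  have e\<beta>: "exp \<beta> = 1 + c * real p / (real n)\<^sup>2" unfolding \<beta>_def
    using c by (intro exp_ln) (simp add: add_pos_nonneg)
  have b2: "b\<^sup>2 / a = \<beta>" unfolding b_def using a_pos \<beta>0 by simp
  have sub: "cell_set n m \<omega> \<subseteq> {..<p}" if "\<omega> \<in> choices n m" for \<omega>
    using cell_set_subset[OF that] nm by fastforce
  show ?thesis
  proof (rule minimax_risk_ge[OF finite_choices choices_nonempty[OF m1]])
    fix \<omega> assume \<omega>: "\<omega> \<in> choices n m"
    have "\<epsilon> \<le> b * sqrt (real n)"
    proof (rule power2_le_imp_le)
      show "\<epsilon>\<^sup>2 \<le> (b * sqrt (real n))\<^sup>2"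
        using \<epsilon>(2) a_pos \<beta>0 by (simp add: b_def power_mult_distrib \<beta>_def mult_ac)
    qed (use a_pos \<beta>0 in \<open>simp add: b_def\<close>)
    then show "spike b (cell_set n m \<omega>) \<in> sparse_alt p s \<epsilon>"
      using n \<omega> a_pos \<beta>0 by (intro spike_sparse_alt sub) (auto simp: card_cell_set b_def)
  next
    have "(\<Sum>\<omega>\<in>choices n m. \<Sum>\<omega>'\<in>choices n m. exp (cinner (spike b (cell_set n m \<omega>)) (spike b (cell_set n m \<omega>'))))
      \<le> (\<Sum>\<omega>\<in>choices n m. \<Sum>\<omega>'\<in>choices n m. exp (\<beta> * real (card (cell_set n m \<omega> \<inter> cell_set n m \<omega>'))))"
      by (intro sum_mono) (use cinner_spike_le[OF sub sub, where b = b] in \<open>simp add: b2\<close>)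
    also have "\<dots> = (\<Sum>\<omega>\<in>choices n m. (real m * (1 + (exp \<beta> - 1) / real m)) ^ n)"
      by (intro sum.cong refl sum_exp_overlap m1)
    also have "\<dots> = real m ^ n * (real m * (1 + (exp \<beta> - 1) / real m)) ^ n"
      by (simp add: card_choices)
    also have "\<dots> = (1 + (exp \<beta> - 1) / real m) ^ n * (real m ^ n)\<^sup>2"
      by (simp add: power_mult_distrib power2_eq_square)
    also have "\<dots> \<le> (1 + \<eta>\<^sup>2) * (real m ^ n)\<^sup>2"
    proof (rule mult_right_mono)
      have "(1 + (exp \<beta> - 1) / real m) ^ n \<le> exp (real n * ((exp \<beta> - 1) / real m))"
        using \<beta>0 by (intro one_plus_power_le_exp) simp
      also have "real n * ((exp \<beta> - 1) / real m) \<le> 2 * c"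
      proof -
        have "real n * ((exp \<beta> - 1) / real m) = c * real p / (real n * real m)"
          using n by (simp add: e\<beta> power2_eq_square)
        also have "\<dots> \<le> c * (2 * real n * real m) / (real n * real m)"
          using m2 c by (intro divide_right_mono mult_left_mono) auto
        also have "\<dots> = 2 * c" using n m1 by simp
        finally show ?thesis .
      qed
      then have "exp (real n * ((exp \<beta> - 1) / real m)) \<le> exp (ln (1 + \<eta>\<^sup>2))" using c by simp
      also have "\<dots> = 1 + \<eta>\<^sup>2" by (simp add: add_pos_nonneg)
      finally show "(1 + (exp \<beta> - 1) / real m) ^ n \<le> 1 + \<eta>\<^sup>2" .
    qed simp
    finally show "(\<Sum>\<omega>\<in>choices n m. \<Sum>\<omega>'\<in>choices n m. exp (cinner (spike b (cell_set n m \<omega>)) (spike b (cell_set n m \<omega>'))))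
      \<le> (1 + \<eta>\<^sup>2) * (real (card (choices n m)))\<^sup>2" by (simp add: card_choices)
  qed (rule \<eta>)
qed

end

section \<open>Lower bound from signals in one block\<close>

text \<open>Convexity of the exponential between 0 and ln (1 + x).\<close>

lemma exp_mult_le_one_plus:
  assumes "0 \<le> t" "t \<le> 1" "0 \<le> (x::real)"
  shows "exp (t * ln (1 + x)) \<le> 1 + t * x"
proof -
  have "exp ((1 - t) *\<^sub>R 0 + t *\<^sub>R ln (1 + x)) \<le> (1 - t) * exp 0 + t * exp (ln (1 + x))"
    using assms by (intro convex_onD[OF exp_convex]) auto
  then show ?thesis using assms by (simp add: algebra_simps)
qed

text \<open>The signal strength, in units of 1 - \<gamma>, at which d zeros among q coordinates can be told from noise in one of R blocks. The
logarithm of R pays for the unknown block.\<close>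

definition block_scale :: "real \<Rightarrow> real \<Rightarrow> real \<Rightarrow> real" where
  "block_scale q d R = (if sqrt (q * (1 + ln R)) \<le> d then sqrt (q * (1 + ln R))
     else d * ln (1 + q * (1 + ln R) / d\<^sup>2)) + ln R"

lemma upsilon_sq_eq:
  assumes p: "p = q * R" and R: "1 \<le> R" and q: "1 \<le> q" and s: "s < q"
  shows "upsilon_sq p s \<gamma> R
    = min ((1 - \<gamma>) * (real q / (real q - real s)) * block_scale (real q) (real q - real s) (real R))
        ((1 - \<gamma> + \<gamma> * real q) * (1 + ln (real R)))"
proof -
  have L: "ln (exp 1 * real R) = 1 + ln (real R)" using R by (simp add: ln_mult)
  have pR: "real p / real R = real q" using R by (simp add: p)
  have e1: "(1 - \<gamma>) * real p / (real p - real R * real s) = (1 - \<gamma>) * (real q / (real q - real s))"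
  proof -
    have "real p - real R * real s = real R * (real q - real s)" by (simp add: p algebra_simps)
    then show ?thesis using R by (simp add: p)
  qed
  have e2: "real R * real p * (1 + ln (real R)) / (real p - real R * real s)\<^sup>2
      = real q * (1 + ln (real R)) / (real q - real s)\<^sup>2"
  proof -
    have "(real p - real R * real s)\<^sup>2 = real R * real R * (real q - real s)\<^sup>2"
      by (simp add: p power2_eq_square algebra_simps)
    moreover have "real R * real p = real R * real R * real q" by (simp add: p)
    ultimately show ?thesis using R by simp
  qed
  show ?thesis
    unfolding upsilon_sq_def Let_def L pR e1 e2 block_scale_def by (auto simp: le_diff_eq add.commute)
qed

lemma block_scale_nonneg: "0 < d \<Longrightarrow> 1 \<le> R \<Longrightarrow> 0 \<le> q \<Longrightarrow> 0 \<le> block_scale q d R"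
  by (auto simp: block_scale_def intro!: add_nonneg_nonneg mult_nonneg_nonneg)

text \<open>In the regime of many zeros, L is dominated by the deviation of a chi-square statistic.\<close>

lemma sqrt_mult_ge_L:
  assumes "sqrt (q * L) \<le> d" "d \<le> q" "(1::real) \<le> L" "0 < q"
  shows "L \<le> q" "L \<le> sqrt (q * L)"
proof -
  have "sqrt (q * L) \<le> q" using assms by linarith
  then have "(sqrt (q * L))\<^sup>2 \<le> q\<^sup>2" using assms by (intro power_mono) auto
  then have "q * L \<le> q * q" using assms by (simp add: power2_eq_square)
  then show "L \<le> q" using assms by simp
  then have "L * L \<le> q * L" using assms by (intro mult_right_mono) auto
  then show "L \<le> sqrt (q * L)" using assms by (intro real_le_rsqrt) (simp add: power2_eq_square)
qed

text \<open>The overlap of two random cell sets has mean n/m, which differs from n^2/q only through the coordinates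
left over by the cells. With many zeros this centring is essential and the exponential moment is
governed by the variance; with few zeros it suffices to bound the exponential moment of the uncentred overlap, or, when ln R dominates, to
use that the overlap is at most n.\<close>

lemma overlap_moment_le:
  fixes n m q :: nat and d R c \<beta> :: real
  assumes n: "1 \<le> n" and m: "1 \<le> m" and nm: "n * m \<le> q" "q < n * m + m" and nd: "real n \<le> 2 * d"
    and d: "0 < d" "d \<le> real q" and R: "1 \<le> R" and c: "0 \<le> c" "16 * c \<le> 1"
    and \<beta>: "0 \<le> \<beta>" "\<beta> \<le> 8 * c * block_scale (real q) d R / d"
  shows "exp (- (\<beta> * (real n)\<^sup>2 / real q)) * (1 + (exp \<beta> - 1) / real m) ^ n \<le> exp (144 * c * (1 + ln R))"
proof -
  define L where "L = 1 + ln R"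
  have L1: "1 \<le> L" using R by (simp add: L_def)
  have q0: "0 < real q" using n m nm by (metis One_nat_def Suc_le_eq mult_pos_pos of_nat_0_less_iff order_less_le_trans)
  have m0: "0 < real m" using m by simp
  have q2: "real q \<le> 2 * (real n * real m)"
  proof -
    have "m \<le> n * m" using n by simp
    then have "q \<le> 2 * (n * m)" using nm by linarith
    then show ?thesis by (metis of_nat_le_iff of_nat_mult of_nat_numeral)
  qed
  have im: "real n / real m \<le> 2 * (real n)\<^sup>2 / real q"
  proof -
    have "real n * real q \<le> real n * (2 * (real n * real m))" using q2 by (intro mult_left_mono) auto
    then show ?thesis using q0 m0 by (simp add: divide_simps power2_eq_square mult_ac)
  qed
  have n4: "(real n)\<^sup>2 \<le> 4 * d\<^sup>2"
    using power_mono[OF nd, of 2] by (simp add: power_mult_distrib)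
  have pw: "(1 + (exp \<beta> - 1) / real m) ^ n \<le> exp (real n * ((exp \<beta> - 1) / real m))"
    using \<beta> by (intro one_plus_power_le_exp) simp
  have neg: "exp (- (\<beta> * (real n)\<^sup>2 / real q)) \<le> 1" using \<beta> q0 by simp
  have nonneg: "0 \<le> (1 + (exp \<beta> - 1) / real m) ^ n" using \<beta> by simp
  consider (dense) "sqrt (real q * L) \<le> d" | (sparse) "d < sqrt (real q * L)" "ln R \<le> d * ln (1 + real q * L / d\<^sup>2)"
    | (big) "d < sqrt (real q * L)" "d * ln (1 + real q * L / d\<^sup>2) < ln R"
    by linarith
  then show ?thesis
  proof cases
    case dense
    let ?t = "sqrt (real q * L)"
    have t: "L \<le> ?t" using sqrt_mult_ge_L[OF dense d(2) L1 q0] by simp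
    have tpos: "0 < ?t" using t L1 by linarith
    have "block_scale (real q) d R = ?t + ln R" using dense by (simp add: block_scale_def L_def)
    also have "\<dots> \<le> 2 * ?t" using t by (simp add: L_def)
    finally have bs: "block_scale (real q) d R \<le> 2 * ?t" .
    have "\<beta> \<le> 8 * c * (2 * ?t) / d"
      by (rule order_trans[OF \<beta>(2)]) (use c d bs in \<open>intro divide_right_mono mult_left_mono; simp\<close>)
    then have b1: "\<beta> \<le> 16 * c * (?t / d)" by simp
    also have "\<dots> \<le> 16 * c * 1" using dense d c by (intro mult_left_mono) (auto simp: divide_simps)
    finally have b2: "\<beta> \<le> 16 * c" by simp
    then have b3: "\<beta> \<le> 1" using c by linarith
    have "real n * ((exp \<beta> - 1) / real m) \<le> real n * ((\<beta> + \<beta>\<^sup>2) / real m)"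
      using exp_bound[OF \<beta>(1) b3] by (intro mult_left_mono divide_right_mono) auto
    also have "\<dots> = \<beta> * (real n / real m) + \<beta>\<^sup>2 * (real n / real m)"
      by (simp add: algebra_simps add_divide_distrib)
    finally have e1: "real n * ((exp \<beta> - 1) / real m) \<le> \<beta> * (real n / real m) + \<beta>\<^sup>2 * (real n / real m)" .
    \<comment> \<open>The cells leave fewer than m coordinates over, so centring by n^2/q instead of n/m costs a bounded amount.\<close>
    have gap: "real n / real m - (real n)\<^sup>2 / real q \<le> 1"
    proof -
      have nq: "real n \<le> real q"
      proof -
        have "n * 1 \<le> n * m" using m by (intro mult_le_mono2)
        then show ?thesis using nm by linarith
      qed
      have "real q - real n * real m \<le> real m"
        using nm(2) by (metis add.commute diff_le_eq less_imp_le of_nat_add of_nat_le_iff of_nat_mult)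
      then have "real n * (real q - real n * real m) \<le> real q * real m"
        using nq by (meson mult_left_mono mult_right_mono of_nat_0_le_iff order_trans)
      then have "real n * (real q - real n * real m) / (real q * real m) \<le> 1"
        using q0 m0 by simp
      moreover have "real n / real m - (real n)\<^sup>2 / real q = real n * (real q - real n * real m) / (real q * real m)"
        using q0 m0 by (simp add: field_simps power2_eq_square)
      ultimately show ?thesis by simp
    qed
    have "\<beta>\<^sup>2 * (real n / real m) \<le> (16 * c * (?t / d))\<^sup>2 * (2 * (4 * d\<^sup>2) / real q)"
    proof (intro mult_mono power_mono)
      show "real n / real m \<le> 2 * (4 * d\<^sup>2) / real q"
        by (rule order_trans[OF im]) (use n4 q0 in \<open>intro divide_right_mono; simp\<close>)
    qed (use \<beta> b1 in auto)
    also have "\<dots> = 2048 * c\<^sup>2 * L"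
    proof -
      have "?t\<^sup>2 = real q * L" using q0 L1 by simp
      then show ?thesis using d q0 by (simp add: power_mult_distrib power_divide)
    qed
    also have "\<dots> \<le> 128 * c * L"
    proof -
      have "c * (16 * c) \<le> c * 1" using c by (intro mult_left_mono) auto
      then have "2048 * c\<^sup>2 \<le> 128 * c" by (simp add: power2_eq_square)
      then show ?thesis using L1 by (intro mult_right_mono) auto
    qed
    finally have e2: "\<beta>\<^sup>2 * (real n / real m) \<le> 128 * c * L" .
    have "\<beta> * (real n / real m - (real n)\<^sup>2 / real q) \<le> \<beta> * 1"
      using gap \<beta> by (intro mult_left_mono) auto
    also have "\<dots> \<le> 16 * c * L"
    proof -
      have "16 * c * 1 \<le> 16 * c * L" using L1 c by (intro mult_left_mono) auto
      then show ?thesis using b2 by simp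
    qed
    finally have "\<beta> * (real n / real m) - \<beta> * (real n)\<^sup>2 / real q \<le> 16 * c * L"
      by (simp add: right_diff_distrib)
    with e1 e2 have "- (\<beta> * (real n)\<^sup>2 / real q) + real n * ((exp \<beta> - 1) / real m) \<le> 144 * c * L"
      by linarith
    then have "exp (- (\<beta> * (real n)\<^sup>2 / real q)) * exp (real n * ((exp \<beta> - 1) / real m)) \<le> exp (144 * c * L)"
      by (simp add: exp_add[symmetric])
    moreover have "exp (- (\<beta> * (real n)\<^sup>2 / real q)) * (1 + (exp \<beta> - 1) / real m) ^ n
      \<le> exp (- (\<beta> * (real n)\<^sup>2 / real q)) * exp (real n * ((exp \<beta> - 1) / real m))"
      using pw by (intro mult_left_mono) auto
    ultimately show ?thesis unfolding L_def by linarith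
  next
    case sparse
    let ?x = "real q * L / d\<^sup>2"
    have x0: "0 \<le> ?x" using q0 L1 by simp
    have bs: "block_scale (real q) d R \<le> d * (2 * ln (1 + ?x))"
      using sparse by (simp add: block_scale_def L_def)
    have "\<beta> \<le> 8 * c * (d * (2 * ln (1 + ?x))) / d"
      by (rule order_trans[OF \<beta>(2)]) (use c d bs in \<open>intro divide_right_mono mult_left_mono; simp\<close>)
    then have "\<beta> \<le> 16 * c * ln (1 + ?x)" using d by simp
    then have "exp \<beta> \<le> exp (16 * c * ln (1 + ?x))" by simp
    also have "\<dots> \<le> 1 + 16 * c * ?x" using c x0 by (intro exp_mult_le_one_plus) auto
    finally have "exp \<beta> - 1 \<le> 16 * c * ?x" by simp
    then have "real n * ((exp \<beta> - 1) / real m) \<le> real n * (16 * c * ?x / real m)"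
      by (intro mult_left_mono divide_right_mono) auto
    also have "\<dots> = (real n / real m) * (16 * c * ?x)" by simp
    also have "\<dots> \<le> (2 * (4 * d\<^sup>2) / real q) * (16 * c * ?x)"
    proof (intro mult_right_mono)
      show "real n / real m \<le> 2 * (4 * d\<^sup>2) / real q"
        by (rule order_trans[OF im]) (use n4 q0 in \<open>intro divide_right_mono; simp\<close>)
      show "0 \<le> 16 * c * ?x" by (rule mult_nonneg_nonneg[OF _ x0]) (use c in simp)
    qed
    also have "\<dots> = 128 * c * L" using d q0 by simp
    also have "\<dots> \<le> 144 * c * L" using c L1 by (intro mult_right_mono) auto
    finally have "exp (real n * ((exp \<beta> - 1) / real m)) \<le> exp (144 * c * L)" by simp
    with pw have "(1 + (exp \<beta> - 1) / real m) ^ n \<le> exp (144 * c * L)" by linarith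
    with mult_mono[OF neg this _ nonneg] show ?thesis by (simp add: L_def)
  next
    case big
    have "\<beta> \<le> 8 * c * (2 * ln R) / d"
      by (rule order_trans[OF \<beta>(2)])
         (use c d big in \<open>intro divide_right_mono mult_left_mono; simp add: block_scale_def L_def\<close>)
    then have "\<beta> * real n \<le> 8 * c * (2 * ln R) / d * (2 * d)"
      using nd \<beta> c R d by (intro mult_mono) auto
    also have "\<dots> = 32 * c * ln R" using d by simp
    also have "\<dots> \<le> 144 * c * L" using c R unfolding L_def by (intro mult_mono) auto
    finally have bn: "\<beta> * real n \<le> 144 * c * L" .
    have "(exp \<beta> - 1) / real m \<le> exp \<beta> - 1"
      using m0 m \<beta> by (simp add: divide_le_eq mult_le_cancel_left1)
    then have "(1 + (exp \<beta> - 1) / real m) ^ n \<le> exp \<beta> ^ n"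
      using \<beta> m0 by (intro power_mono) auto
    also have "\<dots> = exp (\<beta> * real n)" by (simp add: exp_of_nat2_mult)
    finally have "(1 + (exp \<beta> - 1) / real m) ^ n \<le> exp (144 * c * L)"
      using bn by (meson exp_le_cancel_iff order_trans)
    with mult_mono[OF neg this _ nonneg] show ?thesis by (simp add: L_def)
  qed
qed

text \<open>The probability 1/R that two random blocks coincide compensates an exponential moment of size exp (k L), uniformly in R.\<close>

lemma exp_scale_minus_one_le:
  assumes R: "1 \<le> (R::real)" and k: "0 < k" "k \<le> 1 / 2"
  shows "exp (k * (1 + ln R)) - 1 \<le> 2 * k * R"
proof -
  define L where "L = 1 + ln R"
  have L1: "1 \<le> L" using R by (simp add: L_def)
  have RL: "R = exp (L - 1)" using R by (simp add: L_def)
  have "1 + - (k * L) \<le> exp (- (k * L))" by (rule exp_ge_add_one_self)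
  then have "(1 - k * L) * exp (k * L) \<le> exp (- (k * L)) * exp (k * L)"
    by (intro mult_right_mono) auto
  then have "exp (k * L) - 1 \<le> k * L * exp (k * L)"
    by (simp add: exp_add[symmetric] algebra_simps)
  also have "\<dots> \<le> k * (2 * exp (L / 2 - 1)) * exp (L / 2)"
  proof (intro mult_mono)
    show "L \<le> 2 * exp (L / 2 - 1)" using exp_ge_add_one_self[of "L / 2 - 1"] by simp
    have "k * L \<le> 1 / 2 * L" using k L1 by (intro mult_right_mono) auto
    then show "exp (k * L) \<le> exp (L / 2)" by simp
  qed (use k L1 in auto)
  also have "\<dots> = 2 * k * (exp (L / 2 - 1) * exp (L / 2))" by simp
  also have "exp (L / 2 - 1) * exp (L / 2) = R" by (simp add: exp_add[symmetric] RL)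
  finally show ?thesis by (simp add: L_def)
qed

context block_model
begin

definition enum :: "nat set \<Rightarrow> nat \<Rightarrow> nat" where
  "enum B = (SOME f. bij_betw f {..<q} B)"

lemma enum_bij: "B \<in> \<B> \<Longrightarrow> bij_betw (enum B) {..<q} B"
  unfolding enum_def
  using ex_bij_betw_nat_finite[OF finite_block[of B]]
  by (intro someI_ex[of "\<lambda>f. bij_betw f {..<q} B"]) (simp add: card_block atLeast0LessThan)

text \<open>The prior: a uniformly random block and in it a constant signal, either on a random cell set or on its complement. The two
variants give the same centred overlap, because complements of sets of equal size intersect in as many points as the sets do, up to a constant.\<close>

lemma minimax_risk_ge_block:
  fixes compl :: bool and n m s :: nat and b :: real
  assumes m: "1 \<le> m" and nm: "n * m \<le> q"
    and \<sigma>: "\<sigma> = (if compl then q - n else n)" "\<sigma> \<le> s"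
    and b: "0 \<le> b" "\<epsilon> \<le> b * sqrt (real \<sigma>)" and \<eta>: "0 < \<eta>"
    and X: "exp (b\<^sup>2 * (real \<sigma>)\<^sup>2 / (real q * V))
        * (exp (- (b\<^sup>2 / a * (real n)\<^sup>2 / real q)) * (1 + (exp (b\<^sup>2 / a) - 1) / real m) ^ n)
        \<le> 1 + \<eta>\<^sup>2 * real R"
  shows "1 - \<eta> \<le> minimax_risk p s \<gamma> \<B> \<epsilon>"
proof -
  define \<beta> where "\<beta> = b\<^sup>2 / a"
  define T where "T B \<omega> = enum B ` cell_set n m \<omega>" for B \<omega>
  define S where "S B \<omega> = (if compl then B - T B \<omega> else T B \<omega>)" for B \<omega>
  have n_le: "n \<le> q" using m nm by (metis One_nat_def Suc_le_eq le_trans mult_le_mono2 nat_mult_1_right)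
  have cell_q: "cell_set n m \<omega> \<subseteq> {..<q}" if "\<omega> \<in> choices n m" for \<omega>
    using cell_set_subset[OF that] nm by fastforce
  have inj: "inj_on (enum B) {..<q}" if "B \<in> \<B>" for B using enum_bij[OF that] by (simp add: bij_betw_def)
  have T_sub: "T B \<omega> \<subseteq> B" if "B \<in> \<B>" "\<omega> \<in> choices n m" for B \<omega>
    using enum_bij[OF that(1)] cell_q[OF that(2)] by (auto simp: T_def bij_betw_def)
  have card_T: "card (T B \<omega>) = n" if "B \<in> \<B>" "\<omega> \<in> choices n m" for B \<omega>
    unfolding T_def using inj_on_subset[OF inj[OF that(1)] cell_q[OF that(2)]] that
    by (simp add: card_image card_cell_set)
  have card_T_Int: "card (T B \<omega> \<inter> T B \<omega>') = card (cell_set n m \<omega> \<inter> cell_set n m \<omega>')"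
    if "B \<in> \<B>" "\<omega> \<in> choices n m" "\<omega>' \<in> choices n m" for B \<omega> \<omega>'
  proof -
    have "T B \<omega> \<inter> T B \<omega>' = enum B ` (cell_set n m \<omega> \<inter> cell_set n m \<omega>')"
      unfolding T_def using inj[OF that(1)] cell_q[OF that(2)] cell_q[OF that(3)]
      by (intro inj_on_image_Int[symmetric]) auto
    moreover have "inj_on (enum B) (cell_set n m \<omega> \<inter> cell_set n m \<omega>')"
      using inj_on_subset[OF inj[OF that(1)]] cell_q[OF that(2)] by blast
    ultimately show ?thesis by (simp add: card_image)
  qed
  have S_sub: "S B \<omega> \<subseteq> B" if "B \<in> \<B>" "\<omega> \<in> choices n m" for B \<omega>
    using T_sub[OF that] by (auto simp: S_def)
  have S_p: "S B \<omega> \<subseteq> {..<p}" if "B \<in> \<B>" "\<omega> \<in> choices n m" for B \<omega>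
    using S_sub[OF that] block_subset[OF that(1)] by blast
  have card_S: "card (S B \<omega>) = \<sigma>" if "B \<in> \<B>" "\<omega> \<in> choices n m" for B \<omega>
    using T_sub[OF that] card_T[OF that] card_block[OF that(1)] finite_block[OF that(1)]
    by (auto simp: S_def \<sigma> card_Diff_subset finite_subset)
  have q0: "0 < real q" using q_pos by simp
  have card_S_Int: "real (card (S B \<omega> \<inter> S B \<omega>')) - (real \<sigma>)\<^sup>2 / real q
      = real (card (cell_set n m \<omega> \<inter> cell_set n m \<omega>')) - (real n)\<^sup>2 / real q"
    if "B \<in> \<B>" "\<omega> \<in> choices n m" "\<omega>' \<in> choices n m" for B \<omega> \<omega>'
  proof (cases compl)
    case True
    have fin: "finite (T B \<omega>)" "finite (T B \<omega>')" by (auto simp: T_def)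
    have "S B \<omega> \<inter> S B \<omega>' = B - (T B \<omega> \<union> T B \<omega>')" using True by (auto simp: S_def)
    then have "real (card (S B \<omega> \<inter> S B \<omega>')) = real (card B) - real (card (T B \<omega> \<union> T B \<omega>'))"
      using T_sub[OF that(1,2)] T_sub[OF that(1,3)] finite_block[OF that(1)] fin
      by (simp add: card_Diff_subset of_nat_diff card_mono)
    moreover have "card (T B \<omega> \<union> T B \<omega>') + card (T B \<omega> \<inter> T B \<omega>') = n + n"
      using card_Un_Int[OF fin] card_T that by simp
    then have "real (card (T B \<omega> \<union> T B \<omega>')) = 2 * real n - real (card (cell_set n m \<omega> \<inter> cell_set n m \<omega>'))"
      unfolding card_T_Int[OF that] by linarith
    ultimately have e1: "real (card (S B \<omega> \<inter> S B \<omega>'))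
        = real q - 2 * real n + real (card (cell_set n m \<omega> \<inter> cell_set n m \<omega>'))"
      by (simp add: card_block[OF that(1)])
    have e2: "real \<sigma> = real q - real n" using True n_le by (simp add: \<sigma> of_nat_diff)
    show ?thesis unfolding e1 e2 using q0 by (simp add: field_simps power2_eq_square)
  next
    case False
    then show ?thesis using card_T_Int[OF that] by (simp add: S_def \<sigma>)
  qed
  have same: "cinner (spike b (S B \<omega>)) (spike b (S B \<omega>'))
      = \<beta> * real (card (cell_set n m \<omega> \<inter> cell_set n m \<omega>')) - \<beta> * (real n)\<^sup>2 / real q
        + b\<^sup>2 * (real \<sigma>)\<^sup>2 / (real q * V)"
    if "B \<in> \<B>" "\<omega> \<in> choices n m" "\<omega>' \<in> choices n m" for B \<omega> \<omega>'
  proof -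
    have blocks: "(\<Sum>C\<in>\<B>. (\<Sum>i\<in>C. spike b (S B \<omega>) i) * (\<Sum>i\<in>C. spike b (S B \<omega>') i)) = b\<^sup>2 * (real \<sigma>)\<^sup>2"
    proof -
      have "(\<Sum>i\<in>C. spike b (S B \<omega>) i) * (\<Sum>i\<in>C. spike b (S B \<omega>') i)
          = (if C = B then b\<^sup>2 * (real \<sigma>)\<^sup>2 else 0)" if "C \<in> \<B>" for C
      proof (cases "C = B")
        case True
        then show ?thesis
          using \<open>B \<in> \<B>\<close> \<open>\<omega> \<in> choices n m\<close> \<open>\<omega>' \<in> choices n m\<close>
          by (simp add: sum_spike_block S_p card_S Int_absorb2 S_sub power2_eq_square)
      next
        case False
        then have "B \<inter> C = {}"
          using partition_onD2[OF partition] \<open>B \<in> \<B>\<close> that by (auto simp: disjoint_def)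
        then have "S B \<omega> \<inter> C = {}" using S_sub[OF \<open>B \<in> \<B>\<close> \<open>\<omega> \<in> choices n m\<close>] by blast
        then show ?thesis using False that \<open>B \<in> \<B>\<close> \<open>\<omega> \<in> choices n m\<close> by (simp add: sum_spike_block S_p)
      qed
      then show ?thesis using that(1) finite_blocks by simp
    qed
    have "cinner (spike b (S B \<omega>)) (spike b (S B \<omega>'))
        = (b\<^sup>2 * real (card (S B \<omega> \<inter> S B \<omega>')) - \<gamma> / V * (b\<^sup>2 * (real \<sigma>)\<^sup>2)) / a"
      unfolding cinner_def blocks using that by (simp add: sum_spike_mult S_p)
    also have "\<dots> = \<beta> * (real (card (S B \<omega> \<inter> S B \<omega>')) - (real \<sigma>)\<^sup>2 / real q)
        + b\<^sup>2 * (real \<sigma>)\<^sup>2 * ((1 / real q - \<gamma> / V) / a)"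
    proof -
      have "(y * x - g * (y * t)) / A = y / A * (x - t * iq) + y * t * ((iq - g) / A)" for y x g t A iq :: real
        by (simp add: diff_divide_distrib right_diff_distrib mult_ac)
      from this[of "b\<^sup>2" "real (card (S B \<omega> \<inter> S B \<omega>'))" "\<gamma> / V" "(real \<sigma>)\<^sup>2" a "1 / real q"] show ?thesis by (simp add: \<beta>_def)
    qed
    also have "(1 / real q - \<gamma> / V) / a = 1 / (real q * V)"
    proof -
      have "1 / real q - \<gamma> / V = (V - \<gamma> * real q) / (real q * V)" using q0 V_pos by (simp add: field_simps)
      moreover have "V - \<gamma> * real q = a" by (simp add: V_def)
      ultimately show ?thesis using a_pos by simp
    qed
    finally show ?thesis unfolding card_S_Int[OF that] by (simp add: right_diff_distrib)
  qed
  have diff: "cinner (spike b (S B \<omega>)) (spike b (S B' \<omega>')) = 0"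
    if "B \<in> \<B>" "B' \<in> \<B>" "B \<noteq> B'" "\<omega> \<in> choices n m" "\<omega>' \<in> choices n m" for B B' \<omega> \<omega>'
  proof -
    have BB: "B \<inter> B' = {}" using partition_onD2[OF partition] that by (auto simp: disjoint_def)
    then have "S B \<omega> \<inter> S B' \<omega>' = {}" using S_sub that by blast
    moreover have "(\<Sum>C\<in>\<B>. (\<Sum>i\<in>C. spike b (S B \<omega>) i) * (\<Sum>i\<in>C. spike b (S B' \<omega>') i)) = 0"
    proof (intro sum.neutral ballI)
      fix C assume C: "C \<in> \<B>"
      have "B \<noteq> C \<or> B' \<noteq> C" using that(3) by blast
      then have "B \<inter> C = {} \<or> B' \<inter> C = {}"
        using disjointD[OF partition_onD2[OF partition]] C that(1,2) by blast
      then have "S B \<omega> \<inter> C = {} \<or> S B' \<omega>' \<inter> C = {}"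
        using S_sub[OF that(1,4)] S_sub[OF that(2,5)] by blast
      then show "(\<Sum>i\<in>C. spike b (S B \<omega>) i) * (\<Sum>i\<in>C. spike b (S B' \<omega>') i) = 0"
        using C that by (auto simp: sum_spike_block S_p)
    qed
    ultimately show ?thesis unfolding cinner_def using that by (simp add: sum_spike_mult S_p)
  qed
  define N where "N = real m ^ n"
  define X0 where "X0 = exp (b\<^sup>2 * (real \<sigma>)\<^sup>2 / (real q * V))
        * (exp (- (\<beta> * (real n)\<^sup>2 / real q)) * (1 + (exp \<beta> - 1) / real m) ^ n)"
  have N0: "0 < N" using m by (simp add: N_def)
  have inner: "(\<Sum>\<omega>'\<in>choices n m. exp (cinner (spike b (S B \<omega>)) (spike b (S B' \<omega>'))))
      = (if B' = B then X0 * N else N)" if "B \<in> \<B>" "B' \<in> \<B>" "\<omega> \<in> choices n m" for B B' \<omega>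
  proof (cases "B' = B")
    case True
    have "(\<Sum>\<omega>'\<in>choices n m. exp (cinner (spike b (S B \<omega>)) (spike b (S B \<omega>'))))
      = (\<Sum>\<omega>'\<in>choices n m. exp (b\<^sup>2 * (real \<sigma>)\<^sup>2 / (real q * V)) * exp (- (\<beta> * (real n)\<^sup>2 / real q))
          * exp (\<beta> * real (card (cell_set n m \<omega> \<inter> cell_set n m \<omega>'))))"
      using that by (intro sum.cong refl) (simp add: same exp_add[symmetric])
    also have "\<dots> = exp (b\<^sup>2 * (real \<sigma>)\<^sup>2 / (real q * V)) * exp (- (\<beta> * (real n)\<^sup>2 / real q))
          * (real m * (1 + (exp \<beta> - 1) / real m)) ^ n"
      using that(3) m by (simp only: sum_distrib_left[symmetric] sum_exp_overlap)
    also have "\<dots> = X0 * N" by (simp add: X0_def N_def power_mult_distrib mult_ac)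
    finally show ?thesis using True by simp
  next
    case False
    have "(\<Sum>\<omega>'\<in>choices n m. exp (cinner (spike b (S B \<omega>)) (spike b (S B' \<omega>')))) = (\<Sum>\<omega>'\<in>choices n m. 1)"
      using that False by (intro sum.cong refl) (simp add: diff)
    then show ?thesis using False by (simp add: N_def card_choices)
  qed
  let ?\<Omega> = "\<B> \<times> choices n m"
  show ?thesis
  proof (rule minimax_risk_ge[of ?\<Omega> "\<lambda>(B, \<omega>). spike b (S B \<omega>)"])
    show "finite ?\<Omega>" using finite_blocks finite_choices by simp
    have "\<B> \<noteq> {}" using card_blocks R_pos by auto
    then show "?\<Omega> \<noteq> {}" using choices_nonempty[OF m] by blast
    show "0 < \<eta>" by (rule \<eta>)
    fix z assume "z \<in> ?\<Omega>"
    then obtain B \<omega> where z: "z = (B, \<omega>)" "B \<in> \<B>" "\<omega> \<in> choices n m" by blast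
    show "(case z of (B, \<omega>) \<Rightarrow> spike b (S B \<omega>)) \<in> sparse_alt p s \<epsilon>"
      unfolding z(1) prod.case
      by (rule spike_sparse_alt[OF S_p[OF z(2,3)]]) (use card_S[OF z(2,3)] b \<sigma>(2) in simp_all)
  next
    have "(\<Sum>z\<in>?\<Omega>. \<Sum>z'\<in>?\<Omega>. exp (cinner (case z of (B, \<omega>) \<Rightarrow> spike b (S B \<omega>)) (case z' of (B, \<omega>) \<Rightarrow> spike b (S B \<omega>))))
      = (\<Sum>B\<in>\<B>. \<Sum>\<omega>\<in>choices n m. \<Sum>B'\<in>\<B>. \<Sum>\<omega>'\<in>choices n m. exp (cinner (spike b (S B \<omega>)) (spike b (S B' \<omega>'))))"
      by (simp only: sum.cartesian_product' prod.case)
    also have "\<dots> = (\<Sum>B\<in>\<B>. \<Sum>\<omega>\<in>choices n m. \<Sum>B'\<in>\<B>. N + (if B' = B then (X0 - 1) * N else 0))"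
      by (intro sum.cong refl) (simp add: inner algebra_simps)
    also have "\<dots> = (\<Sum>B\<in>\<B>. \<Sum>\<omega>\<in>choices n m. real R * N + (X0 - 1) * N)"
      by (intro sum.cong refl) (simp add: sum.distrib finite_blocks card_blocks)
    also have "\<dots> = real R * N * (real R * N + (X0 - 1) * N)"
      by (simp add: card_blocks card_choices N_def)
    also have "\<dots> \<le> real R * N * ((1 + \<eta>\<^sup>2) * (real R * N))"
    proof (intro mult_left_mono)
      have "(X0 - 1) * N \<le> (\<eta>\<^sup>2 * real R) * N"
        using X N0 by (intro mult_right_mono) (auto simp: X0_def \<beta>_def)
      then show "real R * N + (X0 - 1) * N \<le> (1 + \<eta>\<^sup>2) * (real R * N)" by (simp add: algebra_simps)
    qed (use N0 in simp)
    also have "\<dots> = (1 + \<eta>\<^sup>2) * (real (card ?\<Omega>))\<^sup>2"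
      by (simp add: card_cartesian_product card_blocks card_choices N_def power2_eq_square)
    finally show "(\<Sum>z\<in>?\<Omega>. \<Sum>z'\<in>?\<Omega>. exp (cinner (case z of (B, \<omega>) \<Rightarrow> spike b (S B \<omega>)) (case z' of (B, \<omega>) \<Rightarrow> spike b (S B \<omega>))))
      \<le> (1 + \<eta>\<^sup>2) * (real (card ?\<Omega>))\<^sup>2" .
  qed
qed

text \<open>The signal must have at most s nonzero coordinates and should cover a fixed fraction of the block. If at most half of
the block has to vanish, one zero is put in each cell and the rest of the block is filled; otherwise one nonzero coordinate
is put in each cell of size at most 4.\<close>

lemma minimax_risk_ge_upsilon:
  assumes s: "1 \<le> s" "s < q" "q < 4 * s"
    and c: "0 < c" "16 * c \<le> 1" "290 * c \<le> 1" "290 * c \<le> \<eta>\<^sup>2" and \<eta>: "0 < \<eta>"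
    and \<epsilon>: "0 \<le> \<epsilon>" "\<epsilon>\<^sup>2 \<le> c * upsilon_sq p s \<gamma> R"
  shows "1 - \<eta> \<le> minimax_risk p s \<gamma> \<B> \<epsilon>"
proof -
  define u where "u = upsilon_sq p s \<gamma> R"
  define d where "d = real q - real s"
  define L where "L = 1 + ln (real R)"
  define B where "B = block_scale (real q) d (real R)"
  have R1: "1 \<le> real R" using R_pos by simp
  have L1: "1 \<le> L" using R1 by (simp add: L_def)
  have d0: "0 < d" "d \<le> real q" using s by (auto simp: d_def)
  have q0: "0 < real q" using q_pos by simp
  have u: "u = min (a * (real q / d) * B) (V * L)"
    unfolding u_def d_def L_def B_def V_def using p_eq R_pos q_pos s by (intro upsilon_sq_eq)
  have B0: "0 \<le> B" unfolding B_def using d0 R1 by (intro block_scale_nonneg) auto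
  have u0: "0 \<le> u" unfolding u using a_pos V_pos q0 d0 B0 L1 by simp
  \<comment> \<open>Any cell design with n \<le> 2d whose signal set covers at least an eighth of the block, with at most s points, will do.\<close>
  have main: "1 - \<eta> \<le> minimax_risk p s \<gamma> \<B> \<epsilon>"
    if n: "1 \<le> n" and m: "1 \<le> m" and nm: "n * m \<le> q" "q < n * m + m" and nd: "real n \<le> 2 * d"
      and \<sigma>: "\<sigma> = (if compl then q - n else n)" "\<sigma> \<le> s" "q \<le> 8 * \<sigma>" "\<sigma> \<le> q" for n m \<sigma> compl
  proof -
    have \<sigma>0: "0 < real \<sigma>" using \<sigma>(3) q_pos by simp
    define b where "b = sqrt (c * u / real \<sigma>)"
    have b2: "b\<^sup>2 = c * u / real \<sigma>" unfolding b_def using c u0 by simp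
    have \<beta>0: "0 \<le> b\<^sup>2 / a" using a_pos by simp
    have "b\<^sup>2 / a \<le> c * (a * (real q / d) * B) / real \<sigma> / a"
      unfolding b2 u using c a_pos \<sigma>0 by (intro divide_right_mono mult_left_mono) auto
    also have "\<dots> = c * (B / d) * (real q / real \<sigma>)" using a_pos by simp
    also have "\<dots> \<le> c * (B / d) * 8"
    proof (intro mult_left_mono)
      have "real q \<le> 8 * real \<sigma>" using \<sigma>(3) by simp
      then show "real q / real \<sigma> \<le> 8" using \<sigma>0 by (simp add: divide_simps)
    qed (use c B0 d0 in simp)
    finally have \<beta>8: "b\<^sup>2 / a \<le> 8 * c * B / d" by (simp add: mult_ac)
    have ov: "exp (- (b\<^sup>2 / a * (real n)\<^sup>2 / real q)) * (1 + (exp (b\<^sup>2 / a) - 1) / real m) ^ n \<le> exp (144 * c * L)"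
      unfolding L_def using overlap_moment_le[OF n m nm nd d0 R1 _ c(2) \<beta>0] \<beta>8 c(1) by (simp add: B_def)
    have "b\<^sup>2 * (real \<sigma>)\<^sup>2 / (real q * V) = c * u * real \<sigma> / (real q * V)"
      unfolding b2 using \<sigma>0 by (simp add: power2_eq_square)
    also have "\<dots> \<le> c * (V * L) * real q / (real q * V)"
      using c u0 V_pos \<sigma>(4) q0 unfolding u by (intro divide_right_mono mult_mono) (auto simp: L1 u[symmetric])
    also have "\<dots> = c * L" using V_pos q0 by simp
    finally have e1: "exp (b\<^sup>2 * (real \<sigma>)\<^sup>2 / (real q * V)) \<le> exp (c * L)" by simp
    have "exp (b\<^sup>2 * (real \<sigma>)\<^sup>2 / (real q * V))
        * (exp (- (b\<^sup>2 / a * (real n)\<^sup>2 / real q)) * (1 + (exp (b\<^sup>2 / a) - 1) / real m) ^ n)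
      \<le> exp (c * L) * exp (144 * c * L)"
      by (rule mult_mono[OF e1 ov]) (use \<beta>0 in auto)
    also have "\<dots> = exp (145 * c * L)" by (simp add: exp_add[symmetric] algebra_simps)
    also have "\<dots> \<le> 1 + 2 * (145 * c) * real R"
      using exp_scale_minus_one_le[OF R1, of "145 * c"] c by (simp add: L_def)
    also have "\<dots> \<le> 1 + \<eta>\<^sup>2 * real R"
      using c R1 by (intro add_left_mono mult_right_mono) auto
    finally have X: "exp (b\<^sup>2 * (real \<sigma>)\<^sup>2 / (real q * V))
        * (exp (- (b\<^sup>2 / a * (real n)\<^sup>2 / real q)) * (1 + (exp (b\<^sup>2 / a) - 1) / real m) ^ n) \<le> 1 + \<eta>\<^sup>2 * real R" .
    have b0: "0 \<le> b" unfolding b_def using c u0 by simp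
    have "\<epsilon> \<le> b * sqrt (real \<sigma>)"
    proof (rule power2_le_imp_le)
      show "\<epsilon>\<^sup>2 \<le> (b * sqrt (real \<sigma>))\<^sup>2"
        using \<epsilon>(2) \<sigma>0 by (simp add: power_mult_distrib b2 u_def)
    qed (use b0 in simp)
    from minimax_risk_ge_block[OF m nm(1) \<sigma>(1,2) b0 this \<eta> X] show ?thesis .
  qed
  show ?thesis
  proof (cases "2 * (q - s) \<le> q")
    case True
    \<comment> \<open>At least d zeros, one per cell; rounding q/d down increases their number to at most 2d.\<close>
    define m where "m = q div (q - s)"
    define n where "n = q div m"
    have d1: "1 \<le> q - s" using s by simp
    have m2: "2 \<le> m" unfolding m_def using True d1 by (metis One_nat_def Suc_le_eq div_le_mono div_mult_self_is_m)
    have mq: "m \<le> q" by (simp add: m_def)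
    have n1: "1 \<le> n" unfolding n_def using m2 mq by (simp add: Suc_le_eq div_greater_zero_iff)
    have nm: "n * m \<le> q" "q < n * m + m"
      unfolding n_def using m2 dividend_less_div_times[of m q] by simp_all
    have dm: "(q - s) * m \<le> q" by (simp add: m_def)
    have nd: "q - s \<le> n"
      unfolding n_def using m2 dm by (simp add: less_eq_div_iff_mult_less_eq)
    have "q < (q - s) * m + (q - s)" unfolding m_def using d1
      by (metis One_nat_def Suc_le_eq add.commute dividend_less_times_div)
    moreover have "q - s \<le> (q - s) * m" using m2 by simp
    ultimately have "q < 2 * (q - s) * m" by linarith
    then have "n * m < 2 * (q - s) * m" using nm by linarith
    then have n2: "n < 2 * (q - s)" by (metis mult_less_cancel2)
    have "n * 2 \<le> n * m" using m2 by (intro mult_le_mono2)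
    then have n3: "2 * n \<le> q" using nm by linarith
    show ?thesis
    proof (rule main[of n m "q - n" True])
      show "real n \<le> 2 * d" using n2 s by (simp add: d_def)
    qed (use n1 m2 nm nd n3 in auto)
  next
    case False
    \<comment> \<open>As q < 4s, cells of size 4 give at most s nonzero coordinates; the minimum covers blocks with fewer than 4 points.\<close>
    define m where "m = min 4 q"
    define n where "n = q div m"
    have q2: "2 \<le> q" using s by simp
    have m1: "1 \<le> m" "m \<le> q" "m \<le> 4" "2 \<le> m" using q2 by (auto simp: m_def)
    have n1: "1 \<le> n" unfolding n_def using m1 by (simp add: Suc_le_eq div_greater_zero_iff)
    have nm: "n * m \<le> q" "q < n * m + m"
      unfolding n_def using m1 dividend_less_div_times[of m q] by simp_all
    have ns: "n \<le> s"
    proof (cases "q < 4")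
      case True
      then have "n = 1" using q2 by (simp add: n_def m_def)
      then show ?thesis using s by simp
    next
      case False
      then have "m = 4" by (simp add: m_def)
      then show ?thesis using nm s by simp
    qed
    have "n * 2 \<le> n * m" using m1 by (intro mult_le_mono2)
    then have n3: "2 * n \<le> q" using nm by linarith
    have "n * m \<le> n * 4" using m1 by (intro mult_le_mono2)
    then have n8: "q \<le> 8 * n" using nm m1 n1 by linarith
    show ?thesis
    proof (rule main[of n m n False])
      show "real n \<le> 2 * d" using n3 False s by (simp add: d_def)
    qed (use n1 m1 nm ns n3 n8 in auto)
  qed
qed

end

section \<open>Thresholded squares of Gaussian variables\<close>

text \<open>The threshold \<tau> = 0 gives a chi-square statistic for dense signals; a large \<tau> removes most of the noise in the sparse regime.\<close>

definition thr :: "real \<Rightarrow> real \<Rightarrow> real" where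
  "thr \<tau> z = max (z\<^sup>2 - \<tau>) 0"

definition thr_mean :: "real \<Rightarrow> real \<Rightarrow> real" where
  "thr_mean \<tau> \<delta> = (\<integral>z. thr \<tau> (\<delta> + z) \<partial>std_gauss)"

text \<open>The expected increase caused by a shift of the argument: the signal part of the statistic.\<close>

definition thr_gain :: "real \<Rightarrow> real \<Rightarrow> real" where
  "thr_gain \<tau> \<delta> = thr_mean \<tau> \<delta> - thr_mean \<tau> 0"

definition thr_var :: "real \<Rightarrow> real \<Rightarrow> real" where
  "thr_var \<tau> \<delta> = (\<integral>z. (thr \<tau> (\<delta> + z) - thr_mean \<tau> \<delta>)\<^sup>2 \<partial>std_gauss)"

lemma thr_nonneg[simp]: "0 \<le> thr \<tau> z" by (simp add: thr_def)

lemma measurable_thr[measurable]: "thr \<tau> \<in> borel_measurable borel"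
  unfolding thr_def by measurable

lemma thr_le: "0 \<le> \<tau> \<Longrightarrow> thr \<tau> z \<le> z\<^sup>2" by (simp add: thr_def)

lemma has_bochner_integral_std_gauss:
  fixes f :: "real \<Rightarrow> real"
  assumes [measurable]: "f \<in> borel_measurable borel"
    and "has_bochner_integral lborel (\<lambda>x. std_normal_density x * f x) c"
  shows "has_bochner_integral std_gauss f c"
  unfolding std_gauss_def using assms by (intro has_bochner_integral_density) auto

lemma std_gauss_moments:
  "has_bochner_integral std_gauss (\<lambda>z. z) 0" "has_bochner_integral std_gauss (\<lambda>z. z\<^sup>2) 1"
  "has_bochner_integral std_gauss (\<lambda>z. z ^ 3) 0" "has_bochner_integral std_gauss (\<lambda>z. z ^ 4) 3"
proof -
  show "has_bochner_integral std_gauss (\<lambda>z. z) 0"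
    using std_normal_moment_odd[of 0] by (intro has_bochner_integral_std_gauss) auto
  show "has_bochner_integral std_gauss (\<lambda>z. z\<^sup>2) 1"
    using std_normal_moment_even[of 1] by (intro has_bochner_integral_std_gauss) (auto simp: fact_numeral)
  show "has_bochner_integral std_gauss (\<lambda>z. z ^ 3) 0"
    using std_normal_moment_odd[of 1] by (intro has_bochner_integral_std_gauss) (auto simp: numeral_3_eq_3)
  show "has_bochner_integral std_gauss (\<lambda>z. z ^ 4) 3"
    using std_normal_moment_even[of 2] by (intro has_bochner_integral_std_gauss) (auto simp: fact_numeral)
qed

lemma std_gauss_shift_moments:
  "has_bochner_integral std_gauss (\<lambda>z. (\<delta> + z)\<^sup>2) (\<delta>\<^sup>2 + 1)"
  "has_bochner_integral std_gauss (\<lambda>z. ((\<delta> + z)\<^sup>2 - (\<delta>\<^sup>2 + 1))\<^sup>2) (2 + 4 * \<delta>\<^sup>2)"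
proof -
  interpret prob_space std_gauss by (rule prob_space_std_gauss)
  note M = std_gauss_moments
  have 1: "has_bochner_integral std_gauss (\<lambda>z::real. 1) (1::real)"
    by (simp add: has_bochner_integral_iff prob_space[simplified])
  have "has_bochner_integral std_gauss (\<lambda>z. \<delta>\<^sup>2 * 1 + 2 * \<delta> * z + z\<^sup>2) (\<delta>\<^sup>2 * 1 + 2 * \<delta> * 0 + 1)"
    by (intro has_bochner_integral_add has_bochner_integral_mult_right M 1)
  then show "has_bochner_integral std_gauss (\<lambda>z. (\<delta> + z)\<^sup>2) (\<delta>\<^sup>2 + 1)"
    by (simp add: power2_sum mult_ac add_ac)
  have "has_bochner_integral std_gauss
      (\<lambda>z. z ^ 4 + 4 * \<delta> * z ^ 3 + (4 * \<delta>\<^sup>2 - 2) * z\<^sup>2 + (- 4 * \<delta>) * z + 1 * 1)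
      (3 + 4 * \<delta> * 0 + (4 * \<delta>\<^sup>2 - 2) * 1 + (- 4 * \<delta>) * 0 + 1 * 1)"
    by (intro has_bochner_integral_add has_bochner_integral_mult_right M 1)
  moreover have "z ^ 4 + 4 * \<delta> * z ^ 3 + (4 * \<delta>\<^sup>2 - 2) * z\<^sup>2 + (- 4 * \<delta>) * z + 1 * 1
      = ((\<delta> + z)\<^sup>2 - (\<delta>\<^sup>2 + 1))\<^sup>2" for z :: real
    by (simp add: power2_eq_square power3_eq_cube power4_eq_xxxx algebra_simps)
  ultimately show "has_bochner_integral std_gauss (\<lambda>z. ((\<delta> + z)\<^sup>2 - (\<delta>\<^sup>2 + 1))\<^sup>2) (2 + 4 * \<delta>\<^sup>2)"
    by (simp add: algebra_simps)
qed

lemma std_gauss_exp_square: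
  "has_bochner_integral std_gauss (\<lambda>z. exp ((\<delta> + z)\<^sup>2 / 4)) (sqrt 2 * exp (\<delta>\<^sup>2 / 2))"
proof (rule has_bochner_integral_std_gauss)
  have e: "std_normal_density z * exp ((\<delta> + z)\<^sup>2 / 4) = sqrt 2 * exp (\<delta>\<^sup>2 / 2) * normal_density \<delta> (sqrt 2) z" for z
  proof -
    have "- z\<^sup>2 / 2 + (\<delta> + z)\<^sup>2 / 4 = \<delta>\<^sup>2 / 2 + - (z - \<delta>)\<^sup>2 / 4"
      by (simp add: power2_eq_square field_simps)
    then have "exp (- z\<^sup>2 / 2) * exp ((\<delta> + z)\<^sup>2 / 4) = exp (\<delta>\<^sup>2 / 2) * exp (- (z - \<delta>)\<^sup>2 / 4)"
      by (simp add: exp_add[symmetric])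
    moreover have "1 / sqrt (2 * pi) = sqrt 2 * (1 / sqrt (2 * pi * 2))"
    proof -
      have "sqrt (2 * pi * 2) = sqrt 2 * sqrt (2 * pi)" by (simp add: real_sqrt_mult)
      then show ?thesis by simp
    qed
    ultimately show ?thesis by (simp add: std_normal_density_def normal_density_def)
  qed
  have "has_bochner_integral lborel (normal_density \<delta> (sqrt 2)) 1"
    by (simp add: has_bochner_integral_iff)
  from has_bochner_integral_mult_right[OF this, of "sqrt 2 * exp (\<delta>\<^sup>2 / 2)"]
  show "has_bochner_integral lborel (\<lambda>x. std_normal_density x * exp ((\<delta> + x)\<^sup>2 / 4)) (sqrt 2 * exp (\<delta>\<^sup>2 / 2))"
    unfolding e by simp
qed simp

lemma integral_std_gauss_minus:
  fixes f :: "real \<Rightarrow> real"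
  assumes [measurable]: "f \<in> borel_measurable borel"
  shows "(\<integral>z. f (- z) \<partial>std_gauss) = (\<integral>z. f z \<partial>std_gauss)"
proof -
  have "(\<integral>z. f z \<partial>std_gauss) = (\<integral>z. std_normal_density z *\<^sub>R f z \<partial>lborel)"
    unfolding std_gauss_def by (rule integral_density) auto
  also have "\<dots> = (\<integral>z. std_normal_density (- z) *\<^sub>R f (- z) \<partial>lborel)"
    by (subst lborel_integral_real_affine[where c = "-1" and t = 0]) auto
  also have "\<dots> = (\<integral>z. std_normal_density z *\<^sub>R f (- z) \<partial>lborel)"
    by (simp add: std_normal_density_def)
  also have "\<dots> = (\<integral>z. f (- z) \<partial>std_gauss)"
    unfolding std_gauss_def by (rule integral_density[symmetric]) auto
  finally show ?thesis by simp
qed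

lemma integrable_std_gauss_bound:
  fixes f g :: "real \<Rightarrow> real"
  assumes "integrable std_gauss g" and [measurable]: "f \<in> borel_measurable borel"
    and "\<And>z. 0 \<le> f z" "\<And>z. f z \<le> g z"
  shows "integrable std_gauss f"
  by (rule Bochner_Integration.integrable_bound[OF assms(1)])
     (use assms in \<open>auto intro!: AE_I2 order_trans[OF _ abs_ge_self]\<close>)

lemma integrable_thr:
  assumes "0 \<le> \<tau>"
  shows "integrable std_gauss (\<lambda>z. thr \<tau> (\<delta> + z))"
proof (rule integrable_std_gauss_bound[OF integrable.intros[OF std_gauss_shift_moments(1)[of \<delta>]]])
  show "thr \<tau> (\<delta> + z) \<le> (\<delta> + z)\<^sup>2" for z by (rule thr_le[OF assms])
qed (simp_all add: thr_def)

lemma integrable_thr_dev: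
  assumes "0 \<le> \<tau>"
  shows "integrable std_gauss (\<lambda>z. (thr \<tau> (\<delta> + z) - c)\<^sup>2)"
proof (rule integrable_std_gauss_bound[of "\<lambda>z. 2 * (2 * ((\<delta> + z)\<^sup>2 - (\<delta>\<^sup>2 + 1))\<^sup>2 + 2 * (\<delta>\<^sup>2 + 1)\<^sup>2) + 2 * c\<^sup>2"])
  interpret prob_space std_gauss by (rule prob_space_std_gauss)
  show "integrable std_gauss (\<lambda>z. 2 * (2 * ((\<delta> + z)\<^sup>2 - (\<delta>\<^sup>2 + 1))\<^sup>2 + 2 * (\<delta>\<^sup>2 + 1)\<^sup>2) + 2 * c\<^sup>2)"
    by (intro Bochner_Integration.integrable_add integrable_mult_right integrable_const
        integrable.intros[OF std_gauss_shift_moments(2)[of \<delta>]])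
  fix z
  have sq: "(x + y)\<^sup>2 \<le> 2 * x\<^sup>2 + 2 * y\<^sup>2" for x y :: real
    using sum_squares_bound[of x y] by (simp add: power2_sum)
  have "(thr \<tau> (\<delta> + z) + - c)\<^sup>2 \<le> 2 * (thr \<tau> (\<delta> + z))\<^sup>2 + 2 * (- c)\<^sup>2" by (rule sq)
  moreover have "(thr \<tau> (\<delta> + z))\<^sup>2 \<le> ((\<delta> + z)\<^sup>2)\<^sup>2" using assms by (intro power_mono thr_le) auto
  moreover have "((\<delta> + z)\<^sup>2)\<^sup>2 \<le> 2 * ((\<delta> + z)\<^sup>2 - (\<delta>\<^sup>2 + 1))\<^sup>2 + 2 * (\<delta>\<^sup>2 + 1)\<^sup>2"
    using sq[of "(\<delta> + z)\<^sup>2 - (\<delta>\<^sup>2 + 1)" "\<delta>\<^sup>2 + 1"] by simp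
  ultimately show "(thr \<tau> (\<delta> + z) - c)\<^sup>2 \<le> 2 * (2 * ((\<delta> + z)\<^sup>2 - (\<delta>\<^sup>2 + 1))\<^sup>2 + 2 * (\<delta>\<^sup>2 + 1)\<^sup>2) + 2 * c\<^sup>2"
    by simp
qed auto

text \<open>The function is even and convex, so averaging it over the shifts by \<delta> and - \<delta> does not decrease it. Hence
pairs of coordinates may be discarded from lower bounds for the total gain.\<close>

lemma thr_gain_nonneg:
  assumes "0 \<le> \<tau>"
  shows "0 \<le> thr_gain \<tau> \<delta>"
proof -
  have "thr_mean \<tau> (- \<delta>) = (\<integral>z. thr \<tau> (- \<delta> + - z) \<partial>std_gauss)"
    unfolding thr_mean_def by (rule integral_std_gauss_minus[symmetric]) simp
  also have "\<dots> = thr_mean \<tau> \<delta>"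
    unfolding thr_mean_def by (intro Bochner_Integration.integral_cong) (auto simp: thr_def power2_eq_square algebra_simps)
  finally have "2 * thr_mean \<tau> \<delta> = thr_mean \<tau> \<delta> + thr_mean \<tau> (- \<delta>)" by simp
  also have "\<dots> = (\<integral>z. thr \<tau> (\<delta> + z) + thr \<tau> (- \<delta> + z) \<partial>std_gauss)"
    unfolding thr_mean_def by (rule Bochner_Integration.integral_add[symmetric]) (rule integrable_thr[OF assms])+
  also have "\<dots> \<ge> (\<integral>z. 2 * thr \<tau> (0 + z) \<partial>std_gauss)"
  proof (rule integral_mono)
    fix z :: real
    have "2 * (z\<^sup>2 - \<tau>) \<le> ((\<delta> + z)\<^sup>2 - \<tau>) + ((- \<delta> + z)\<^sup>2 - \<tau>)"
      by (simp add: power2_eq_square algebra_simps)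
    also have "\<dots> \<le> thr \<tau> (\<delta> + z) + thr \<tau> (- \<delta> + z)"
      by (intro add_mono) (simp_all add: thr_def)
    finally have "2 * (z\<^sup>2 - \<tau>) \<le> thr \<tau> (\<delta> + z) + thr \<tau> (- \<delta> + z)" .
    then show "2 * thr \<tau> (0 + z) \<le> thr \<tau> (\<delta> + z) + thr \<tau> (- \<delta> + z)"
      using thr_nonneg[of \<tau> "\<delta> + z"] thr_nonneg[of \<tau> "- \<delta> + z"]
      by (simp add: thr_def[of \<tau> z] max_def)
  qed (intro Bochner_Integration.integrable_add integrable_mult_right integrable_thr assms)+
  finally show ?thesis by (simp add: thr_gain_def thr_mean_def)
qed

text \<open>Thresholding costs at most \<tau>: the mean is at least \<delta>^2 + 1 - \<tau>, and without a shift it is at most 1.\<close>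

lemma thr_gain_ge:
  assumes "0 \<le> \<tau>"
  shows "\<delta>\<^sup>2 - \<tau> \<le> thr_gain \<tau> \<delta>"
proof -
  interpret prob_space std_gauss by (rule prob_space_std_gauss)
  have m: "integrable std_gauss (\<lambda>z. (\<delta> + z)\<^sup>2)" "(\<integral>z. (\<delta> + z)\<^sup>2 \<partial>std_gauss) = \<delta>\<^sup>2 + 1" for \<delta>
    by (rule integrable.intros[OF std_gauss_shift_moments(1)])
       (rule has_bochner_integral_integral_eq[OF std_gauss_shift_moments(1)])
  have "thr_mean \<tau> 0 \<le> (\<integral>z. (0 + z)\<^sup>2 \<partial>std_gauss)"
    unfolding thr_mean_def using assms by (intro integral_mono integrable_thr m) (auto intro: thr_le)
  then have "thr_mean \<tau> 0 \<le> 1" using m(2)[of 0] by simp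
  moreover have "(\<integral>z. (\<delta> + z)\<^sup>2 - \<tau> \<partial>std_gauss) \<le> thr_mean \<tau> \<delta>"
    unfolding thr_mean_def using assms by (intro integral_mono integrable_thr Bochner_Integration.integrable_diff m) (auto simp: thr_def)
  then have "\<delta>\<^sup>2 + 1 - \<tau> \<le> thr_mean \<tau> \<delta>"
    by (subst (asm) Bochner_Integration.integral_diff) (auto simp: m prob_space[simplified])
  ultimately show ?thesis by (simp add: thr_gain_def)
qed

lemma sqrt_two_bound: "128 * sqrt 2 \<le> (182::real)"
proof -
  have "sqrt 2 \<le> 182 / 128" by (rule real_le_lsqrt) (auto simp: power2_eq_square)
  then show ?thesis by simp
qed

lemma square_le_exp: "0 \<le> x \<Longrightarrow> x\<^sup>2 \<le> 128 * exp (x / 8)" for x :: real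
  using exp_lower_Taylor_quadratic[of "x / 8"] by (simp add: power2_eq_square)

text \<open>Second-order remainder of the exponential moment. It carries the factor exp (- \<tau>/4) because it vanishes below the threshold.\<close>

lemma thr_square_exp_le:
  assumes "0 \<le> u" "u \<le> 1 / 8"
  shows "(thr \<tau> z)\<^sup>2 * exp (u * thr \<tau> z) \<le> 128 * (exp (- \<tau> / 4) * exp (z\<^sup>2 / 4))"
proof (cases "z\<^sup>2 \<le> \<tau>")
  case False
  define g where "g = z\<^sup>2 - \<tau>"
  have g: "thr \<tau> z = g" "0 \<le> g" using False by (auto simp: thr_def g_def)
  have "g\<^sup>2 * exp (u * g) \<le> 128 * exp (g / 8) * exp (g / 8)"
    using assms g mult_right_mono[OF assms(2) g(2)] by (intro mult_mono square_le_exp) auto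
  also have "\<dots> = 128 * exp (g / 4)" by (simp add: exp_add[symmetric])
  also have "exp (g / 4) = exp (- \<tau> / 4) * exp (z\<^sup>2 / 4)"
    by (simp add: g_def exp_add[symmetric] field_simps)
  finally show ?thesis by (simp add: g)
qed (simp add: thr_def)

text \<open>From exp x \<le> 1 + x + x^2 exp x for nonnegative x: the noise is sub-Gaussian up to u = 1/8 with variance proxy of order
exp (- \<tau>/4).\<close>

lemma thr_null_mgf:
  assumes \<tau>: "0 \<le> \<tau>" and u: "0 \<le> u" "u \<le> 1 / 8"
  shows "integrable std_gauss (\<lambda>z. exp (u * (thr \<tau> z - thr_mean \<tau> 0)))"
    and "(\<integral>z. exp (u * (thr \<tau> z - thr_mean \<tau> 0)) \<partial>std_gauss) \<le> exp (182 * u\<^sup>2 * exp (- \<tau> / 4))"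
proof -
  interpret prob_space std_gauss by (rule prob_space_std_gauss)
  note E = std_gauss_exp_square[of 0, simplified]
  have Ei: "integrable std_gauss (\<lambda>z. exp (z\<^sup>2 / 4))" "(\<integral>z. exp (z\<^sup>2 / 4) \<partial>std_gauss) = sqrt 2"
    by (rule integrable.intros[OF E]) (rule has_bochner_integral_integral_eq[OF E])
  have i1: "integrable std_gauss (\<lambda>z. exp (u * thr \<tau> z))"
  proof (rule integrable_std_gauss_bound[OF Ei(1)])
    fix z
    have "u * thr \<tau> z \<le> 1 / 8 * z\<^sup>2" using thr_le[OF \<tau>] u by (intro mult_mono) auto
    also have "\<dots> \<le> z\<^sup>2 / 4" by simp
    finally show "exp (u * thr \<tau> z) \<le> exp (z\<^sup>2 / 4)" by simp
  qed auto
  have eq: "exp (u * (thr \<tau> z - thr_mean \<tau> 0)) = exp (- u * thr_mean \<tau> 0) * exp (u * thr \<tau> z)" for z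
    by (simp add: exp_add[symmetric] algebra_simps)
  show "integrable std_gauss (\<lambda>z. exp (u * (thr \<tau> z - thr_mean \<tau> 0)))"
    unfolding eq using i1 by simp
  have it: "integrable std_gauss (thr \<tau>)" using integrable_thr[OF \<tau>, of 0] by simp
  note s2 = sqrt_two_bound
  have "(\<integral>z. exp (u * thr \<tau> z) \<partial>std_gauss)
      \<le> (\<integral>z. 1 + u * thr \<tau> z + u\<^sup>2 * (128 * (exp (- \<tau> / 4) * exp (z\<^sup>2 / 4))) \<partial>std_gauss)"
  proof (rule integral_mono[OF i1])
    show "integrable std_gauss (\<lambda>z. 1 + u * thr \<tau> z + u\<^sup>2 * (128 * (exp (- \<tau> / 4) * exp (z\<^sup>2 / 4))))"
      by (intro Bochner_Integration.integrable_add integrable_mult_right it Ei) simp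
    fix z
    define x where "x = u * thr \<tau> z"
    have x: "0 \<le> x" using u by (simp add: x_def)
    have "1 + - x \<le> exp (- x)" by (rule exp_ge_add_one_self)
    then have "(1 - x) * exp x \<le> exp (- x) * exp x" by (intro mult_right_mono) auto
    then have "exp x - 1 \<le> x * exp x" by (simp add: exp_add[symmetric] algebra_simps)
    moreover from this x have "x * (exp x - 1) \<le> x * (x * exp x)" by (intro mult_left_mono) auto
    ultimately have "exp x \<le> 1 + x + x\<^sup>2 * exp x" by (simp add: power2_eq_square algebra_simps)
    also have "x\<^sup>2 * exp x = u\<^sup>2 * ((thr \<tau> z)\<^sup>2 * exp (u * thr \<tau> z))"
      by (simp add: x_def power_mult_distrib)
    also have "\<dots> \<le> u\<^sup>2 * (128 * (exp (- \<tau> / 4) * exp (z\<^sup>2 / 4)))"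
      using thr_square_exp_le[OF u] by (intro mult_left_mono) auto
    finally show "exp (u * thr \<tau> z) \<le> 1 + u * thr \<tau> z + u\<^sup>2 * (128 * (exp (- \<tau> / 4) * exp (z\<^sup>2 / 4)))"
      by (simp add: x_def)
  qed
  also have "\<dots> = 1 + u * thr_mean \<tau> 0 + u\<^sup>2 * (128 * (exp (- \<tau> / 4) * sqrt 2))"
    by (simp add: it Ei prob_space[simplified] thr_mean_def)
  also have "\<dots> \<le> 1 + (u * thr_mean \<tau> 0 + 182 * u\<^sup>2 * exp (- \<tau> / 4))"
    using mult_right_mono[OF s2, of "u\<^sup>2 * exp (- \<tau> / 4)"] by (simp add: mult_ac)
  also have "\<dots> \<le> exp (u * thr_mean \<tau> 0 + 182 * u\<^sup>2 * exp (- \<tau> / 4))"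
    by (rule exp_ge_add_one_self)
  finally have "exp (- u * thr_mean \<tau> 0) * (\<integral>z. exp (u * thr \<tau> z) \<partial>std_gauss)
      \<le> exp (- u * thr_mean \<tau> 0) * exp (u * thr_mean \<tau> 0 + 182 * u\<^sup>2 * exp (- \<tau> / 4))"
    by (intro mult_left_mono) auto
  also have "\<dots> = exp (182 * u\<^sup>2 * exp (- \<tau> / 4))" by (simp add: exp_add[symmetric])
  finally show "(\<integral>z. exp (u * (thr \<tau> z - thr_mean \<tau> 0)) \<partial>std_gauss) \<le> exp (182 * u\<^sup>2 * exp (- \<tau> / 4))"
    unfolding eq by simp
qed

text \<open>The mean minimises the mean square deviation.\<close>

lemma thr_var_le_dev:
  assumes "0 \<le> \<tau>"
  shows "thr_var \<tau> \<delta> \<le> (\<integral>z. (thr \<tau> (\<delta> + z) - c)\<^sup>2 \<partial>std_gauss)"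
proof -
  interpret prob_space std_gauss by (rule prob_space_std_gauss)
  let ?m = "thr_mean \<tau> \<delta>"
  have i: "integrable std_gauss (\<lambda>z. thr \<tau> (\<delta> + z))" by (rule integrable_thr[OF assms])
  have "(\<integral>z. (thr \<tau> (\<delta> + z) - c)\<^sup>2 \<partial>std_gauss)
    = (\<integral>z. (thr \<tau> (\<delta> + z) - ?m)\<^sup>2 + (2 * (?m - c) * (thr \<tau> (\<delta> + z) - ?m) + (?m - c)\<^sup>2) \<partial>std_gauss)"
    by (intro Bochner_Integration.integral_cong refl) (simp add: power2_eq_square algebra_simps)
  also have "\<dots> = thr_var \<tau> \<delta> + (2 * (?m - c) * (?m - ?m) + (?m - c)\<^sup>2)"
    unfolding thr_var_def using integrable_thr_dev[OF assms, of \<delta> ?m] i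
    by (subst Bochner_Integration.integral_add) (auto simp: thr_mean_def[symmetric] prob_space[simplified])
  finally show ?thesis by simp
qed

text \<open>The variance is controlled by the gain itself and by the noise level, so that a large expected gain can always be detected by Chebyshev's
inequality. For a large shift compare with the square, whose variance is 2 + 4 \<delta>^2. For a shift below the order of
the threshold, the second moment is at most 8 \<tau> times the mean, up to values that exceed 8 \<tau> with exponentially small weight.\<close>

lemma thr_var_le:
  assumes \<tau>: "0 \<le> \<tau>"
  shows "thr_var \<tau> \<delta> \<le> 12 * (1 + \<tau>) * thr_gain \<tau> \<delta> + 600 * exp (- \<tau> / 8)"
proof -
  interpret prob_space std_gauss by (rule prob_space_std_gauss)
  let ?g = "thr_gain \<tau> \<delta>"
  have g0: "0 \<le> ?g" by (rule thr_gain_nonneg[OF \<tau>])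
  have g1: "\<delta>\<^sup>2 - \<tau> \<le> ?g" by (rule thr_gain_ge[OF \<tau>])
  have gg: "12 * ?g \<le> 12 * (1 + \<tau>) * ?g" using g0 \<tau> by (simp add: algebra_simps)
  note s2 = sqrt_two_bound
  show ?thesis
  proof (cases "2 * \<tau> \<le> \<delta>\<^sup>2")
    case True
    have "thr_var \<tau> \<delta> \<le> (\<integral>z. (thr \<tau> (\<delta> + z) - max (\<delta>\<^sup>2 + 1 - \<tau>) 0)\<^sup>2 \<partial>std_gauss)"
      by (rule thr_var_le_dev[OF \<tau>])
    also have "\<dots> \<le> (\<integral>z. ((\<delta> + z)\<^sup>2 - (\<delta>\<^sup>2 + 1))\<^sup>2 \<partial>std_gauss)"
    proof (rule integral_mono[OF integrable_thr_dev[OF \<tau>]])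
      show "integrable std_gauss (\<lambda>z. ((\<delta> + z)\<^sup>2 - (\<delta>\<^sup>2 + 1))\<^sup>2)"
        by (rule integrable.intros[OF std_gauss_shift_moments(2)])
      fix z
      have "\<bar>thr \<tau> (\<delta> + z) - max (\<delta>\<^sup>2 + 1 - \<tau>) 0\<bar> \<le> \<bar>(\<delta> + z)\<^sup>2 - (\<delta>\<^sup>2 + 1)\<bar>"
        unfolding thr_def by linarith
      then show "(thr \<tau> (\<delta> + z) - max (\<delta>\<^sup>2 + 1 - \<tau>) 0)\<^sup>2 \<le> ((\<delta> + z)\<^sup>2 - (\<delta>\<^sup>2 + 1))\<^sup>2"
        by (rule power2_le_iff_abs_le[THEN iffD2, rotated] | simp add: abs_le_square_iff)
    qed
    also have "\<dots> = 2 + 4 * \<delta>\<^sup>2"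
      by (rule has_bochner_integral_integral_eq[OF std_gauss_shift_moments(2)])
    finally have v: "thr_var \<tau> \<delta> \<le> 2 + 4 * \<delta>\<^sup>2" .
    show ?thesis
    proof (cases "1 \<le> \<delta>\<^sup>2")
      case big: True
      have "0 \<le> 600 * exp (- \<tau> / 8)" by simp
      then show ?thesis using v big True g1 gg by linarith
    next
      case False
      then have "\<tau> \<le> 1" using True by linarith
      then have "1 - 1 / 8 \<le> exp (- \<tau> / 8)" using exp_ge_add_one_self[of "- \<tau> / 8"] by linarith
      then show ?thesis using v False g0 gg by linarith
    qed
  next
    case False
    have E: "integrable std_gauss (\<lambda>z. exp ((\<delta> + z)\<^sup>2 / 4))"
        "(\<integral>z. exp ((\<delta> + z)\<^sup>2 / 4) \<partial>std_gauss) = sqrt 2 * exp (\<delta>\<^sup>2 / 2)" for \<delta>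
      by (rule integrable.intros[OF std_gauss_exp_square])
         (rule has_bochner_integral_integral_eq[OF std_gauss_exp_square])
    have it: "integrable std_gauss (\<lambda>z. thr \<tau> (\<delta> + z))" for \<delta> by (rule integrable_thr[OF \<tau>])
    have "thr_var \<tau> \<delta> \<le> (\<integral>z. (thr \<tau> (\<delta> + z) - 0)\<^sup>2 \<partial>std_gauss)"
      by (rule thr_var_le_dev[OF \<tau>])
    also have "\<dots> \<le> (\<integral>z. 8 * \<tau> * thr \<tau> (\<delta> + z) + 128 * exp (- 5 * \<tau> / 4) * exp ((\<delta> + z)\<^sup>2 / 4) \<partial>std_gauss)"
    proof (rule integral_mono[OF integrable_thr_dev[OF \<tau>]])
      show "integrable std_gauss (\<lambda>z. 8 * \<tau> * thr \<tau> (\<delta> + z) + 128 * exp (- 5 * \<tau> / 4) * exp ((\<delta> + z)\<^sup>2 / 4))"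
        by (intro Bochner_Integration.integrable_add integrable_mult_right it E)
      fix z
      define g where "g = thr \<tau> (\<delta> + z)"
      have gn: "0 \<le> g" by (simp add: g_def)
      show "(thr \<tau> (\<delta> + z) - 0)\<^sup>2 \<le> 8 * \<tau> * thr \<tau> (\<delta> + z) + 128 * exp (- 5 * \<tau> / 4) * exp ((\<delta> + z)\<^sup>2 / 4)"
      proof (cases "g \<le> 8 * \<tau>")
        case True
        then have "g\<^sup>2 \<le> 8 * \<tau> * g" using gn by (simp add: power2_eq_square mult_right_mono)
        moreover have "0 \<le> 128 * exp (- 5 * \<tau> / 4) * exp ((\<delta> + z)\<^sup>2 / 4)" by simp
        ultimately have "g\<^sup>2 \<le> 8 * \<tau> * g + 128 * exp (- 5 * \<tau> / 4) * exp ((\<delta> + z)\<^sup>2 / 4)" by linarith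
        then show ?thesis by (simp add: g_def)
      next
        case large: False
        then have "0 < g" using \<tau> by linarith
        then have gz: "g = (\<delta> + z)\<^sup>2 - \<tau>" by (auto simp: g_def thr_def max_def split: if_splits)
        have "g\<^sup>2 \<le> 128 * exp (g / 8)" by (rule square_le_exp[OF gn])
        also have "\<dots> \<le> 128 * exp (g / 4 - \<tau>)" using large by simp
        also have "g / 4 - \<tau> = - 5 * \<tau> / 4 + (\<delta> + z)\<^sup>2 / 4" by (simp add: gz field_simps)
        finally have "g\<^sup>2 \<le> 128 * exp (- 5 * \<tau> / 4) * exp ((\<delta> + z)\<^sup>2 / 4)"
          by (simp only: exp_add mult.assoc)
        moreover have "0 \<le> 8 * \<tau> * g" using \<tau> gn by simp
        ultimately have "g\<^sup>2 \<le> 8 * \<tau> * g + 128 * exp (- 5 * \<tau> / 4) * exp ((\<delta> + z)\<^sup>2 / 4)" by linarith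
        then show ?thesis by (simp add: g_def)
      qed
    qed
    also have "\<dots> = 8 * \<tau> * thr_mean \<tau> \<delta> + 128 * exp (- 5 * \<tau> / 4) * (sqrt 2 * exp (\<delta>\<^sup>2 / 2))"
      by (simp add: it E thr_mean_def)
    also have "128 * exp (- 5 * \<tau> / 4) * (sqrt 2 * exp (\<delta>\<^sup>2 / 2)) \<le> 182 * exp (- \<tau> / 8)"
    proof -
      have "exp (- 5 * \<tau> / 4) * exp (\<delta>\<^sup>2 / 2) \<le> exp (- \<tau> / 8)"
        using False \<tau> by (simp add: exp_add[symmetric])
      from mult_mono[OF s2 this] show ?thesis by (simp add: mult_ac)
    qed
    also have "8 * \<tau> * thr_mean \<tau> \<delta> = 8 * \<tau> * ?g + 8 * \<tau> * thr_mean \<tau> 0"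
      by (simp add: thr_gain_def algebra_simps)
    also have "8 * \<tau> * thr_mean \<tau> 0 \<le> 384 * exp (- \<tau> / 8)"
    proof -
      have "thr_mean \<tau> 0 \<le> (\<integral>z. 4 * exp (- \<tau> / 4) * exp ((0 + z)\<^sup>2 / 4) \<partial>std_gauss)"
        unfolding thr_mean_def
      proof (rule integral_mono[OF it])
        show "integrable std_gauss (\<lambda>z. 4 * exp (- \<tau> / 4) * exp ((0 + z)\<^sup>2 / 4))"
          by (intro integrable_mult_right E)
        fix z :: real
        have "(z\<^sup>2 - \<tau>) / 4 \<le> exp ((z\<^sup>2 - \<tau>) / 4)"
          using exp_ge_add_one_self[of "(z\<^sup>2 - \<tau>) / 4"] by linarith
        also have "\<dots> = exp (- \<tau> / 4) * exp (z\<^sup>2 / 4)" by (simp add: exp_add[symmetric] diff_divide_distrib)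
        finally have "z\<^sup>2 - \<tau> \<le> 4 * (exp (- \<tau> / 4) * exp (z\<^sup>2 / 4))" by simp
        then show "thr \<tau> (0 + z) \<le> 4 * exp (- \<tau> / 4) * exp ((0 + z)\<^sup>2 / 4)"
          by (simp add: thr_def mult.assoc)
      qed
      also have "\<dots> = exp (- \<tau> / 4) * (4 * sqrt 2)" using E(2)[of 0] by simp
      also have "\<dots> \<le> exp (- \<tau> / 4) * 6" using s2 by simp
      finally have m0: "thr_mean \<tau> 0 \<le> exp (- \<tau> / 4) * 6" .
      have "\<tau> / 8 \<le> exp (\<tau> / 8)" using exp_ge_add_one_self[of "\<tau> / 8"] by linarith
      then have "\<tau> / 8 * exp (- \<tau> / 4) \<le> exp (\<tau> / 8) * exp (- \<tau> / 4)" by (intro mult_right_mono) auto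
      also have "\<dots> = exp (- \<tau> / 8)" by (simp add: exp_add[symmetric])
      finally have "48 * \<tau> * exp (- \<tau> / 4) \<le> 384 * exp (- \<tau> / 8)" by simp
      moreover have "8 * \<tau> * thr_mean \<tau> 0 \<le> 8 * \<tau> * (exp (- \<tau> / 4) * 6)"
        using m0 \<tau> by (intro mult_left_mono) auto
      ultimately show ?thesis by simp
    qed
    finally have "thr_var \<tau> \<delta> \<le> 8 * \<tau> * ?g + 566 * exp (- \<tau> / 8)" by simp
    also have "8 * \<tau> * ?g \<le> 12 * (1 + \<tau>) * ?g" using g0 \<tau> by (intro mult_right_mono) auto
    finally show ?thesis using exp_gt_zero[of "- \<tau> / 8"] by linarith
  qed
qed

section \<open>Averages over random matchings\<close>

lemma distr_coordinate:
  assumes "i \<in> I"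
  shows "distr (gauss_prod I) borel (\<lambda>z. z i) = std_gauss"
proof -
  have "distr (gauss_prod I) borel (\<lambda>z. z i) = distr (gauss_prod I) std_gauss (\<lambda>z. z i)"
    by (intro distr_cong refl) (simp add: sets_std_gauss)
  also have "\<dots> = std_gauss"
    unfolding gauss_prod_def using assms prob_space_std_gauss by (intro distr_PiM_component) auto
  finally show ?thesis .
qed

lemma measurable_coordinate: "i \<in> I \<Longrightarrow> (\<lambda>z. z i) \<in> borel_measurable (gauss_prod I)"
  unfolding measurable_cong_sets[OF sets_gauss_prod refl] by (rule measurable_component_singleton)

lemma indep_vars_coordinates:
  assumes I: "I \<noteq> {}"
  shows "prob_space.indep_vars (gauss_prod I) (\<lambda>_. borel) (\<lambda>i z. z i) I"
proof -
  interpret prob_space "gauss_prod I" by (rule prob_space_gauss_prod)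
  have "distr (gauss_prod I) (PiM I (\<lambda>_. borel)) (\<lambda>z. \<lambda>i\<in>I. z i)
      = distr (gauss_prod I) (PiM I (\<lambda>_. borel)) (\<lambda>z. z)"
    by (intro distr_cong refl) (auto simp: PiE_def extensional_restrict)
  also have "\<dots> = gauss_prod I" by (rule distr_id2) (simp add: sets_gauss_prod)
  also have "\<dots> = PiM I (\<lambda>i. distr (gauss_prod I) borel (\<lambda>z. z i))"
    unfolding gauss_prod_def[of I]
    by (intro PiM_cong refl) (simp add: distr_coordinate[unfolded gauss_prod_def])
  finally show ?thesis using I measurable_coordinate by (subst indep_vars_iff_distr_eq_PiM') auto
qed

lemma distr_normalized_difference:
  assumes "i \<in> I" "j \<in> I" "i \<noteq> j"
  shows "distr (gauss_prod I) borel (\<lambda>z. (z i - z j) / sqrt 2) = std_gauss"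
proof -
  interpret prob_space "gauss_prod I" by (rule prob_space_gauss_prod)
  have "indep_var (PiM {i} (\<lambda>_. borel)) (\<lambda>z. \<lambda>k\<in>{i}. z k) (PiM {j} (\<lambda>_. borel)) (\<lambda>z. \<lambda>k\<in>{j}. z k)"
    using assms by (intro indep_var_restrict[OF indep_vars_coordinates]) auto
  then have "indep_var borel ((\<lambda>f. f i) \<circ> (\<lambda>z. \<lambda>k\<in>{i}. z k)) borel ((\<lambda>f. f j) \<circ> (\<lambda>z. \<lambda>k\<in>{j}. z k))"
    by (rule indep_var_compose) auto
  then have ind: "indep_var borel (\<lambda>z. z i) borel (\<lambda>z. z j)" by (simp add: comp_def)
  have d: "distributed (gauss_prod I) lborel (\<lambda>z. z k) (normal_density 0 1)" if "k \<in> I" for k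
  proof -
    have "distr (gauss_prod I) lborel (\<lambda>z. z k) = distr (gauss_prod I) borel (\<lambda>z. z k)"
      by (intro distr_cong) auto
    then show ?thesis
      using distr_coordinate[OF that] measurable_coordinate[OF that]
      by (simp add: distributed_def std_gauss_def)
  qed
  have "distributed (gauss_prod I) lborel (\<lambda>z. z i - z j) (normal_density (0 - 0) (sqrt (1\<^sup>2 + 1\<^sup>2)))"
    using assms by (intro diff_indep_normal ind d) auto
  then have "distributed (gauss_prod I) lborel (\<lambda>z. z i - z j) (\<lambda>x. ennreal (normal_density 0 (sqrt 2) x))" by simp
  from normal_density_affine[OF this, of "1 / sqrt 2" 0]
  have "distributed (gauss_prod I) lborel (\<lambda>z. (z i - z j) / sqrt 2) (\<lambda>x. ennreal (normal_density 0 1 x))"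
    by simp
  then have "distr (gauss_prod I) lborel (\<lambda>z. (z i - z j) / sqrt 2) = std_gauss"
    by (simp add: distributed_def std_gauss_def)
  moreover have "distr (gauss_prod I) lborel (\<lambda>z. (z i - z j) / sqrt 2)
      = distr (gauss_prod I) borel (\<lambda>z. (z i - z j) / sqrt 2)"
    by (intro distr_cong) auto
  ultimately show ?thesis by simp
qed

locale matchings =
  fixes I :: "'i set" and J :: "'j set" and K :: "'k set" and \<alpha> \<beta> :: "'k \<Rightarrow> 'j \<Rightarrow> 'i"
  assumes finite_J: "finite J" and finite_K: "finite K" and K_nonempty: "K \<noteq> {}"
    and in_I: "\<And>k j. k \<in> K \<Longrightarrow> j \<in> J \<Longrightarrow> \<alpha> k j \<in> I \<and> \<beta> k j \<in> I \<and> \<alpha> k j \<noteq> \<beta> k j"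
    and disjoint_pairs: "\<And>k i j. k \<in> K \<Longrightarrow> i \<in> J \<Longrightarrow> j \<in> J \<Longrightarrow> i \<noteq> j \<Longrightarrow>
      {\<alpha> k i, \<beta> k i} \<inter> {\<alpha> k j, \<beta> k j} = {}"
begin

definition D :: "'k \<Rightarrow> 'j \<Rightarrow> ('i \<Rightarrow> real) \<Rightarrow> real" where
  "D k j z = (z (\<alpha> k j) - z (\<beta> k j)) / sqrt 2"

sublocale gp: prob_space "gauss_prod I" by (rule prob_space_gauss_prod)

lemma measurable_D: "k \<in> K \<Longrightarrow> j \<in> J \<Longrightarrow> D k j \<in> borel_measurable (gauss_prod I)"
  unfolding D_def[abs_def] using in_I[of k j]
  by (intro borel_measurable_divide borel_measurable_diff measurable_coordinate) auto

lemma distr_D: "k \<in> K \<Longrightarrow> j \<in> J \<Longrightarrow> distr (gauss_prod I) borel (D k j) = std_gauss"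
  unfolding D_def using in_I[of k j] by (intro distr_normalized_difference) auto

lemma integral_D:
  fixes F :: "real \<Rightarrow> real"
  assumes "k \<in> K" "j \<in> J" and [measurable]: "F \<in> borel_measurable borel"
  shows "(\<integral>z. F (D k j z) \<partial>gauss_prod I) = (\<integral>x. F x \<partial>std_gauss)"
    and "integrable (gauss_prod I) (\<lambda>z. F (D k j z)) \<longleftrightarrow> integrable std_gauss F"
  unfolding distr_D[OF assms(1,2), symmetric]
  by (rule integral_distr[symmetric, OF measurable_D[OF assms(1,2)] assms(3)])
     (rule integrable_distr_eq[symmetric, OF measurable_D[OF assms(1,2)] assms(3)])

text \<open>The pairs of one matching are disjoint, so their differences are functions of disjoint sets of coordinates.\<close>

lemma indep_D:
  assumes "k \<in> K" "J \<noteq> {}"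
  shows "gp.indep_vars (\<lambda>_. borel) (D k) J"
proof -
  let ?K = "\<lambda>j. {\<alpha> k j, \<beta> k j}"
  have "I \<noteq> {}" using in_I[OF assms(1)] assms(2) by blast
  then have "gp.indep_vars (\<lambda>j. PiM (?K j) (\<lambda>_. borel)) (\<lambda>j z. restrict (\<lambda>i. z i) (?K j)) J"
    using in_I[OF assms(1)] disjoint_pairs[OF assms(1)]
    by (intro gp.indep_vars_restrict[OF indep_vars_coordinates]) (auto simp: disjoint_family_on_def)
  then have "gp.indep_vars (\<lambda>_. borel)
      (\<lambda>j z. (\<lambda>f. (f (\<alpha> k j) - f (\<beta> k j)) / sqrt 2) (restrict (\<lambda>i. z i) (?K j))) J"
    by (rule gp.indep_vars_compose2) auto
  then show ?thesis by (simp add: D_def[abs_def])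
qed

lemma matching_mgf:
  assumes k: "k \<in> K" and J: "J \<noteq> {}" and \<tau>: "0 \<le> \<tau>" and u: "0 \<le> u" "u \<le> 1 / 8"
  defines "Y \<equiv> \<lambda>z. \<Sum>j\<in>J. thr \<tau> (D k j z) - thr_mean \<tau> 0"
  shows "integrable (gauss_prod I) (\<lambda>z. exp (u * Y z))"
    and "(\<integral>z. exp (u * Y z) \<partial>gauss_prod I) \<le> exp (182 * u\<^sup>2 * (real (card J) * exp (- \<tau> / 4)))"
proof -
  let ?F = "\<lambda>x. exp (u * (thr \<tau> x - thr_mean \<tau> 0))"
  have e: "exp (u * Y z) = (\<Prod>j\<in>J. ?F (D k j z))" for z
    unfolding Y_def by (simp add: sum_distrib_left exp_sum finite_J)
  have ind: "gp.indep_vars (\<lambda>_. borel) (\<lambda>j z. ?F (D k j z)) J"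
    by (rule gp.indep_vars_compose2[OF indep_D[OF k J]]) simp
  have i: "j \<in> J \<Longrightarrow> integrable (gauss_prod I) (\<lambda>z. ?F (D k j z))" for j
    using thr_null_mgf(1)[OF \<tau> u] k by (subst integral_D(2)) auto
  show "integrable (gauss_prod I) (\<lambda>z. exp (u * Y z))"
    unfolding e by (rule gp.indep_vars_integrable[OF finite_J ind i])
  have "(\<integral>z. exp (u * Y z) \<partial>gauss_prod I) = (\<Prod>j\<in>J. \<integral>z. ?F (D k j z) \<partial>gauss_prod I)"
    unfolding e by (rule gp.indep_vars_lebesgue_integral[OF finite_J ind i])
  also have "\<dots> = (\<Prod>j\<in>J. \<integral>x. ?F x \<partial>std_gauss)"
    using k by (intro prod.cong refl integral_D(1)) auto
  also have "\<dots> \<le> (\<Prod>j\<in>J. exp (182 * u\<^sup>2 * exp (- \<tau> / 4)))"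
    using thr_null_mgf(2)[OF \<tau> u] by (intro prod_mono) auto
  also have "\<dots> = exp (182 * u\<^sup>2 * (real (card J) * exp (- \<tau> / 4)))"
    by (simp add: exp_of_nat_mult[symmetric] mult_ac)
  finally show "(\<integral>z. exp (u * Y z) \<partial>gauss_prod I) \<le> exp (182 * u\<^sup>2 * (real (card J) * exp (- \<tau> / 4)))" .
qed

lemma matching_variance:
  fixes \<delta> :: "'j \<Rightarrow> real"
  assumes k: "k \<in> K" and J: "J \<noteq> {}" and \<tau>: "0 \<le> \<tau>"
  defines "Y \<equiv> \<lambda>z. \<Sum>j\<in>J. thr \<tau> (\<delta> j + D k j z) - thr_mean \<tau> (\<delta> j)"
  shows "integrable (gauss_prod I) (\<lambda>z. (Y z)\<^sup>2)"
    and "(\<integral>z. (Y z)\<^sup>2 \<partial>gauss_prod I) = (\<Sum>j\<in>J. thr_var \<tau> (\<delta> j))"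
proof -
  let ?F = "\<lambda>j x. thr \<tau> (\<delta> j + x) - thr_mean \<tau> (\<delta> j)"
  have ind: "gp.indep_vars (\<lambda>_. borel) (\<lambda>j z. ?F j (D k j z)) J"
    by (rule gp.indep_vars_compose2[OF indep_D[OF k J]]) simp
  interpret sg: prob_space std_gauss by (rule prob_space_std_gauss)
  have iF: "integrable std_gauss (?F j)" for j
    using integrable_thr[OF \<tau>] by (intro Bochner_Integration.integrable_diff) auto
  have zero: "(\<integral>x. ?F j x \<partial>std_gauss) = 0" for j
    using integrable_thr[OF \<tau>, of "\<delta> j"] by (simp add: thr_mean_def[symmetric] sg.prob_space[simplified])
  have i: "j \<in> J \<Longrightarrow> integrable (gauss_prod I) (\<lambda>z. ?F j (D k j z))" for j
    using iF k by (subst integral_D(2)[where F = "?F j"]) auto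
  have pair: "integrable (gauss_prod I) (\<lambda>z. ?F i (D k i z) * ?F j (D k j z)) \<and>
      (\<integral>z. ?F i (D k i z) * ?F j (D k j z) \<partial>gauss_prod I) = (if i = j then thr_var \<tau> (\<delta> j) else 0)"
    if ij: "i \<in> J" "j \<in> J" for i j
  proof (cases "i = j")
    case True
    have "integrable (gauss_prod I) (\<lambda>z. (?F j (D k j z))\<^sup>2)"
      using integrable_thr_dev[OF \<tau>] k ij by (subst integral_D(2)[where F = "\<lambda>x. (?F j x)\<^sup>2"]) auto
    moreover have "(\<integral>z. (?F j (D k j z))\<^sup>2 \<partial>gauss_prod I) = thr_var \<tau> (\<delta> j)"
      unfolding thr_var_def using k ij by (intro integral_D(1)[where F = "\<lambda>x. (?F j x)\<^sup>2"]) auto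
    ultimately show ?thesis using True by (simp add: power2_eq_square)
  next
    case False
    have ind2: "gp.indep_vars (\<lambda>_. borel) (\<lambda>j z. ?F j (D k j z)) {i, j}"
      using ij by (intro gp.indep_vars_subset[OF ind]) auto
    have i2: "l \<in> {i, j} \<Longrightarrow> integrable (gauss_prod I) (\<lambda>z. ?F l (D k l z))" for l
      using ij i by auto
    have "integrable (gauss_prod I) (\<lambda>z. \<Prod>l\<in>{i, j}. ?F l (D k l z))"
      by (rule gp.indep_vars_integrable[OF _ ind2 i2]) auto
    moreover have "(\<integral>z. (\<Prod>l\<in>{i, j}. ?F l (D k l z)) \<partial>gauss_prod I) = (\<Prod>l\<in>{i, j}. \<integral>z. ?F l (D k l z) \<partial>gauss_prod I)"
      by (rule gp.indep_vars_lebesgue_integral[OF _ ind2 i2]) auto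
    moreover have "(\<integral>z. ?F i (D k i z) \<partial>gauss_prod I) = 0"
      using k ij by (subst integral_D(1)[where F = "?F i"]) (auto simp: zero)
    ultimately show ?thesis using False by simp
  qed
  have sq: "(Y z)\<^sup>2 = (\<Sum>i\<in>J. \<Sum>j\<in>J. ?F i (D k i z) * ?F j (D k j z))" for z
    unfolding Y_def by (simp add: power2_eq_square sum_product)
  show "integrable (gauss_prod I) (\<lambda>z. (Y z)\<^sup>2)"
    unfolding sq using pair by (intro Bochner_Integration.integrable_sum) blast
  have "(\<integral>z. (Y z)\<^sup>2 \<partial>gauss_prod I) = (\<Sum>i\<in>J. \<Sum>j\<in>J. \<integral>z. ?F i (D k i z) * ?F j (D k j z) \<partial>gauss_prod I)"
    unfolding sq using pair
    by (subst Bochner_Integration.integral_sum, intro Bochner_Integration.integrable_sum, blast)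
       (intro sum.cong refl Bochner_Integration.integral_sum, blast)
  also have "\<dots> = (\<Sum>i\<in>J. \<Sum>j\<in>J. if i = j then thr_var \<tau> (\<delta> j) else 0)"
    using pair by (intro sum.cong refl) blast
  also have "\<dots> = (\<Sum>j\<in>J. thr_var \<tau> (\<delta> j))" by (simp add: finite_J)
  finally show "(\<integral>z. (Y z)\<^sup>2 \<partial>gauss_prod I) = (\<Sum>j\<in>J. thr_var \<tau> (\<delta> j))" .
qed

definition stat :: "real \<Rightarrow> ('k \<Rightarrow> 'j \<Rightarrow> real) \<Rightarrow> ('i \<Rightarrow> real) \<Rightarrow> real" where
  "stat \<tau> \<delta> z = (\<Sum>k\<in>K. \<Sum>j\<in>J. thr \<tau> (\<delta> k j + D k j z)) / real (card K)"

definition gain :: "real \<Rightarrow> ('k \<Rightarrow> 'j \<Rightarrow> real) \<Rightarrow> real" where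
  "gain \<tau> \<delta> = (\<Sum>k\<in>K. \<Sum>j\<in>J. thr_gain \<tau> (\<delta> k j)) / real (card K)"

lemma card_K_pos: "0 < real (card K)"
  using finite_K K_nonempty by (simp add: card_gt_0_iff)

lemma measurable_stat: "stat \<tau> \<delta> \<in> borel_measurable (gauss_prod I)"
  unfolding stat_def using measurable_D by measurable

text \<open>The differences in distinct matchings are dependent, but the exponential is convex: the exponential moment of the average is at most
the average of the exponential moments, each of which factorises. The tail bound is Chernoff's.\<close>

lemma stat_null_tail:
  assumes J: "J \<noteq> {}" and \<tau>: "0 \<le> \<tau>" and u: "0 \<le> u" "u \<le> 1 / 8"
  shows "measure (gauss_prod I) {z \<in> space (gauss_prod I). x < stat \<tau> (\<lambda>_ _. 0) z - real (card J) * thr_mean \<tau> 0}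
    \<le> exp (182 * u\<^sup>2 * (real (card J) * exp (- \<tau> / 4)) - u * x)"
proof -
  define Y where "Y k z = (\<Sum>j\<in>J. thr \<tau> (D k j z) - thr_mean \<tau> 0)" for k z
  let ?S = "\<lambda>z. stat \<tau> (\<lambda>_ _. 0) z - real (card J) * thr_mean \<tau> 0"
  have S: "?S z = (\<Sum>k\<in>K. (1 / real (card K)) *\<^sub>R Y k z)" for z
    using card_K_pos
    by (simp add: stat_def Y_def sum_subtractf sum_divide_distrib[symmetric] diff_divide_distrib
        sum_distrib_left[symmetric])
  note mgf = matching_mgf[OF _ J \<tau> u, folded Y_def]
  \<comment> \<open>Jensen's inequality for the average over the matchings.\<close>
  have conv: "exp (u * ?S z) \<le> (\<Sum>k\<in>K. (1 / real (card K)) * exp (u * Y k z))" for z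
  proof -
    have "exp (\<Sum>k\<in>K. (1 / real (card K)) *\<^sub>R (u * Y k z)) \<le> (\<Sum>k\<in>K. (1 / real (card K)) * exp (u * Y k z))"
      using finite_K K_nonempty card_K_pos by (intro convex_on_sum[OF _ _ exp_convex]) auto
    then show ?thesis unfolding S by (simp add: sum_distrib_left mult_ac)
  qed
  have int: "integrable (gauss_prod I) (\<lambda>z. \<Sum>k\<in>K. (1 / real (card K)) * exp (u * Y k z))"
    using mgf(1) by (intro Bochner_Integration.integrable_sum integrable_mult_right) auto
  let ?A = "{z \<in> space (gauss_prod I). x < ?S z}"
  have A: "?A \<in> sets (gauss_prod I)" using measurable_stat by measurable
  have "measure (gauss_prod I) ?A = (\<integral>z. indicator ?A z \<partial>gauss_prod I)"
  proof -
    have "?A \<inter> space (gauss_prod I) = ?A" by blast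
    then show ?thesis by (simp only: Bochner_Integration.integral_indicator)
  qed
  also have "\<dots> \<le> (\<integral>z. exp (- u * x) * (\<Sum>k\<in>K. (1 / real (card K)) * exp (u * Y k z)) \<partial>gauss_prod I)"
  proof (rule integral_mono)
    show "integrable (gauss_prod I) (indicator ?A :: _ \<Rightarrow> real)"
      by (rule integrable_real_indicator[OF A]) (simp add: less_top[symmetric])
    show "integrable (gauss_prod I) (\<lambda>z. exp (- u * x) * (\<Sum>k\<in>K. (1 / real (card K)) * exp (u * Y k z)))"
      using int by (rule integrable_mult_right)
    fix z
    have "indicator ?A z \<le> exp (- u * x) * exp (u * ?S z)"
    proof (cases "z \<in> ?A")
      case True
      then have "u * x \<le> u * ?S z" using u by (intro mult_left_mono) auto
      then have "1 \<le> exp (- u * x) * exp (u * ?S z)" by (simp add: exp_add[symmetric])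
      then show ?thesis using True by simp
    qed simp
    also have "\<dots> \<le> exp (- u * x) * (\<Sum>k\<in>K. (1 / real (card K)) * exp (u * Y k z))"
      using conv by (intro mult_left_mono) auto
    finally show "indicator ?A z \<le> exp (- u * x) * (\<Sum>k\<in>K. (1 / real (card K)) * exp (u * Y k z))" .
  qed
  also have "\<dots> = exp (- u * x) * (\<Sum>k\<in>K. (1 / real (card K)) * (\<integral>z. exp (u * Y k z) \<partial>gauss_prod I))"
    using mgf(1) by (simp add: Bochner_Integration.integral_sum)
  also have "\<dots> \<le> exp (- u * x) * (\<Sum>k\<in>K. (1 / real (card K)) * exp (182 * u\<^sup>2 * (real (card J) * exp (- \<tau> / 4))))"
    using mgf(2) by (intro mult_left_mono sum_mono) auto
  also have "\<dots> = exp (182 * u\<^sup>2 * (real (card J) * exp (- \<tau> / 4)) - u * x)"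
    using card_K_pos by (simp add: exp_add[symmetric])
  finally show ?thesis .
qed

text \<open>Likewise the square is convex, so the variance of the average is at most the average of the variances; the tail bound is
Chebyshev's.\<close>

lemma stat_alt_tail:
  assumes J: "J \<noteq> {}" and \<tau>: "0 \<le> \<tau>" and G: "0 < gain \<tau> \<delta>"
  shows "measure (gauss_prod I) {z \<in> space (gauss_prod I). stat \<tau> \<delta> z - real (card J) * thr_mean \<tau> 0 \<le> gain \<tau> \<delta> / 2}
    \<le> 4 * (12 * (1 + \<tau>) * gain \<tau> \<delta> + 600 * (real (card J) * exp (- \<tau> / 8))) / (gain \<tau> \<delta>)\<^sup>2"
proof -
  define Y where "Y k z = (\<Sum>j\<in>J. thr \<tau> (\<delta> k j + D k j z) - thr_mean \<tau> (\<delta> k j))" for k z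
  let ?n = "real (card K)"
  let ?S = "\<lambda>z. stat \<tau> \<delta> z - real (card J) * thr_mean \<tau> 0"
  have S: "?S z - gain \<tau> \<delta> = (\<Sum>k\<in>K. Y k z) / ?n" for z
  proof -
    have "(\<Sum>k\<in>K. Y k z) = (\<Sum>k\<in>K. \<Sum>j\<in>J. thr \<tau> (\<delta> k j + D k j z)) - (\<Sum>k\<in>K. \<Sum>j\<in>J. thr_gain \<tau> (\<delta> k j))
        - ?n * (real (card J) * thr_mean \<tau> 0)"
      by (simp add: Y_def thr_gain_def sum_subtractf)
    then show ?thesis using card_K_pos by (simp add: stat_def gain_def diff_divide_distrib)
  qed
  have varle: "(\<integral>z. (Y k z)\<^sup>2 \<partial>gauss_prod I)
      \<le> 12 * (1 + \<tau>) * (\<Sum>j\<in>J. thr_gain \<tau> (\<delta> k j)) + 600 * (real (card J) * exp (- \<tau> / 8))" if "k \<in> K" for k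
  proof -
    have "(\<integral>z. (Y k z)\<^sup>2 \<partial>gauss_prod I) = (\<Sum>j\<in>J. thr_var \<tau> (\<delta> k j))"
      using matching_variance(2)[OF that J \<tau>] unfolding Y_def .
    also have "\<dots> \<le> (\<Sum>j\<in>J. 12 * (1 + \<tau>) * thr_gain \<tau> (\<delta> k j) + 600 * exp (- \<tau> / 8))"
      by (intro sum_mono thr_var_le \<tau>)
    also have "\<dots> = 12 * (1 + \<tau>) * (\<Sum>j\<in>J. thr_gain \<tau> (\<delta> k j)) + real (card J) * (600 * exp (- \<tau> / 8))"
      by (simp only: sum.distrib sum_distrib_left[symmetric] sum_constant of_nat_id)
    finally show ?thesis by (simp only: mult.left_commute)
  qed
  have int: "integrable (gauss_prod I) (\<lambda>z. \<Sum>k\<in>K. (Y k z)\<^sup>2)"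
    using matching_variance(1)[OF _ J \<tau>] unfolding Y_def by (intro Bochner_Integration.integrable_sum) auto
  let ?G = "gain \<tau> \<delta>"
  let ?A = "{z \<in> space (gauss_prod I). ?S z \<le> ?G / 2}"
  have A: "?A \<in> sets (gauss_prod I)" using measurable_stat by measurable
  have "measure (gauss_prod I) ?A = (\<integral>z. indicator ?A z \<partial>gauss_prod I)"
  proof -
    have "?A \<inter> space (gauss_prod I) = ?A" by blast
    then show ?thesis by (simp only: Bochner_Integration.integral_indicator)
  qed
  also have "\<dots> \<le> (\<integral>z. 4 / ?G\<^sup>2 / ?n * (\<Sum>k\<in>K. (Y k z)\<^sup>2) \<partial>gauss_prod I)"
  proof (rule integral_mono)
    show "integrable (gauss_prod I) (indicator ?A :: _ \<Rightarrow> real)"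
      by (rule integrable_real_indicator[OF A]) (simp add: less_top[symmetric])
    show "integrable (gauss_prod I) (\<lambda>z. 4 / ?G\<^sup>2 / ?n * (\<Sum>k\<in>K. (Y k z)\<^sup>2))"
      using int by (rule integrable_mult_right)
    fix z
    have n: "0 < ?n" by (rule card_K_pos)
    show "indicator ?A z \<le> 4 / ?G\<^sup>2 / ?n * (\<Sum>k\<in>K. (Y k z)\<^sup>2)"
    proof (cases "z \<in> ?A")
      case True
      then have "?G / 2 \<le> - ((\<Sum>k\<in>K. Y k z) / ?n)" using S[of z] by simp
      then have "(?G / 2)\<^sup>2 \<le> (- ((\<Sum>k\<in>K. Y k z) / ?n))\<^sup>2" using G by (intro power_mono) auto
      also have "\<dots> = (\<Sum>k\<in>K. Y k z)\<^sup>2 / ?n\<^sup>2" by (simp add: power_divide)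
      also have "\<dots> \<le> ((\<Sum>k\<in>K. (Y k z)\<^sup>2) * ?n) / ?n\<^sup>2"
        by (intro divide_right_mono sum_squared_le_sum_of_squares) simp
      also have "\<dots> = (\<Sum>k\<in>K. (Y k z)\<^sup>2) / ?n" using n by (simp add: power2_eq_square)
      finally have "?G\<^sup>2 \<le> 4 * ((\<Sum>k\<in>K. (Y k z)\<^sup>2) / ?n)" by (simp add: power_divide mult.commute)
      then have "1 \<le> 4 * ((\<Sum>k\<in>K. (Y k z)\<^sup>2) / ?n) / ?G\<^sup>2"
        by (subst le_divide_eq_1_pos) (use G in simp_all)
      then show ?thesis using True by (simp add: mult.commute)
    qed (simp add: sum_nonneg)
  qed
  also have "\<dots> = 4 / ?G\<^sup>2 / ?n * (\<Sum>k\<in>K. \<integral>z. (Y k z)\<^sup>2 \<partial>gauss_prod I)"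
    using matching_variance(1)[OF _ J \<tau>] unfolding Y_def by simp
  also have "\<dots> \<le> 4 / ?G\<^sup>2 / ?n * (\<Sum>k\<in>K. 12 * (1 + \<tau>) * (\<Sum>j\<in>J. thr_gain \<tau> (\<delta> k j)) + 600 * (real (card J) * exp (- \<tau> / 8)))"
    using varle by (intro mult_left_mono sum_mono) auto
  also have "\<dots> = 4 / ?G\<^sup>2 * (12 * (1 + \<tau>) * ?G + 600 * (real (card J) * exp (- \<tau> / 8)))"
    using card_K_pos
    by (simp add: gain_def sum.distrib sum_distrib_left[symmetric] add_divide_distrib algebra_simps)
  finally show ?thesis by (simp add: mult_ac)
qed

end

lemma Diff_Collect_less: "E - {x \<in> E. c < f x} = {x \<in> E. f x \<le> (c :: real)}"
  by auto

text \<open>A random permutation maps a fixed pair of distinct points to a uniformly random such pair: the sum over permutations is the same for every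
pair, since any pair can be moved to any other by a permutation.\<close>

lemma sum_permutations_pair:
  fixes f :: "nat \<Rightarrow> nat \<Rightarrow> real"
  assumes xy: "x < q" "y < q" "x \<noteq> y"
  shows "real (q * (q - 1)) * (\<Sum>\<pi> | \<pi> permutes {..<q}. f (\<pi> x) (\<pi> y))
    = fact q * (\<Sum>(i, j) \<in> {(i, j). i < q \<and> j < q \<and> i \<noteq> j}. f i j)"
proof -
  let ?P = "{(i, j). i < q \<and> j < q \<and> i \<noteq> j}"
  let ?A = "\<lambda>x y. \<Sum>\<pi> | \<pi> permutes {..<q}. f (\<pi> x) (\<pi> y)"
  have Peq: "?P = (SIGMA i:{..<q}. {..<q} - {i})" by auto
  have finP: "finite ?P" unfolding Peq by auto
  have cardP: "card ?P = q * (q - 1)" unfolding Peq by (subst card_SigmaI) auto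
  have A: "?A x' y' = ?A x y" if xy': "x' < q" "y' < q" "x' \<noteq> y'" for x' y'
  proof -
    \<comment> \<open>Two transpositions move (x', y') to (x, y); the second one fixes x.\<close>
    define s where "s = Transposition.transpose x' x"
    define t where "t = Transposition.transpose (s y') y"
    define \<sigma> where "\<sigma> = t \<circ> s"
    have s: "s permutes {..<q}" unfolding s_def using xy xy' by (intro permutes_swap_id) auto
    have sy: "s y' < q" using permutes_in_image[OF s, of y'] xy' by simp
    have t: "t permutes {..<q}" unfolding t_def using sy xy by (intro permutes_swap_id) auto
    have sx: "s x' = x" by (simp add: s_def)
    have "s y' \<noteq> x" using sx xy'(3) permutes_inj[OF s] by (metis injD)
    then have "\<sigma> x' = x" "\<sigma> y' = y" using xy by (auto simp: \<sigma>_def sx t_def Transposition.transpose_def)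
    moreover have "\<sigma> permutes {..<q}" unfolding \<sigma>_def by (rule permutes_compose[OF s t])
    from sum_permutations_compose_right[OF this, of "\<lambda>\<pi>. f (\<pi> x') (\<pi> y')"]
    have "?A x' y' = (\<Sum>\<pi> | \<pi> permutes {..<q}. f (\<pi> (\<sigma> x')) (\<pi> (\<sigma> y')))" by simp
    ultimately show ?thesis by simp
  qed
  have "real (q * (q - 1)) * ?A x y = (\<Sum>(x', y')\<in>?P. ?A x y)" by (simp add: cardP split_beta)
  also have "\<dots> = (\<Sum>(x', y')\<in>?P. ?A x' y')" by (intro sum.cong refl) (auto simp: A)
  also have "\<dots> = (\<Sum>\<pi> | \<pi> permutes {..<q}. \<Sum>(x', y')\<in>?P. f (\<pi> x') (\<pi> y'))"
    unfolding split_beta by (rule sum.swap)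
  also have "\<dots> = (\<Sum>\<pi> | \<pi> permutes {..<q}. \<Sum>(i, j)\<in>?P. f i j)"
  proof (rule sum.cong[OF refl])
    fix \<pi> assume "\<pi> \<in> {\<pi>. \<pi> permutes {..<q}}"
    then have p: "\<pi> permutes {..<q}" by simp
    have lt: "\<pi> i < q \<longleftrightarrow> i < q" for i using permutes_in_image[OF p, of i] by simp
    have lt': "Hilbert_Choice.inv \<pi> i < q \<longleftrightarrow> i < q" for i using permutes_in_image[OF permutes_inv[OF p], of i] by simp
    show "(\<Sum>(x', y')\<in>?P. f (\<pi> x') (\<pi> y')) = (\<Sum>(i, j)\<in>?P. f i j)"
      by (rule sum.reindex_bij_witness[of _ "\<lambda>(i, j). (Hilbert_Choice.inv \<pi> i, Hilbert_Choice.inv \<pi> j)" "\<lambda>(i, j). (\<pi> i, \<pi> j)"])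
         (auto simp: lt lt' permutes_inverses[OF p] dest: permutes_inj[OF p, THEN injD]
            permutes_inj[OF permutes_inv[OF p], THEN injD])
  qed
  also have "\<dots> = fact q * (\<Sum>(i, j)\<in>?P. f i j)" by (simp add: card_permutations[of _ q])
  finally show ?thesis .
qed

section \<open>Tests based on differences within blocks\<close>

context block_model
begin

definition pairs :: "nat set set \<Rightarrow> (nat set \<times> nat) set" where
  "pairs U = U \<times> {..<q div 2}"

definition fst_pt :: "(nat \<Rightarrow> nat) \<Rightarrow> nat set \<times> nat \<Rightarrow> nat" where
  "fst_pt \<pi> j = enum (fst j) (\<pi> (2 * snd j))"

definition snd_pt :: "(nat \<Rightarrow> nat) \<Rightarrow> nat set \<times> nat \<Rightarrow> nat" where
  "snd_pt \<pi> j = enum (fst j) (\<pi> (2 * snd j + 1))"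

abbreviation perms :: "(nat \<Rightarrow> nat) set" where
  "perms \<equiv> {\<pi>. \<pi> permutes {..<q}}"

lemma enum_in: "B \<in> \<B> \<Longrightarrow> i < q \<Longrightarrow> enum B i \<in> B"
  using enum_bij[of B] by (auto simp: bij_betw_def)

lemma enum_inj: "B \<in> \<B> \<Longrightarrow> i < q \<Longrightarrow> j < q \<Longrightarrow> enum B i = enum B j \<Longrightarrow> i = j"
  using enum_bij[of B] by (auto simp: bij_betw_def inj_on_def)

lemma enum_eqD:
  assumes "B \<in> \<B>" "C \<in> \<B>" "i < q" "j < q" "enum B i = enum C j"
  shows "B = C \<and> i = j"
proof -
  have "enum B i \<in> B" "enum C j \<in> C" using enum_in[OF assms(1,3)] enum_in[OF assms(2,4)] by auto
  then have "B = C" using assms(5) disjointD[OF partition_onD2[OF partition] assms(1,2)] by auto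
  then show ?thesis using assms enum_inj by blast
qed

lemma matchings_pairs:
  assumes U: "U \<subseteq> \<B>"
  shows "matchings {..<p} (pairs U) perms fst_pt snd_pt"
proof
  show "finite (pairs U)" using finite_subset[OF U finite_blocks] by (simp add: pairs_def)
  show "finite perms" by (rule finite_permutations) simp
  show "perms \<noteq> {}" using permutes_id by blast
  fix \<pi> assume "\<pi> \<in> perms"
  then have \<pi>: "\<pi> permutes {..<q}" by simp
  have lt: "\<pi> i < q \<longleftrightarrow> i < q" for i using permutes_in_image[OF \<pi>, of i] by simp
  have inj: "\<pi> i = \<pi> j \<longleftrightarrow> i = j" for i j using permutes_inj[OF \<pi>] by (auto dest: injD)
  have l: "fst j \<in> \<B> \<and> 2 * snd j < q \<and> 2 * snd j + 1 < q" if "j \<in> pairs U" for j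
    using that U by (auto simp: pairs_def)
  {
    fix j assume j: "j \<in> pairs U"
    have "fst_pt \<pi> j \<in> fst j" "snd_pt \<pi> j \<in> fst j"
      using l[OF j] by (auto simp: fst_pt_def snd_pt_def lt intro!: enum_in)
    moreover have "fst_pt \<pi> j \<noteq> snd_pt \<pi> j"
    proof
      assume "fst_pt \<pi> j = snd_pt \<pi> j"
      then have eq: "enum (fst j) (\<pi> (2 * snd j)) = enum (fst j) (\<pi> (2 * snd j + 1))"
        unfolding fst_pt_def snd_pt_def .
      have "\<pi> (2 * snd j) = \<pi> (2 * snd j + 1)"
        by (rule enum_inj[OF _ _ _ eq]) (use l[OF j] in \<open>simp_all only: lt\<close>)
      then show False by (simp add: inj)
    qed
    ultimately show "fst_pt \<pi> j \<in> {..<p} \<and> snd_pt \<pi> j \<in> {..<p} \<and> fst_pt \<pi> j \<noteq> snd_pt \<pi> j"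
      using block_subset[of "fst j"] l[OF j] by blast
  }
  fix i j assume i: "i \<in> pairs U" and j: "j \<in> pairs U" and ij: "i \<noteq> j"
  have key: "fst i = fst j \<and> x = y"
    if "enum (fst i) (\<pi> x) = enum (fst j) (\<pi> y)" "x < q" "y < q" for x y
    using enum_eqD[of "fst i" "fst j" "\<pi> x" "\<pi> y"] that l[OF i] l[OF j] by (simp add: lt inj)
  show "{fst_pt \<pi> i, snd_pt \<pi> i} \<inter> {fst_pt \<pi> j, snd_pt \<pi> j} = {}"
  proof (rule ccontr)
    assume "\<not> ?thesis"
    then obtain x y where xy: "x \<in> {2 * snd i, 2 * snd i + 1}" "y \<in> {2 * snd j, 2 * snd j + 1}"
      "enum (fst i) (\<pi> x) = enum (fst j) (\<pi> y)"
      unfolding fst_pt_def snd_pt_def by blast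
    moreover have "x < q" "y < q" using xy(1,2) l[OF i] l[OF j] by auto
    ultimately have "fst i = fst j" "x = y" using key by blast+
    then have "snd i = snd j" using xy(1,2) by auto
    with \<open>fst i = fst j\<close> ij show False by (simp add: prod_eq_iff)
  qed
qed

text \<open>Centred under the null hypothesis. The matchings pair the positions 2l and 2l + 1 of a random enumeration of each block of U.\<close>

definition pair_stat :: "nat set set \<Rightarrow> real \<Rightarrow> (nat \<Rightarrow> real) \<Rightarrow> real" where
  "pair_stat U \<tau> x = (\<Sum>\<pi>\<in>perms. \<Sum>j\<in>pairs U. thr \<tau> ((x (fst_pt \<pi> j) - x (snd_pt \<pi> j)) / sqrt (2 * a))) / real (card perms)
      - real (card (pairs U)) * thr_mean \<tau> 0"

definition pair_delta :: "(nat \<Rightarrow> real) \<Rightarrow> (nat \<Rightarrow> nat) \<Rightarrow> nat set \<times> nat \<Rightarrow> real" where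
  "pair_delta \<theta> \<pi> j = (\<theta> (fst_pt \<pi> j) - \<theta> (snd_pt \<pi> j)) / sqrt (2 * a)"

lemma points_in:
  assumes "U \<subseteq> \<B>" "\<pi> \<in> perms" "j \<in> pairs U"
  shows "fst_pt \<pi> j \<in> {..<p}" "snd_pt \<pi> j \<in> {..<p}" "blk (fst_pt \<pi> j) = fst j" "blk (snd_pt \<pi> j) = fst j"
proof -
  interpret matchings "{..<p}" "pairs U" perms fst_pt snd_pt by (rule matchings_pairs[OF assms(1)])
  show "fst_pt \<pi> j \<in> {..<p}" "snd_pt \<pi> j \<in> {..<p}" using in_I[OF assms(2,3)] by auto
  have \<pi>: "\<pi> permutes {..<q}" using assms by simp
  have lt: "\<pi> i < q \<longleftrightarrow> i < q" for i using permutes_in_image[OF \<pi>, of i] by simp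
  have l: "fst j \<in> \<B> \<and> 2 * snd j < q \<and> 2 * snd j + 1 < q" using assms by (auto simp: pairs_def)
  show "blk (fst_pt \<pi> j) = fst j" "blk (snd_pt \<pi> j) = fst j"
    using l by (auto simp: fst_pt_def snd_pt_def lt intro!: blk_eq enum_in)
qed

lemma measurable_pair_stat:
  assumes U: "U \<subseteq> \<B>"
  shows "pair_stat U \<tau> \<in> borel_measurable (borel_euclid p)"
proof -
  have m: "(\<lambda>x. thr \<tau> ((x (fst_pt \<pi> j) - x (snd_pt \<pi> j)) / sqrt (2 * a))) \<in> borel_measurable (borel_euclid p)"
    if "\<pi> \<in> perms" "j \<in> pairs U" for \<pi> j
    using points_in(1,2)[OF U that]
    by (intro measurable_compose[OF _ measurable_thr] borel_measurable_divide borel_measurable_diff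
        measurable_component_singleton) auto
  show ?thesis unfolding pair_stat_def[abs_def]
    by (intro borel_measurable_diff borel_measurable_divide borel_measurable_sum m borel_measurable_const) auto
qed

text \<open>The statistic depends on differences within blocks only, hence its law is that of the matching statistic of independent Gaussian
variables.\<close>

lemma measure_pair_stat:
  assumes U: "U \<subseteq> \<B>" and P[measurable]: "Measurable.pred borel P"
  shows "measure (obs \<theta>) {x \<in> euclid p. P (pair_stat U \<tau> x)}
    = measure (gauss_prod {..<p}) {z \<in> space (gauss_prod {..<p}).
        P (matchings.stat (pairs U) perms fst_pt snd_pt \<tau> (pair_delta \<theta>) z - real (card (pairs U)) * thr_mean \<tau> 0)}"
proof -
  interpret matchings "{..<p}" "pairs U" perms fst_pt snd_pt by (rule matchings_pairs[OF U])
  note [measurable] = measurable_pair_stat[OF U]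
  let ?A = "{x \<in> euclid p. P (pair_stat U \<tau> x)}"
  have A: "?A \<in> sets (borel_euclid p)" by (rule sets_Collect_euclid) measurable
  have a: "sqrt a / sqrt (2 * a) = 1 / sqrt 2" unfolding real_sqrt_mult using a_pos by simp
  have eq: "pair_stat U \<tau> (\<lambda>i\<in>{..<p}. \<theta> i + sqrt a * z i)
      = stat \<tau> (pair_delta \<theta>) z - real (card (pairs U)) * thr_mean \<tau> 0" for z
  proof -
    have "thr \<tau> (((\<lambda>i\<in>{..<p}. \<theta> i + sqrt a * z i) (fst_pt \<pi> j) - (\<lambda>i\<in>{..<p}. \<theta> i + sqrt a * z i) (snd_pt \<pi> j)) / sqrt (2 * a))
      = thr \<tau> (pair_delta \<theta> \<pi> j + D \<pi> j z)" if "\<pi> \<in> perms" "j \<in> pairs U" for \<pi> j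
    proof -
      have "((\<lambda>i\<in>{..<p}. \<theta> i + sqrt a * z i) (fst_pt \<pi> j) - (\<lambda>i\<in>{..<p}. \<theta> i + sqrt a * z i) (snd_pt \<pi> j)) / sqrt (2 * a)
         = pair_delta \<theta> \<pi> j + (sqrt a / sqrt (2 * a)) * (z (fst_pt \<pi> j) - z (snd_pt \<pi> j))"
        using points_in(1,2)[OF U that] by (simp add: pair_delta_def add_divide_distrib diff_divide_distrib right_diff_distrib)
      then show ?thesis unfolding a by (simp add: D_def)
    qed
    then show ?thesis by (simp add: pair_stat_def stat_def)
  qed
  have "measure (obs \<theta>) ?A = measure (gauss_prod {..<p}) {z \<in> euclid p. (\<lambda>i\<in>{..<p}. \<theta> i + sqrt a * z i) \<in> ?A}"
  proof (rule measure_obs_law_shift_invariant[OF A])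
    fix x y c assume xy: "x \<in> euclid p" "y \<in> euclid p" "\<And>i. i < p \<Longrightarrow> y i = x i + c (blk i)" and x: "x \<in> ?A"
    have "y (fst_pt \<pi> j) - y (snd_pt \<pi> j) = x (fst_pt \<pi> j) - x (snd_pt \<pi> j)"
      if "\<pi> \<in> perms" "j \<in> pairs U" for \<pi> j
      using points_in[OF U that] xy(3) by simp
    then have "pair_stat U \<tau> y = pair_stat U \<tau> x" by (simp add: pair_stat_def)
    then show "y \<in> ?A" using x xy by simp
  qed
  also have "{z \<in> euclid p. (\<lambda>i\<in>{..<p}. \<theta> i + sqrt a * z i) \<in> ?A}
      = {z \<in> space (gauss_prod {..<p}). P (stat \<tau> (pair_delta \<theta>) z - real (card (pairs U)) * thr_mean \<tau> 0)}"
    by (auto simp: eq)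
  finally show ?thesis .
qed

text \<open>The expected increase of the statistic that a block contributes lies between this sum over all ordered pairs and twice it.\<close>

definition block_gain :: "real \<Rightarrow> (nat \<Rightarrow> real) \<Rightarrow> nat set \<Rightarrow> real" where
  "block_gain \<tau> \<theta> B = (\<Sum>i\<in>B. \<Sum>j\<in>B. thr_gain \<tau> ((\<theta> i - \<theta> j) / sqrt (2 * a))) / (2 * real q)"

text \<open>Averaging over permutations replaces the pairs of the matching by all pairs of the block. The constant comes from
2 (q div 2) \<ge> q - 1.\<close>

lemma gain_ge_block_gain:
  assumes U: "U \<subseteq> \<B>" and q2: "2 \<le> q" and \<tau>: "0 \<le> \<tau>"
  shows "(\<Sum>B\<in>U. block_gain \<tau> \<theta> B) \<le> matchings.gain (pairs U) perms \<tau> (pair_delta \<theta>)"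
proof -
  interpret matchings "{..<p}" "pairs U" perms fst_pt snd_pt by (rule matchings_pairs[OF U])
  have finU: "finite U" using U finite_blocks finite_subset by blast
  define g where "g B i j = thr_gain \<tau> ((\<theta> (enum B i) - \<theta> (enum B j)) / sqrt (2 * a))" for B i j
  have g0: "g B i i = 0" for B i by (simp add: g_def thr_gain_def)
  let ?S = "\<lambda>B. \<Sum>(i, j) \<in> {(i, j). i < q \<and> j < q \<and> i \<noteq> j}. g B i j"
  have cardp: "real (card perms) = fact q" by (simp add: card_permutations[of _ q])
  have qq: "0 < real (q * (q - 1))" using q2 by simp
  have S: "(\<Sum>i\<in>B. \<Sum>j\<in>B. thr_gain \<tau> ((\<theta> i - \<theta> j) / sqrt (2 * a))) = ?S B" if "B \<in> U" for B
  proof -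
    have B: "bij_betw (enum B) {..<q} B" using that U by (intro enum_bij) auto
    have "(\<Sum>i\<in>B. \<Sum>j\<in>B. thr_gain \<tau> ((\<theta> i - \<theta> j) / sqrt (2 * a))) = (\<Sum>i<q. \<Sum>j<q. g B i j)"
      unfolding g_def by (simp add: sum.reindex_bij_betw[OF B, symmetric])
    also have "\<dots> = (\<Sum>(i, j)\<in>{..<q} \<times> {..<q}. g B i j)" by (simp add: sum.cartesian_product)
    also have "\<dots> = ?S B"
      by (rule sum.mono_neutral_right) (auto simp: g0)
    finally show ?thesis .
  qed
  have S0: "0 \<le> ?S B" for B
    unfolding g_def by (intro sum_nonneg) (auto intro: thr_gain_nonneg[OF \<tau>])
  have "gain \<tau> (pair_delta \<theta>) = (\<Sum>\<pi>\<in>perms. \<Sum>j\<in>pairs U. g (fst j) (\<pi> (2 * snd j)) (\<pi> (2 * snd j + 1))) / fact q"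
    unfolding gain_def cardp by (simp add: pair_delta_def fst_pt_def snd_pt_def g_def)
  also have "\<dots> = (\<Sum>j\<in>pairs U. \<Sum>\<pi>\<in>perms. g (fst j) (\<pi> (2 * snd j)) (\<pi> (2 * snd j + 1))) / fact q"
    by (subst sum.swap) simp
  also have "\<dots> = (\<Sum>j\<in>pairs U. fact q * ?S (fst j) / real (q * (q - 1))) / fact q"
  proof -
    have "(\<Sum>\<pi>\<in>perms. g (fst j) (\<pi> (2 * snd j)) (\<pi> (2 * snd j + 1))) = fact q * ?S (fst j) / real (q * (q - 1))"
      if "j \<in> pairs U" for j
    proof -
      have "real (q * (q - 1)) * (\<Sum>\<pi>\<in>perms. g (fst j) (\<pi> (2 * snd j)) (\<pi> (2 * snd j + 1))) = fact q * ?S (fst j)"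
        using that by (intro sum_permutations_pair) (auto simp: pairs_def)
      moreover have "x = y / c" if "0 < c" "c * x = y" for c x y :: real
        using that by (simp add: eq_divide_eq mult.commute)
      ultimately show ?thesis using qq by blast
    qed
    then show ?thesis by simp
  qed
  also have "\<dots> = (\<Sum>j\<in>pairs U. ?S (fst j)) / real (q * (q - 1))"
    by (simp add: sum_divide_distrib[symmetric] sum_distrib_left[symmetric])
  also have "(\<Sum>j\<in>pairs U. ?S (fst j)) = (\<Sum>B\<in>U. real (q div 2) * ?S B)"
    unfolding pairs_def by (simp add: sum.cartesian_product' )
  also have "(\<Sum>B\<in>U. real (q div 2) * ?S B) / real (q * (q - 1)) = (\<Sum>B\<in>U. real (q div 2) / real (q * (q - 1)) * ?S B)"
    by (simp add: sum_divide_distrib)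
  also have "\<dots> \<ge> (\<Sum>B\<in>U. 1 / (2 * real q) * ?S B)"
  proof (intro sum_mono mult_right_mono S0)
    have "q - 1 \<le> 2 * (q div 2)" by linarith
    then have "real (q - 1) \<le> real (2 * (q div 2))" by (simp only: of_nat_le_iff)
    then have "real (q - 1) \<le> 2 * real (q div 2)" by (simp only: of_nat_mult of_nat_numeral)
    then have "real q * real (q - 1) \<le> real q * (2 * real (q div 2))" by (intro mult_left_mono) auto
    then show "1 / (2 * real q) \<le> real (q div 2) / real (q * (q - 1))"
      using qq q2 by (simp add: divide_simps mult_ac)
  qed
  finally have "(\<Sum>B\<in>U. 1 / (2 * real q) * ?S B) \<le> gain \<tau> (pair_delta \<theta>)" .
  moreover have "block_gain \<tau> \<theta> B = 1 / (2 * real q) * ?S B" if "B \<in> U" for B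
    unfolding block_gain_def S[OF that] by simp
  ultimately show ?thesis by simp
qed

text \<open>Chernoff's bound with u = L / (16 S). The hypotheses say that S dominates both the sub-exponential scale L and the
sub-Gaussian scale, which is the square root of L times the noise level.\<close>

lemma pair_test_level:
  assumes U: "U \<subseteq> \<B>" "U \<noteq> {}" and q2: "2 \<le> q" and \<tau>: "0 \<le> \<tau>"
    and L: "1 \<le> L" "L \<le> 2 * S" and n: "real (card (pairs U)) * exp (- \<tau> / 8) \<le> 10 * S\<^sup>2 / L"
  shows "measure (obs origin) {x \<in> euclid p. C * S < pair_stat U \<tau> x} \<le> exp (- ((C / 16 - 8) * L))"
proof -
  interpret matchings "{..<p}" "pairs U" perms fst_pt snd_pt by (rule matchings_pairs[OF U(1)])
  have S: "0 < S" using L by linarith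
  have "0 \<in> {..<q div 2}" using q2 by simp
  then have J: "pairs U \<noteq> {}" using U(2) unfolding pairs_def by blast
  define u where "u = L / (16 * S)"
  have u: "0 \<le> u" "u \<le> 1 / 8" using L S by (auto simp: u_def divide_simps)
  have d0: "stat \<tau> (pair_delta origin) z = stat \<tau> (\<lambda>_ _. 0) z" for z
    unfolding stat_def using points_in(1,2)[OF U(1)]
    by (intro arg_cong2[of _ _ _ _ "(/)"] sum.cong refl) (simp add: pair_delta_def)
  have "measure (obs origin) {x \<in> euclid p. C * S < pair_stat U \<tau> x}
      = measure (gauss_prod {..<p}) {z \<in> space (gauss_prod {..<p}).
          C * S < stat \<tau> (\<lambda>_ _. 0) z - real (card (pairs U)) * thr_mean \<tau> 0}"
    by (subst measure_pair_stat[OF U(1)]) (auto simp: d0)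
  also have "\<dots> \<le> exp (182 * u\<^sup>2 * (real (card (pairs U)) * exp (- \<tau> / 4)) - u * (C * S))"
    by (rule stat_null_tail[OF J \<tau> u])
  also have "182 * u\<^sup>2 * (real (card (pairs U)) * exp (- \<tau> / 4)) - u * (C * S) \<le> - ((C / 16 - 8) * L)"
  proof -
    have "real (card (pairs U)) * exp (- \<tau> / 4) \<le> real (card (pairs U)) * exp (- \<tau> / 8)"
      using \<tau> by (intro mult_left_mono) auto
    then have "182 * u\<^sup>2 * (real (card (pairs U)) * exp (- \<tau> / 4)) \<le> 182 * u\<^sup>2 * (10 * S\<^sup>2 / L)"
      using n by (intro mult_left_mono) auto
    also have "\<dots> = 1820 / 256 * L" using S L by (simp add: u_def power_divide power_mult_distrib power2_eq_square)
    also have "\<dots> \<le> 8 * L" using L by simp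
    finally have "182 * u\<^sup>2 * (real (card (pairs U)) * exp (- \<tau> / 4)) \<le> 8 * L" .
    moreover have "u * (C * S) = C / 16 * L" using S by (simp add: u_def)
    ultimately show ?thesis unfolding left_diff_distrib by linarith
  qed
  finally show ?thesis by simp
qed

text \<open>Under these hypotheses the variance of the statistic is of order 1/C relative to the square of its expected gain.\<close>

lemma pair_test_power:
  assumes U: "U \<subseteq> \<B>" "U \<noteq> {}" and q2: "2 \<le> q" and \<tau>: "0 \<le> \<tau>" "1 + \<tau> \<le> 10 * S"
    and L: "1 \<le> L" and n: "real (card (pairs U)) * exp (- \<tau> / 8) \<le> 10 * S\<^sup>2 / L"
    and C: "1 \<le> C" and G: "2 * C * S \<le> (\<Sum>B\<in>U. block_gain \<tau> \<theta> B)"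
  shows "measure (obs \<theta>) {x \<in> euclid p. pair_stat U \<tau> x \<le> C * S} \<le> 6240 / C"
proof -
  interpret matchings "{..<p}" "pairs U" perms fst_pt snd_pt by (rule matchings_pairs[OF U(1)])
  have S: "0 < S" using \<tau> by linarith
  have "0 \<in> {..<q div 2}" using q2 by simp
  then have J: "pairs U \<noteq> {}" using U(2) unfolding pairs_def by blast
  define H where "H = gain \<tau> (pair_delta \<theta>)"
  have H: "2 * C * S \<le> H" unfolding H_def using gain_ge_block_gain[OF U(1) q2 \<tau>(1), of \<theta>] G by linarith
  have CS: "0 < 2 * C * S" using C S by simp
  then have H0: "0 < H" using H by linarith
  have "measure (obs \<theta>) {x \<in> euclid p. pair_stat U \<tau> x \<le> C * S}
      = measure (gauss_prod {..<p}) {z \<in> space (gauss_prod {..<p}).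
          stat \<tau> (pair_delta \<theta>) z - real (card (pairs U)) * thr_mean \<tau> 0 \<le> C * S}"
    by (rule measure_pair_stat[OF U(1)]) simp
  also have "\<dots> \<le> measure (gauss_prod {..<p}) {z \<in> space (gauss_prod {..<p}).
          stat \<tau> (pair_delta \<theta>) z - real (card (pairs U)) * thr_mean \<tau> 0 \<le> H / 2}"
  proof (rule gp.finite_measure_mono)
    note [measurable] = measurable_stat
    show "{z \<in> space (gauss_prod {..<p}). stat \<tau> (pair_delta \<theta>) z - real (card (pairs U)) * thr_mean \<tau> 0 \<le> H / 2}
      \<in> sets (gauss_prod {..<p})" by measurable
    have "C * S \<le> H / 2" using H by simp
    then show "{z \<in> space (gauss_prod {..<p}). stat \<tau> (pair_delta \<theta>) z - real (card (pairs U)) * thr_mean \<tau> 0 \<le> C * S}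
      \<subseteq> {z \<in> space (gauss_prod {..<p}). stat \<tau> (pair_delta \<theta>) z - real (card (pairs U)) * thr_mean \<tau> 0 \<le> H / 2}"
      by (intro Collect_mono) (metis order_trans)
  qed
  also have "\<dots> \<le> 4 * (12 * (1 + \<tau>) * H + 600 * (real (card (pairs U)) * exp (- \<tau> / 8))) / H\<^sup>2"
    unfolding H_def by (rule stat_alt_tail[OF J \<tau>(1) H0[unfolded H_def]])
  also have "\<dots> = 48 * (1 + \<tau>) / H + 2400 * (real (card (pairs U)) * exp (- \<tau> / 8)) / H\<^sup>2"
    using H0 by (simp add: field_simps power2_eq_square)
  also have "\<dots> \<le> 48 * (10 * S) / (2 * C * S) + 2400 * (10 * S\<^sup>2 / L) / (2 * C * S)\<^sup>2"
  proof (rule add_mono)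
    show "48 * (1 + \<tau>) / H \<le> 48 * (10 * S) / (2 * C * S)"
      using \<tau> S by (intro frac_le[OF _ _ CS H]) simp_all
    have "(2 * C * S)\<^sup>2 \<le> H\<^sup>2" using H CS by (intro power_mono) simp_all
    moreover have "0 < (2 * C * S)\<^sup>2" using CS by (rule zero_less_power)
    moreover have "2400 * (real (card (pairs U)) * exp (- \<tau> / 8)) \<le> 2400 * (10 * S\<^sup>2 / L)"
      using n by (rule mult_left_mono) simp
    moreover have "0 \<le> 2400 * (10 * S\<^sup>2 / L)" using L by simp
    ultimately show "2400 * (real (card (pairs U)) * exp (- \<tau> / 8)) / H\<^sup>2 \<le> 2400 * (10 * S\<^sup>2 / L) / (2 * C * S)\<^sup>2"
      by (intro frac_le)
  qed
  also have "\<dots> = 240 / C + 6000 / (C\<^sup>2 * L)"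
    using S C L by (simp add: power_mult_distrib)
  also have "6000 / (C\<^sup>2 * L) \<le> 6000 / C"
  proof -
    have "1 * 1 \<le> C * L" using C L by (intro mult_mono) auto
    then have "C * 1 \<le> C * (C * L)" using C by (intro mult_left_mono) auto
    then have "C \<le> C\<^sup>2 * L" by (simp add: power2_eq_square mult.assoc)
    then show ?thesis using C by (intro frac_le) auto
  qed
  finally show ?thesis by (simp add: add_divide_distrib[symmetric])
qed

section \<open>Signal energy seen by the differences and by the block means\<close>

definition energy :: "(nat \<Rightarrow> real) \<Rightarrow> nat set \<Rightarrow> real" where
  "energy \<theta> B = (\<Sum>i\<in>B. (\<theta> i)\<^sup>2)"

text \<open>The squared length of the projection onto the indicator of the block.\<close>

definition mean_energy :: "(nat \<Rightarrow> real) \<Rightarrow> nat set \<Rightarrow> real" where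
  "mean_energy \<theta> B = (\<Sum>i\<in>B. \<theta> i)\<^sup>2 / real q"

definition supp :: "(nat \<Rightarrow> real) \<Rightarrow> nat set \<Rightarrow> nat set" where
  "supp \<theta> B = {i \<in> B. \<theta> i \<noteq> 0}"

lemma thr_gain_zero: "thr_gain \<tau> 0 = 0" by (simp add: thr_gain_def)

lemma delta_square: "((x - y) / sqrt (2 * a))\<^sup>2 = (x - y)\<^sup>2 / (2 * a)"
  using a_pos by (simp add: power_divide)

text \<open>Summing (x - y)^2 over all pairs of a block gives its energy orthogonal to the indicator. Each pair that meets
the support loses at most \<tau>, and there are at most 2 q times the size of the support of them.\<close>

lemma block_gain_ge_spread:
  assumes B: "B \<in> \<B>" and \<tau>: "0 \<le> \<tau>"
  shows "(energy \<theta> B - mean_energy \<theta> B) / (2 * a) - real (card (supp \<theta> B)) * \<tau> \<le> block_gain \<tau> \<theta> B"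
proof -
  have q0: "0 < real q" using q_pos by simp
  have fin: "finite B" by (rule finite_block[OF B])
  have cB: "real (card B) = real q" using card_block[OF B] by simp
  let ?z = "\<lambda>i. if \<theta> i \<noteq> 0 then \<tau> else 0"
  have sz: "(\<Sum>i\<in>B. ?z i) = real (card (supp \<theta> B)) * \<tau>"
    using fin by (simp add: sum.If_cases supp_def Int_def)
  have "(\<Sum>i\<in>B. \<Sum>j\<in>B. (\<theta> i - \<theta> j)\<^sup>2 / (2 * a) - (?z i + ?z j))
    \<le> (\<Sum>i\<in>B. \<Sum>j\<in>B. thr_gain \<tau> ((\<theta> i - \<theta> j) / sqrt (2 * a)))"
  proof (intro sum_mono)
    fix i j
    have "(\<theta> i - \<theta> j)\<^sup>2 / (2 * a) - \<tau> \<le> thr_gain \<tau> ((\<theta> i - \<theta> j) / sqrt (2 * a))"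
      using thr_gain_ge[OF \<tau>, of "(\<theta> i - \<theta> j) / sqrt (2 * a)"] unfolding delta_square .
    then show "(\<theta> i - \<theta> j)\<^sup>2 / (2 * a) - (?z i + ?z j) \<le> thr_gain \<tau> ((\<theta> i - \<theta> j) / sqrt (2 * a))"
      using \<tau> by (cases "\<theta> i = 0"; cases "\<theta> j = 0") (auto simp: thr_gain_zero)
  qed
  moreover have "(\<Sum>i\<in>B. \<Sum>j\<in>B. (\<theta> i - \<theta> j)\<^sup>2 / (2 * a) - (?z i + ?z j))
      = (2 * real q * energy \<theta> B - 2 * (\<Sum>i\<in>B. \<theta> i)\<^sup>2) / (2 * a) - 2 * real q * (real (card (supp \<theta> B)) * \<tau>)"
  proof -
    have "(\<Sum>i\<in>B. \<Sum>j\<in>B. (\<theta> i - \<theta> j)\<^sup>2) = (\<Sum>i\<in>B. \<Sum>j\<in>B. (\<theta> i)\<^sup>2 + (\<theta> j)\<^sup>2 - 2 * (\<theta> i * \<theta> j))"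
      by (simp add: power2_diff mult_ac)
    also have "\<dots> = 2 * real q * energy \<theta> B - 2 * (\<Sum>i\<in>B. \<theta> i)\<^sup>2"
      by (simp add: sum_subtractf sum.distrib cB energy_def power2_eq_square sum_product sum_distrib_left[symmetric])
    finally have "(\<Sum>i\<in>B. \<Sum>j\<in>B. (\<theta> i - \<theta> j)\<^sup>2) = 2 * real q * energy \<theta> B - 2 * (\<Sum>i\<in>B. \<theta> i)\<^sup>2" .
    moreover have "(\<Sum>i\<in>B. \<Sum>j\<in>B. ?z i + ?z j) = 2 * real q * (real (card (supp \<theta> B)) * \<tau>)"
      by (simp only: sum.distrib sz sum_constant cB sum_distrib_left[symmetric])
    ultimately show ?thesis
      by (simp only: sum_subtractf sum_divide_distrib[symmetric])
  qed
  ultimately have "((2 * real q * energy \<theta> B - 2 * (\<Sum>i\<in>B. \<theta> i)\<^sup>2) / (2 * a) - 2 * real q * (real (card (supp \<theta> B)) * \<tau>)) / (2 * real q)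
     \<le> block_gain \<tau> \<theta> B"
    unfolding block_gain_def using q0 by (intro divide_right_mono) auto
  moreover have "((2 * real q * energy \<theta> B - 2 * (\<Sum>i\<in>B. \<theta> i)\<^sup>2) / (2 * a) - 2 * real q * (real (card (supp \<theta> B)) * \<tau>)) / (2 * real q)
    = (energy \<theta> B - mean_energy \<theta> B) / (2 * a) - real (card (supp \<theta> B)) * \<tau>"
  proof -
    have "((2 * Q * e - 2 * m) / A - 2 * Q * t) / (2 * Q) = (e - m / Q) / A - t" if "Q \<noteq> 0" "A \<noteq> 0" for Q e m A t :: real
      using that by (simp add: field_simps)
    then show ?thesis using q0 a_pos by (simp add: mean_energy_def)
  qed
  ultimately show ?thesis by simp
qed

text \<open>Only the pairs of a zero and a nonzero coordinate are used, so the loss through the threshold is proportional to the number of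
zeros. This makes the bound sharp when nearly all coordinates of the block are nonzero.\<close>

lemma block_gain_ge_zeros:
  assumes B: "B \<in> \<B>" and \<tau>: "0 \<le> \<tau>"
  shows "(real q - real (card (supp \<theta> B))) / real q * (energy \<theta> B / (2 * a) - real (card (supp \<theta> B)) * \<tau>)
    \<le> block_gain \<tau> \<theta> B"
proof -
  have q0: "0 < real q" using q_pos by simp
  have fin: "finite B" by (rule finite_block[OF B])
  let ?S = "supp \<theta> B"
  let ?T = "B - ?S"
  have sub: "?S \<subseteq> B" by (auto simp: supp_def)
  then have finS: "finite ?S" using fin finite_subset by blast
  have cT: "real (card ?T) = real q - real (card ?S)"
    using sub finS fin card_mono[OF fin sub] by (simp add: card_Diff_subset of_nat_diff card_block[OF B])
  let ?G = "\<lambda>i j. thr_gain \<tau> ((\<theta> i - \<theta> j) / sqrt (2 * a))"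
  have G0: "0 \<le> ?G i j" for i j by (rule thr_gain_nonneg[OF \<tau>])
  have e: "(\<Sum>i\<in>?S. (\<theta> i)\<^sup>2 / (2 * a) - \<tau>) = energy \<theta> B / (2 * a) - real (card ?S) * \<tau>"
  proof -
    have "(\<Sum>i\<in>?S. (\<theta> i)\<^sup>2) = energy \<theta> B"
      unfolding energy_def using fin by (intro sum.mono_neutral_left) (auto simp: supp_def)
    then show ?thesis by (simp add: sum_subtractf sum_divide_distrib[symmetric])
  qed
  have ST: "real (card ?T) * (energy \<theta> B / (2 * a) - real (card ?S) * \<tau>) \<le> (\<Sum>i\<in>?S. \<Sum>j\<in>?T. ?G i j)"
  proof -
    have "real (card ?T) * (energy \<theta> B / (2 * a) - real (card ?S) * \<tau>) = (\<Sum>i\<in>?S. \<Sum>j\<in>?T. (\<theta> i)\<^sup>2 / (2 * a) - \<tau>)"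
      by (simp only: sum_constant sum_distrib_left[symmetric] e)
    also have "\<dots> \<le> (\<Sum>i\<in>?S. \<Sum>j\<in>?T. ?G i j)"
    proof (intro sum_mono)
      fix i j assume "j \<in> ?T"
      then have "\<theta> j = 0" by (auto simp: supp_def)
      then show "(\<theta> i)\<^sup>2 / (2 * a) - \<tau> \<le> ?G i j"
        using thr_gain_ge[OF \<tau>, of "(\<theta> i - \<theta> j) / sqrt (2 * a)"] unfolding delta_square by simp
    qed
    finally show ?thesis .
  qed
  have TS: "real (card ?T) * (energy \<theta> B / (2 * a) - real (card ?S) * \<tau>) \<le> (\<Sum>i\<in>?T. \<Sum>j\<in>?S. ?G i j)"
  proof -
    have "real (card ?T) * (energy \<theta> B / (2 * a) - real (card ?S) * \<tau>) = (\<Sum>i\<in>?T. \<Sum>j\<in>?S. (\<theta> j)\<^sup>2 / (2 * a) - \<tau>)"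
      by (simp only: e sum_constant)
    also have "\<dots> \<le> (\<Sum>i\<in>?T. \<Sum>j\<in>?S. ?G i j)"
    proof (intro sum_mono)
      fix i j assume "i \<in> ?T"
      then have "\<theta> i = 0" by (auto simp: supp_def)
      then show "(\<theta> j)\<^sup>2 / (2 * a) - \<tau> \<le> ?G i j"
        using thr_gain_ge[OF \<tau>, of "(\<theta> i - \<theta> j) / sqrt (2 * a)"] unfolding delta_square by simp
    qed
    finally show ?thesis .
  qed
  have "(\<Sum>i\<in>?S. \<Sum>j\<in>?T. ?G i j) + (\<Sum>i\<in>?T. \<Sum>j\<in>?S. ?G i j) \<le> (\<Sum>i\<in>?S. \<Sum>j\<in>B. ?G i j) + (\<Sum>i\<in>?T. \<Sum>j\<in>B. ?G i j)"
    using fin sub by (intro add_mono sum_mono sum_mono2 G0) auto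
  also have "\<dots> = (\<Sum>i\<in>B. \<Sum>j\<in>B. ?G i j)"
    using sum.subset_diff[OF sub fin, of "\<lambda>i. \<Sum>j\<in>B. ?G i j"] by simp
  finally have total: "(\<Sum>i\<in>?S. \<Sum>j\<in>?T. ?G i j) + (\<Sum>i\<in>?T. \<Sum>j\<in>?S. ?G i j) \<le> (\<Sum>i\<in>B. \<Sum>j\<in>B. ?G i j)" .
  have "2 * (real (card ?T) * (energy \<theta> B / (2 * a) - real (card ?S) * \<tau>)) \<le> (\<Sum>i\<in>B. \<Sum>j\<in>B. ?G i j)"
  proof -
    have "2 * x \<le> t" if "x \<le> y" "x \<le> z" "y + z \<le> t" for x y z t :: real
      using that by linarith
    from this[OF ST TS total] show ?thesis .
  qed
  then have "2 * (real (card ?T) * (energy \<theta> B / (2 * a) - real (card ?S) * \<tau>)) / (2 * real q) \<le> block_gain \<tau> \<theta> B"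
    unfolding block_gain_def using q0 by (intro divide_right_mono) auto
  then show ?thesis by (simp add: cT)
qed

text \<open>The Cauchy-Schwarz inequality on the support.\<close>

lemma mean_energy_le:
  assumes B: "B \<in> \<B>"
  shows "mean_energy \<theta> B \<le> real (card (supp \<theta> B)) / real q * energy \<theta> B"
proof -
  have fin: "finite B" by (rule finite_block[OF B])
  have "(\<Sum>i\<in>B. \<theta> i) = (\<Sum>i\<in>supp \<theta> B. \<theta> i)" "energy \<theta> B = (\<Sum>i\<in>supp \<theta> B. (\<theta> i)\<^sup>2)"
    unfolding energy_def using fin by (auto intro!: sum.mono_neutral_right simp: supp_def)
  then have "(\<Sum>i\<in>B. \<theta> i)\<^sup>2 \<le> energy \<theta> B * real (card (supp \<theta> B))"
    using sum_squared_le_sum_of_squares[of \<theta> "supp \<theta> B"] by simp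
  then show ?thesis unfolding mean_energy_def using divide_right_mono[of _ _ "real q"] by (simp add: mult.commute)
qed

lemma mean_energy_le_energy: "B \<in> \<B> \<Longrightarrow> mean_energy \<theta> B \<le> energy \<theta> B"
proof -
  assume B: "B \<in> \<B>"
  have "card (supp \<theta> B) \<le> q"
    using card_mono[OF finite_block[OF B], of "supp \<theta> B"] card_block[OF B] by (auto simp: supp_def)
  then have "real (card (supp \<theta> B)) / real q \<le> 1" using q_pos by simp
  moreover have "0 \<le> energy \<theta> B" by (simp add: energy_def sum_nonneg)
  ultimately have "real (card (supp \<theta> B)) / real q * energy \<theta> B \<le> 1 * energy \<theta> B" by (rule mult_right_mono)
  with mean_energy_le[OF B, of \<theta>] show ?thesis by simp
qed

lemma sum_supp: "(\<Sum>B\<in>\<B>. card (supp \<theta> B)) = card {i \<in> {..<p}. \<theta> i \<noteq> 0}"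
proof -
  have "(\<Sum>B\<in>\<B>. card (supp \<theta> B)) = (\<Sum>B\<in>\<B>. \<Sum>i\<in>B. if \<theta> i \<noteq> 0 then 1 else 0)"
    using finite_block by (intro sum.cong refl) (simp add: supp_def sum.If_cases Int_def)
  also have "\<dots> = card {i \<in> {..<p}. \<theta> i \<noteq> 0}"
    unfolding sum_blocks by (simp add: sum.If_cases Int_def)
  finally show ?thesis .
qed

text \<open>The indicator of a block of size q captures at most the fraction k/q of the energy of a signal with k nonzero coordinates in this
block. As the supports have fewer than q points in total, at most one block has k > q/2, and if the differences see little energy,
this block must exist and its mean must carry the energy.\<close>

lemma energy_dichotomy:
  assumes supp: "card {i \<in> {..<p}. \<theta> i \<noteq> 0} < q"
    and small: "(\<Sum>B\<in>\<B>. energy \<theta> B - mean_energy \<theta> B) < (\<Sum>B\<in>\<B>. energy \<theta> B) / 4"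
  shows "\<exists>B\<in>\<B>. (\<Sum>B\<in>\<B>. energy \<theta> B) / 2 \<le> mean_energy \<theta> B"
proof -
  let ?E = "\<Sum>B\<in>\<B>. energy \<theta> B" and ?M = "\<Sum>B\<in>\<B>. mean_energy \<theta> B"
  have q0: "0 < real q" using q_pos by simp
  have E0: "0 \<le> energy \<theta> B" for B by (simp add: energy_def sum_nonneg)
  have half: "mean_energy \<theta> B \<le> energy \<theta> B / 2" if "B \<in> \<B>" "2 * card (supp \<theta> B) \<le> q" for B
  proof -
    have "real (card (supp \<theta> B)) / real q \<le> 1 / 2" using that(2) q0 by (simp add: divide_simps)
    from order_trans[OF mean_energy_le[OF that(1)] mult_right_mono[OF this E0[of B]]] show ?thesis by simp
  qed
  have MS: "3 / 4 * ?E < ?M" using small by (simp add: sum_subtractf)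
  have Etot: "0 \<le> ?E" by (intro sum_nonneg E0)
  have "\<exists>B\<in>\<B>. \<not> 2 * card (supp \<theta> B) \<le> q"
  proof (rule ccontr)
    assume "\<not> ?thesis"
    then have "?M \<le> (\<Sum>B\<in>\<B>. energy \<theta> B / 2)" by (intro sum_mono half) auto
    then have "?M \<le> ?E / 2" by (simp add: sum_divide_distrib)
    then show False using MS Etot by linarith
  qed
  then obtain B where B: "B \<in> \<B>" "q < 2 * card (supp \<theta> B)" by (auto simp: not_le)
  have "card (supp \<theta> B) + (\<Sum>C\<in>\<B> - {B}. card (supp \<theta> C)) < q"
    using supp unfolding sum_supp[symmetric] using sum.remove[OF finite_blocks B(1), of "\<lambda>C. card (supp \<theta> C)"] by simp
  moreover have "card (supp \<theta> C) \<le> (\<Sum>C\<in>\<B> - {B}. card (supp \<theta> C))" if "C \<in> \<B> - {B}" for C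
    using that finite_blocks by (intro member_le_sum) auto
  ultimately have other: "2 * card (supp \<theta> C) \<le> q" if "C \<in> \<B> - {B}" for C
    using that B(2) by fastforce
  have "?M = mean_energy \<theta> B + (\<Sum>C\<in>\<B> - {B}. mean_energy \<theta> C)"
    by (rule sum.remove[OF finite_blocks B(1)])
  also have "(\<Sum>C\<in>\<B> - {B}. mean_energy \<theta> C) \<le> (\<Sum>C\<in>\<B> - {B}. energy \<theta> C / 2)"
    using other by (intro sum_mono half) auto
  also have "\<dots> = (?E - energy \<theta> B) / 2"
    using sum.remove[OF finite_blocks B(1), of "energy \<theta>"] by (simp add: sum_divide_distrib[symmetric])
  finally have "?M \<le> mean_energy \<theta> B + (?E - energy \<theta> B) / 2" by simp
  moreover have "mean_energy \<theta> B \<le> energy \<theta> B" by (rule mean_energy_le_energy[OF B(1)])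
  moreover have "E / 2 \<le> m" if "3 / 4 * E < M" "M \<le> m + (E - e) / 2" "m \<le> e" for E M m e :: real
    using that by (simp add: field_simps)
  ultimately have "?E / 2 \<le> mean_energy \<theta> B" using MS by blast
  then show ?thesis using B(1) by blast
qed


section \<open>Tests based on block sums\<close>

definition block_sum :: "nat set \<Rightarrow> (nat \<Rightarrow> real) \<Rightarrow> real" where
  "block_sum B x = (\<Sum>i\<in>B. x i)"

text \<open>The indicator of a block is an eigenvector of the covariance, with eigenvalue V.\<close>

lemma cinner_block_indicator:
  assumes B: "B \<in> \<B>"
  shows "cinner v (\<lambda>i. r * indicator B i) = r * block_sum B v / V"
proof -
  have qV: "V - \<gamma> * real q = a" by (simp add: V_def)
  have "(\<Sum>i<p. v i * (r * indicator B i)) = (\<Sum>i<p. if i \<in> B then r * v i else 0)"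
    by (intro sum.cong) (auto simp: indicator_def)
  also have "\<dots> = (\<Sum>i\<in>B. r * v i)"
    using block_subset[OF B] by (simp add: sum.If_cases Int_absorb1)
  finally have 1: "(\<Sum>i<p. v i * (r * indicator B i)) = r * block_sum B v"
    by (simp add: block_sum_def sum_distrib_left)
  have "(\<Sum>C\<in>\<B>. (\<Sum>i\<in>C. v i) * (\<Sum>i\<in>C. r * indicator B i))
      = (\<Sum>C\<in>\<B>. if C = B then block_sum B v * (r * real q) else 0)"
  proof (rule sum.cong[OF refl])
    fix C assume C: "C \<in> \<B>"
    show "(\<Sum>i\<in>C. v i) * (\<Sum>i\<in>C. r * indicator B i) = (if C = B then block_sum B v * (r * real q) else 0)"
    proof (cases "C = B")
      case True
      have "(\<Sum>i\<in>B. r * indicator B i) = (\<Sum>i\<in>B. r)" by (rule sum.cong) auto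
      then show ?thesis using True card_block[OF B] by (simp add: block_sum_def mult.commute)
    next
      case False
      then have "C \<inter> B = {}" using disjointD[OF partition_onD2[OF partition] C B] by simp
      then have "(\<Sum>i\<in>C. r * indicator B i) = 0" by (intro sum.neutral) (auto simp: indicator_def)
      then show ?thesis using False by simp
    qed
  qed
  then have 2: "(\<Sum>C\<in>\<B>. (\<Sum>i\<in>C. v i) * (\<Sum>i\<in>C. r * indicator B i)) = block_sum B v * (r * real q)"
    using B finite_blocks by simp
  have "cinner v (\<lambda>i. r * indicator B i) = (r * block_sum B v - \<gamma> / V * (block_sum B v * (r * real q))) / a"
    unfolding cinner_def 1 2 ..
  also have "r * block_sum B v - \<gamma> / V * (block_sum B v * (r * real q)) = r * block_sum B v * (V - \<gamma> * real q) / V"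
    using V_pos by (simp add: field_simps)
  finally show ?thesis unfolding qV using a_pos by simp
qed

text \<open>Exponential tilting by a block sum shifts the Gaussian density; so the exponential moments of the block sum are known without
computing its law.\<close>

lemma dens_tilt:
  assumes B: "B \<in> \<B>"
  shows "exp (w * (block_sum B x - block_sum B \<theta>)) * dens \<theta> x
    = exp (w\<^sup>2 * (real q * V) / 2) * dens (\<lambda>i. \<theta> i + w * V * indicator B i) x"
proof -
  let ?v = "\<lambda>i. x i - \<theta> i" and ?h = "\<lambda>i. w * V * indicator B i"
  have vs: "block_sum B ?v = block_sum B x - block_sum B \<theta>" by (simp add: block_sum_def sum_subtractf)
  have hs: "block_sum B ?h = w * V * real q"
  proof -
    have "(\<Sum>i\<in>B. ?h i) = (\<Sum>i\<in>B. w * V)" by (rule sum.cong) auto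
    then show ?thesis using card_block[OF B] by (simp add: block_sum_def mult.commute)
  qed
  have vh: "cinner ?v ?h = w * (block_sum B x - block_sum B \<theta>)"
    unfolding cinner_block_indicator[OF B] vs using V_pos by simp
  have hh: "cinner ?h ?h = w\<^sup>2 * (real q * V)"
    unfolding cinner_block_indicator[OF B, of ?h] hs using V_pos by (simp add: power2_eq_square)
  have e: "cinner (\<lambda>i. x i - (\<theta> i + ?h i)) (\<lambda>i. x i - (\<theta> i + ?h i)) = cinner (\<lambda>i. ?v i - ?h i) (\<lambda>i. ?v i - ?h i)"
    by (rule cinner_cong) auto
  have "cinner (\<lambda>i. ?v i - ?h i) (\<lambda>i. ?v i - ?h i) = cinner ?v ?v - cinner ?v ?h - (cinner ?h ?v - cinner ?h ?h)"
    unfolding cinner_diff_right[of _ ?v ?h] cinner_diff_left[of ?v ?h] by simp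
  also have "\<dots> = cinner ?v ?v - 2 * (w * (block_sum B x - block_sum B \<theta>)) + w\<^sup>2 * (real q * V)"
    unfolding cinner_commute[of ?h ?v] vh hh by simp
  finally have "w * (block_sum B x - block_sum B \<theta>) + - cinner ?v ?v / 2
      = w\<^sup>2 * (real q * V) / 2 + - cinner (\<lambda>i. ?v i - ?h i) (\<lambda>i. ?v i - ?h i) / 2"
    by (simp add: field_simps)
  then show ?thesis unfolding dens_def e by (simp add: exp_add[symmetric])
qed

lemma measurable_block_sum: "B \<in> \<B> \<Longrightarrow> block_sum B \<in> borel_measurable (borel_euclid p)"
  unfolding block_sum_def[abs_def] using block_subset
  by (intro borel_measurable_sum measurable_component_singleton) auto

lemma block_sum_tail:
  assumes B: "B \<in> \<B>" and \<sigma>: "\<sigma>\<^sup>2 = (1 :: real)" and t: "0 \<le> t"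
  shows "measure (obs \<theta>) {x \<in> euclid p. t \<le> \<sigma> * (block_sum B x - block_sum B \<theta>)}
    \<le> exp (- (t\<^sup>2 / (2 * (real q * V))))"
proof -
  let ?L = "lborel_euclid p"
  let ?A = "{x \<in> euclid p. t \<le> \<sigma> * (block_sum B x - block_sum B \<theta>)}"
  define u where "u = t / (real q * V)"
  have qV: "0 < real q * V" using q_pos V_pos by simp
  have u0: "0 \<le> u" using t qV by (simp add: u_def)
  note [measurable] = measurable_block_sum[OF B]
  have A: "?A \<in> sets (borel_euclid p)" by (rule sets_Collect_euclid) measurable
  have s: "sets ?L = sets (borel_euclid p)" by (intro sets_PiM_cong) auto
  have A': "?A \<in> sets ?L" using A s by simp
  let ?\<theta>' = "\<lambda>i. \<theta> i + u * \<sigma> * V * indicator B i"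
  have tilt: "exp (u * \<sigma> * (block_sum B x - block_sum B \<theta>)) * dens \<theta> x = exp (u\<^sup>2 * (real q * V) / 2) * dens ?\<theta>' x" for x
    using dens_tilt[OF B, of "u * \<sigma>"] \<sigma> by (simp add: power_mult_distrib)
  have "measure (obs \<theta>) ?A = (\<integral>x. indicator ?A x * dens \<theta> x \<partial>?L)"
    by (rule measure_obs_law[OF A])
  also have "\<dots> \<le> (\<integral>x. exp (- u * t) * (exp (u\<^sup>2 * (real q * V) / 2) * dens ?\<theta>' x) \<partial>?L)"
  proof (rule integral_mono)
    show "integrable ?L (\<lambda>x. indicator ?A x * dens \<theta> x)"
      using integrable_mult_indicator[OF A' integrable_dens[of \<theta>]] by simp
    show "integrable ?L (\<lambda>x. exp (- u * t) * (exp (u\<^sup>2 * (real q * V) / 2) * dens ?\<theta>' x))"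
      by (intro integrable_mult_right integrable_dens)
    fix x
    show "indicator ?A x * dens \<theta> x \<le> exp (- u * t) * (exp (u\<^sup>2 * (real q * V) / 2) * dens ?\<theta>' x)"
    proof (cases "x \<in> ?A")
      case True
      then have "u * t \<le> u * (\<sigma> * (block_sum B x - block_sum B \<theta>))" using u0 by (intro mult_left_mono) auto
      then have "0 \<le> - u * t + u * \<sigma> * (block_sum B x - block_sum B \<theta>)" by (simp add: mult.assoc)
      then have "1 \<le> exp (- u * t) * exp (u * \<sigma> * (block_sum B x - block_sum B \<theta>))"
        unfolding exp_add[symmetric] by (subst one_le_exp_iff)
      from mult_right_mono[OF this, of "dens \<theta> x"] show ?thesis
        using True dens_pos[of \<theta> x] unfolding tilt[symmetric] by (simp add: mult.assoc)
    next
      case False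
      then show ?thesis using dens_pos[of ?\<theta>' x] by simp
    qed
  qed
  also have "\<dots> = exp (- u * t) * exp (u\<^sup>2 * (real q * V) / 2)" by (simp add: integral_dens)
  also have "\<dots> = exp (- (t\<^sup>2 / (2 * (real q * V))))"
  proof -
    have "- (t / D) * t + (t / D)\<^sup>2 * D / 2 = - (t\<^sup>2 / (2 * D))" if "0 < D" for D :: real
      using that by (simp add: field_simps power2_eq_square)
    then show ?thesis unfolding exp_add[symmetric] u_def using qV by simp
  qed
  finally show ?thesis .
qed

lemma mean_test_level:
  assumes B: "B \<in> \<B>" and L: "1 \<le> L" and C: "0 \<le> C"
  shows "measure (obs origin) {x \<in> euclid p. C * sqrt (real q * V * L) < \<bar>block_sum B x\<bar>} \<le> 2 * exp (- (C\<^sup>2 * L / 2))"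
proof -
  interpret prob_space "obs origin" by (rule prob_space_obs_law)
  let ?t = "C * sqrt (real q * V * L)"
  have qV: "0 < real q * V" using q_pos V_pos by simp
  have t: "0 \<le> ?t" using C qV L by simp
  have z: "block_sum B origin = 0" unfolding block_sum_def using block_subset[OF B] by (intro sum.neutral) auto
  have tt: "?t\<^sup>2 / (2 * (real q * V)) = C\<^sup>2 * L / 2"
    using qV L q_pos V_pos by (simp add: power_mult_distrib)
  note [measurable] = measurable_block_sum[OF B]
  let ?A = "\<lambda>\<sigma>. {x \<in> euclid p. ?t \<le> \<sigma> * (block_sum B x - block_sum B origin)}"
  have m: "?A \<sigma> \<in> sets (obs origin)" for \<sigma>
    unfolding sets_obs_law by (rule sets_Collect_euclid) measurable
  have "measure (obs origin) {x \<in> euclid p. ?t < \<bar>block_sum B x\<bar>} \<le> measure (obs origin) (?A 1 \<union> ?A (-1))"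
  proof (rule finite_measure_mono)
    have "r \<le> 1 * (y - 0) \<or> r \<le> - 1 * (y - 0)" if "r < \<bar>y\<bar>" for r y :: real
      using that by (auto simp: abs_if split: if_splits)
    then show "{x \<in> euclid p. ?t < \<bar>block_sum B x\<bar>} \<subseteq> ?A 1 \<union> ?A (-1)"
      unfolding z by blast
  qed (use m in blast)
  also have "\<dots> \<le> measure (obs origin) (?A 1) + measure (obs origin) (?A (-1))"
    using m by (intro measure_Un_le)
  also have "\<dots> \<le> exp (- (?t\<^sup>2 / (2 * (real q * V)))) + exp (- (?t\<^sup>2 / (2 * (real q * V))))"
    by (intro add_mono block_sum_tail[OF B _ t]) auto
  finally show ?thesis unfolding tt by simp
qed

lemma mean_test_power:
  assumes B: "B \<in> \<B>" and L: "1 \<le> L" and C: "0 \<le> C"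
    and M: "4 * C\<^sup>2 * (V * L) \<le> mean_energy \<theta> B"
  shows "measure (obs \<theta>) {x \<in> euclid p. \<bar>block_sum B x\<bar> \<le> C * sqrt (real q * V * L)} \<le> exp (- (C\<^sup>2 * L / 2))"
proof -
  interpret prob_space "obs \<theta>" by (rule prob_space_obs_law)
  let ?t = "C * sqrt (real q * V * L)"
  have q0: "0 < real q" using q_pos by simp
  have qV: "0 < real q * V" using q_pos V_pos by simp
  have t: "0 \<le> ?t" using C qV L by simp
  have t2: "?t\<^sup>2 = C\<^sup>2 * (real q * V * L)" using qV L by (simp add: power_mult_distrib)
  have tt: "?t\<^sup>2 / (2 * (real q * V)) = C\<^sup>2 * L / 2"
    unfolding t2 using q_pos V_pos by simp
  have "4 * C\<^sup>2 * (V * L) * real q \<le> (block_sum B \<theta>)\<^sup>2"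
    using M q0 unfolding mean_energy_def block_sum_def by (simp add: pos_le_divide_eq)
  then have "(2 * ?t)\<^sup>2 \<le> \<bar>block_sum B \<theta>\<bar>\<^sup>2" unfolding power_mult_distrib[of 2] t2 by (simp add: mult_ac)
  then have big: "2 * ?t \<le> \<bar>block_sum B \<theta>\<bar>" by (rule power2_le_imp_le) simp
  define \<sigma> :: real where "\<sigma> = (if 0 \<le> block_sum B \<theta> then - 1 else 1)"
  note [measurable] = measurable_block_sum[OF B]
  let ?A = "{x \<in> euclid p. ?t \<le> \<sigma> * (block_sum B x - block_sum B \<theta>)}"
  have m: "?A \<in> sets (obs \<theta>)"
    unfolding sets_obs_law by (rule sets_Collect_euclid) measurable
  have "measure (obs \<theta>) {x \<in> euclid p. \<bar>block_sum B x\<bar> \<le> ?t} \<le> measure (obs \<theta>) ?A"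
  proof (rule finite_measure_mono[OF _ m])
    have "r \<le> (if 0 \<le> b then - 1 else 1) * (y - b)" if "\<bar>y\<bar> \<le> r" "2 * r \<le> \<bar>b\<bar>" for r y b :: real
      using that by (auto simp: abs_if split: if_splits)
    from this[OF _ big] have "?t \<le> \<sigma> * (y - block_sum B \<theta>)" if "\<bar>y\<bar> \<le> ?t" for y
      using that unfolding \<sigma>_def by blast
    then show "{x \<in> euclid p. \<bar>block_sum B x\<bar> \<le> ?t} \<subseteq> ?A" by blast
  qed
  also have "\<dots> \<le> exp (- (?t\<^sup>2 / (2 * (real q * V))))"
    by (rule block_sum_tail[OF B _ t]) (simp add: \<sigma>_def)
  finally show ?thesis unfolding tt .
qed

section \<open>The minimax rate\<close>

lemma minimax_risk_le:
  assumes s: "1 \<le> s" and A: "A \<in> sets (borel_euclid p)"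
    and null: "measure (obs origin) A \<le> e0"
    and alt: "\<And>\<theta>. \<theta> \<in> sparse_alt p s \<epsilon> \<Longrightarrow> measure (obs \<theta>) (euclid p - A) \<le> e1"
  shows "minimax_risk p s \<gamma> \<B> \<epsilon> \<le> e0 + e1"
proof -
  define \<phi> :: "(nat \<Rightarrow> real) \<Rightarrow> nat" where "\<phi> x = (if x \<in> A then 1 else 0)" for x
  have Asub: "A \<subseteq> euclid p" using sets.sets_into_space[OF A] by (simp add: space_PiM)
  have "\<phi> \<in> tests p"
    unfolding tests_def \<phi>_def[abs_def] using A by (intro measurable_If_set measurable_const) auto
  have p1: "1 \<le> p" using p_eq q_pos R_pos by simp
  let ?r = "\<lambda>\<phi>. measure (obs origin) {x \<in> euclid p. \<phi> x = 1}
        + (SUP \<theta>\<in>sparse_alt p s \<epsilon>. measure (obs \<theta>) {x \<in> euclid p. \<phi> x = (0::nat)})"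
  obtain \<theta>0 where \<theta>0: "\<theta>0 \<in> sparse_alt p s \<epsilon>" using sparse_alt_nonempty[OF s p1, of \<epsilon>] by blast
  have "minimax_risk p s \<gamma> \<B> \<epsilon> \<le> ?r \<phi>"
    unfolding minimax_risk_def
  proof (rule cINF_lower[OF _ \<open>\<phi> \<in> tests p\<close>])
    have "0 \<le> ?r f" for f
    proof -
      have "bdd_above ((\<lambda>\<theta>. measure (obs \<theta>) {x \<in> euclid p. f x = 0}) ` sparse_alt p s \<epsilon>)"
        by (intro bdd_aboveI[of _ 1]) (auto intro: prob_space.prob_le_1 prob_space_obs_law)
      from cSUP_upper[OF \<theta>0 this] show ?thesis
        by (intro add_nonneg_nonneg measure_nonneg) (rule order_trans[OF measure_nonneg])
    qed
    then show "bdd_below (?r ` tests p)" by (intro bdd_belowI[of _ 0]) auto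
  qed
  also have "\<dots> \<le> e0 + e1"
  proof (rule add_mono)
    have "{x \<in> euclid p. \<phi> x = 1} = A" using Asub by (auto simp: \<phi>_def)
    then show "measure (obs origin) {x \<in> euclid p. \<phi> x = 1} \<le> e0" using null by simp
    have "{x \<in> euclid p. \<phi> x = 0} = euclid p - A" by (auto simp: \<phi>_def)
    then show "(SUP \<theta>\<in>sparse_alt p s \<epsilon>. measure (obs \<theta>) {x \<in> euclid p. \<phi> x = 0}) \<le> e1"
      using alt sparse_alt_nonempty[OF s p1, of \<epsilon>] by (intro cSUP_least) auto
  qed
  finally show ?thesis .
qed

lemma card_pairs: "card (pairs U) = card U * (q div 2)"
  by (simp add: pairs_def card_cartesian_product)

text \<open>The scale S of the test for \<psi>_1. Below the square root of p, the threshold 8 ln (1 + p/s^2) lowers the noise level of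
the p coordinates to the order of s^2.\<close>

lemma psi1_params:
  assumes s: "1 \<le> s"
  shows "\<exists>\<tau> S. 0 \<le> \<tau> \<and> 1 + \<tau> \<le> 10 * S \<and> 1 \<le> 2 * S \<and> real (card (pairs \<B>)) * exp (- \<tau> / 8) \<le> 10 * S\<^sup>2 / 1
    \<and> a * S \<le> psi1_sq p s \<gamma> \<and> real s * \<tau> \<le> 8 * S"
proof -
  have "1 \<le> p" using p_eq q_pos R_pos by simp
  then have p1: "1 \<le> real p" by simp
  have cp: "real (card (pairs \<B>)) \<le> real p"
  proof -
    have "R * (q div 2) \<le> R * q" by (intro mult_le_mono2) simp
    then have "card (pairs \<B>) \<le> p" by (simp add: card_pairs card_blocks p_eq mult.commute)
    then show ?thesis by simp
  qed
  show ?thesis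
  proof (cases "real s < sqrt (real p)")
    case True
    define lam where "lam = ln (1 + real p / (real s)\<^sup>2)"
    have s0: "0 < real s" "1 \<le> real s" using s by auto
    have "(real s)\<^sup>2 \<le> real p" using power_mono[of "real s" "sqrt (real p)" 2] True by simp
    then have ps: "1 \<le> real p / (real s)\<^sup>2" using s0 by (simp add: divide_simps)
    then have "ln 2 \<le> lam" unfolding lam_def by (subst ln_le_cancel_iff) auto
    then have l: "1 / 2 \<le> lam" using ln2_ge_two_thirds by linarith
    have sl: "lam \<le> real s * lam" using s0 l by simp
    have "real (card (pairs \<B>)) * exp (- (8 * lam) / 8) \<le> 10 * (real s * lam)\<^sup>2 / 1"
    proof -
      have "exp (- (8 * lam) / 8) = inverse (1 + real p / (real s)\<^sup>2)"
        using ps by (simp add: lam_def exp_minus)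
      also have "\<dots> \<le> inverse (real p / (real s)\<^sup>2)" using ps by (intro le_imp_inverse_le) auto
      also have "\<dots> = (real s)\<^sup>2 / real p" by simp
      finally have "real (card (pairs \<B>)) * exp (- (8 * lam) / 8) \<le> real p * ((real s)\<^sup>2 / real p)"
        using cp by (intro mult_mono) auto
      also have "\<dots> = (real s)\<^sup>2 * 1" using p1 by simp
      also have "\<dots> \<le> (real s)\<^sup>2 * (10 * lam\<^sup>2)"
      proof (rule mult_left_mono)
        have "(1 / 2)\<^sup>2 \<le> lam\<^sup>2" using l by (intro power_mono) auto
        then show "1 \<le> 10 * lam\<^sup>2" by (simp add: power2_eq_square)
      qed simp
      finally show ?thesis by (simp add: power_mult_distrib mult_ac)
    qed
    moreover have "psi1_sq p s \<gamma> = a * (real s * lam)" using True by (simp add: psi1_sq_def lam_def)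
    moreover have "0 \<le> 8 * lam" "1 + 8 * lam \<le> 10 * (real s * lam)" "1 \<le> 2 * (real s * lam)"
      using l sl by linarith+
    ultimately show ?thesis
      by (rule_tac exI[of _ "8 * lam"], rule_tac exI[of _ "real s * lam"]) (intro conjI; (assumption | simp | linarith))
  next
    case False
    have "1 \<le> sqrt (real p)" using p1 by simp
    then have "1 \<le> 10 * sqrt (real p)" "1 \<le> 2 * sqrt (real p)" by linarith+
    moreover have "real (card (pairs \<B>)) \<le> 10 * real p" using cp by simp
    ultimately show ?thesis using False
      by (rule_tac exI[of _ "0::real"], rule_tac exI[of _ "sqrt (real p)"]) (simp add: psi1_sq_def)
  qed
qed

text \<open>The analogous choice for a single block with d zeros, at the confidence exp (- L) that the union over the blocks requires.\<close>

lemma block_params: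
  assumes d: "1 \<le> d" "d \<le> real q"
  defines "L \<equiv> 1 + ln (real R)"
  shows "\<exists>\<tau> S. 0 \<le> \<tau> \<and> 1 + \<tau> \<le> 10 * S \<and> L \<le> 2 * S \<and> real (q div 2) * exp (- \<tau> / 8) \<le> 10 * S\<^sup>2 / L
    \<and> S \<le> block_scale (real q) d (real R) \<and> d * \<tau> \<le> 8 * S"
proof -
  have R1: "1 \<le> real R" using R_pos by simp
  have L1: "1 \<le> L" using R1 by (simp add: L_def)
  have lnR: "0 \<le> ln (real R)" using R1 by simp
  have q0: "0 < real q" using q_pos by simp
  have half: "real (q div 2) \<le> real q" by simp
  show ?thesis
  proof (cases "sqrt (real q * L) \<le> d")
    case True
    let ?S = "sqrt (real q * L)"
    have LS: "L \<le> ?S" by (rule sqrt_mult_ge_L(2)[OF True d(2) L1 q0])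
    have "10 * ?S\<^sup>2 / L = 10 * real q" using q0 L1 by simp
    moreover have "?S \<le> block_scale (real q) d (real R)" using True lnR by (simp add: block_scale_def L_def)
    ultimately show ?thesis using LS L1 half
      by (rule_tac exI[of _ "0::real"], rule_tac exI[of _ ?S]) (intro conjI; (assumption | simp | linarith))
  next
    case False
    define lam where "lam = ln (1 + real q * L / d\<^sup>2)"
    define S where "S = d * lam + ln (real R)"
    have qL: "0 < real q * L" using q0 L1 by simp
    have "d\<^sup>2 \<le> real q * L" using power_mono[of d "sqrt (real q * L)" 2] False d qL by simp
    then have x: "1 \<le> real q * L / d\<^sup>2" using d by (simp add: divide_simps)
    then have "ln 2 \<le> lam" unfolding lam_def by (subst ln_le_cancel_iff) auto
    then have l: "1 / 2 \<le> lam" using ln2_ge_two_thirds by linarith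
    have dl: "lam \<le> d * lam" using d l by simp
    have dS: "d * lam \<le> S" using lnR by (simp add: S_def)
    have LS: "L \<le> 2 * S" using dl l lnR unfolding S_def L_def distrib_left by linarith
    have "real (q div 2) * exp (- (8 * lam) / 8) \<le> 10 * S\<^sup>2 / L"
    proof -
      have "exp (- (8 * lam) / 8) = inverse (1 + real q * L / d\<^sup>2)"
        using x by (simp add: lam_def exp_minus)
      also have "\<dots> \<le> inverse (real q * L / d\<^sup>2)" using x by (intro le_imp_inverse_le) auto
      also have "\<dots> = d\<^sup>2 / (real q * L)" by simp
      finally have "real (q div 2) * exp (- (8 * lam) / 8) \<le> real q * (d\<^sup>2 / (real q * L))"
        using half by (intro mult_mono) auto
      also have "\<dots> = d\<^sup>2 / L" using q0 by simp
      also have "\<dots> \<le> 10 * S\<^sup>2 / L"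
      proof (rule divide_right_mono)
        have "d * (1 / 2) \<le> d * lam" using l d by (intro mult_left_mono) auto
        then have "d / 2 \<le> S" using dS by simp
        then have "(d / 2)\<^sup>2 \<le> S\<^sup>2" using d by (intro power_mono) auto
        then have "d\<^sup>2 \<le> 4 * S\<^sup>2" by (simp add: power_divide)
        then show "d\<^sup>2 \<le> 10 * S\<^sup>2" using zero_le_power2[of S] by linarith
      qed (use L1 in simp)
      finally show ?thesis .
    qed
    moreover have "S = block_scale (real q) d (real R)"
      using False by (simp add: block_scale_def S_def lam_def L_def)
    moreover have "1 + 8 * lam \<le> 10 * S" "d * (8 * lam) \<le> 8 * S" using dl dS l by linarith+
    ultimately show ?thesis using LS l
      by (rule_tac exI[of _ "8 * lam"], rule_tac exI[of _ S]) (intro conjI; (assumption | simp | linarith))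
  qed
qed

text \<open>A union bound; since L = 1 + ln R, the level exp (- y L) for a single block absorbs the factor R.\<close>

lemma union_level:
  assumes A: "\<And>B. B \<in> \<B> \<Longrightarrow> A B \<in> sets (borel_euclid p)"
    and level: "\<And>B. B \<in> \<B> \<Longrightarrow> measure (obs origin) (A B) \<le> exp (- (y * (1 + ln (real R))))"
    and y: "1 \<le> y"
  shows "measure (obs origin) (\<Union>B\<in>\<B>. A B) \<le> exp (- (y - 1))"
proof -
  interpret prob_space "obs origin" by (rule prob_space_obs_law)
  have R1: "1 \<le> real R" using R_pos by simp
  have "measure (obs origin) (\<Union>B\<in>\<B>. A B) \<le> (\<Sum>B\<in>\<B>. measure (obs origin) (A B))"
    using A by (intro finite_measure_subadditive_finite finite_blocks) (auto simp: sets_obs_law)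
  also have "\<dots> \<le> (\<Sum>B\<in>\<B>. exp (- (y * (1 + ln (real R)))))" by (intro sum_mono level)
  also have "\<dots> = exp (ln (real R)) * exp (- (y * (1 + ln (real R))))" using R1 by (simp add: card_blocks)
  also have "\<dots> = exp (ln (real R) - y * (1 + ln (real R)))" by (simp add: exp_add[symmetric])
  also have "\<dots> \<le> exp (- (y - 1))"
  proof -
    have "1 * ln (real R) \<le> y * ln (real R)" using y R1 by (intro mult_right_mono) auto
    then show ?thesis using y by (simp add: algebra_simps)
  qed
  finally show ?thesis .
qed


lemma sum_energy: "(\<Sum>B\<in>\<B>. energy \<theta> B) = (L2_set \<theta> {..<p})\<^sup>2"
  unfolding energy_def sum_blocks by (simp add: L2_set_def sum_nonneg)

lemma psi1_sq_nonneg: "0 \<le> psi1_sq p s \<gamma>"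
  unfolding psi1_sq_def using a_pos by (auto intro!: mult_nonneg_nonneg)

text \<open>The test rejects if the global pair test does, or if one of the block tests does; the block test uses the differences or the sum
of the block, depending on which term attains the minimum in \<upsilon>^2.\<close>

lemma minimax_risk_le_rate:
  assumes s: "1 \<le> s" "s < q" and \<eta>: "0 < \<eta>" "\<eta> < 1"
    and c: "4 * (12480 / \<eta> + 144) + 8 \<le> c"
  shows "minimax_risk p s \<gamma> \<B> (c * sqrt (psi1_sq p s \<gamma> + upsilon_sq p s \<gamma> R)) \<le> \<eta>"
proof -
  \<comment> \<open>The critical value C makes 6240/C, the error of the second kind of the pair tests, at most \<eta>/2, and exp (9 - C/16), the level after the union over the blocks, at most \<eta>/4.\<close>
  define C where "C = 12480 / \<eta> + 144"
  define L where "L = 1 + ln (real R)"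
  define d where "d = real q - real s"
  define \<psi> where "\<psi> = psi1_sq p s \<gamma>"
  define u where "u = upsilon_sq p s \<gamma> R"
  define bs where "bs = block_scale (real q) d (real R)"
  let ?\<epsilon> = "c * sqrt (\<psi> + u)"
  have q2: "2 \<le> q" using s by simp
  have q0: "0 < real q" using q_pos by simp
  have R1: "1 \<le> real R" using R_pos by simp
  have L1: "1 \<le> L" using R1 by (simp add: L_def)
  have d1: "1 \<le> d" "d \<le> real q" using s by (auto simp: d_def)
  have d0: "0 < d" using d1 by simp
  have C144: "144 \<le> C" using \<eta> by (simp add: C_def)
  then have C1: "1 \<le> C" "0 \<le> C" by auto
  have c2: "16 * C\<^sup>2 + 64 \<le> c\<^sup>2"
  proof -
    have "(4 * C + 8)\<^sup>2 \<le> c\<^sup>2" using c C1 by (intro power_mono) (auto simp: C_def)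
    moreover have "(4 * C + 8)\<^sup>2 = 16 * C\<^sup>2 + 64 + 64 * C" by (simp add: power2_eq_square algebra_simps)
    ultimately show ?thesis using C1 by linarith
  qed
  have CC: "C \<le> C\<^sup>2" using C1 by (simp add: power2_eq_square mult_le_cancel_left1)
  have c16: "16 * C + 64 \<le> c\<^sup>2" using c2 CC by linarith
  have u_eq: "u = min (a * (real q / d) * bs) (V * L)"
    unfolding u_def d_def L_def bs_def V_def using p_eq R_pos q_pos s by (intro upsilon_sq_eq)
  have bs0: "0 \<le> bs" unfolding bs_def using d0 R1 by (intro block_scale_nonneg) auto
  have u0: "0 \<le> u" unfolding u_eq using a_pos V_pos q0 d0 bs0 L1 by simp
  have \<psi>0: "0 \<le> \<psi>" unfolding \<psi>_def by (rule psi1_sq_nonneg)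
  have c0: "0 \<le> c" using c \<eta> by (smt (verit) divide_pos_pos)
  have power: "6240 / C \<le> \<eta> / 2"
  proof -
    have "6240 / C \<le> 6240 / (12480 / \<eta>)" using \<eta> by (intro frac_le) (auto simp: C_def)
    then show ?thesis by simp
  qed
  have level: "exp (- (C / 16 - 9)) \<le> \<eta> / 4"
  proof -
    have x: "C / 16 - 9 = 780 / \<eta>" by (simp add: C_def add_divide_distrib)
    have "780 / \<eta> \<le> exp (780 / \<eta>)" using exp_ge_add_one_self[of "780 / \<eta>"] by linarith
    then have "inverse (exp (780 / \<eta>)) \<le> inverse (780 / \<eta>)" using \<eta> by (intro le_imp_inverse_le) auto
    then have "exp (- (780 / \<eta>)) \<le> \<eta> / 780" by (simp add: exp_minus)
    then show ?thesis unfolding x using \<eta> by simp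
  qed
  obtain \<tau>1 S1 where P1: "0 \<le> \<tau>1" "1 + \<tau>1 \<le> 10 * S1" "1 \<le> 2 * S1"
      "real (card (pairs \<B>)) * exp (- \<tau>1 / 8) \<le> 10 * S1\<^sup>2 / 1" "a * S1 \<le> \<psi>" "real s * \<tau>1 \<le> 8 * S1"
    using psi1_params[OF s(1)] unfolding \<psi>_def by blast
  have \<B>0: "\<B> \<noteq> {}" using card_blocks R_pos by auto
  from block_params[OF d1] obtain \<tau>2 S2 where P2: "0 \<le> \<tau>2" "1 + \<tau>2 \<le> 10 * S2" "L \<le> 2 * S2"
      "real (q div 2) * exp (- \<tau>2 / 8) \<le> 10 * S2\<^sup>2 / L" "S2 \<le> bs" "d * \<tau>2 \<le> 8 * S2"
    unfolding L_def bs_def by blast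
  define A1 where "A1 = {x \<in> euclid p. C * S1 < pair_stat \<B> \<tau>1 x}"
  define rej where "rej B = (if a * (real q / d) * bs \<le> V * L
      then {x \<in> euclid p. C * S2 < pair_stat {B} \<tau>2 x}
      else {x \<in> euclid p. C * sqrt (real q * V * L) < \<bar>block_sum B x\<bar>})" for B
  define A where "A = A1 \<union> (\<Union>B\<in>\<B>. rej B)"
  have S1: "0 < S1" and S2: "0 < S2" using P1 P2 L1 by linarith+
  note [measurable] = measurable_pair_stat[OF order_refl]
  have A1m: "A1 \<in> sets (borel_euclid p)"
    unfolding A1_def by (rule sets_Collect_euclid) measurable
  have rejm: "rej B \<in> sets (borel_euclid p)" if B: "B \<in> \<B>" for B
  proof -
    have [measurable]: "pair_stat {B} \<tau>2 \<in> borel_measurable (borel_euclid p)"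
        "block_sum B \<in> borel_measurable (borel_euclid p)"
      using measurable_pair_stat[of "{B}"] measurable_block_sum[OF B] B by auto
    show ?thesis
      unfolding rej_def
      by (cases "a * (real q / d) * bs \<le> V * L"; simp only: if_True if_False;
          rule sets_Collect_euclid; measurable)
  qed
  have Am: "A \<in> sets (borel_euclid p)"
    unfolding A_def using A1m rejm finite_blocks by (intro sets.Un sets.finite_UN) auto
  have null1: "measure (obs origin) A1 \<le> \<eta> / 4"
  proof -
    have "measure (obs origin) A1 \<le> exp (- ((C / 16 - 8) * 1))"
      unfolding A1_def by (rule pair_test_level[OF order_refl \<B>0 q2 P1(1) order_refl P1(3,4)])
    also have "\<dots> \<le> exp (- (C / 16 - 9))" by simp
    finally show ?thesis using level by linarith
  qed
  have null2: "measure (obs origin) (\<Union>B\<in>\<B>. rej B) \<le> \<eta> / 4"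
  proof -
    have "measure (obs origin) (rej B) \<le> exp (- ((C / 16 - 8) * L))" if B: "B \<in> \<B>" for B
    proof (cases "a * (real q / d) * bs \<le> V * L")
      case True
      have "measure (obs origin) {x \<in> euclid p. C * S2 < pair_stat {B} \<tau>2 x} \<le> exp (- ((C / 16 - 8) * L))"
        using B P2(4) by (intro pair_test_level[OF _ _ q2 P2(1) L1 P2(3)]) (auto simp: card_pairs)
      then show ?thesis using True by (simp add: rej_def)
    next
      case False
      have "measure (obs origin) (rej B) \<le> 2 * exp (- (C\<^sup>2 * L / 2))"
        using mean_test_level[OF B L1 C1(2)] False by (simp add: rej_def)
      also have "\<dots> \<le> exp 1 * exp (- (C\<^sup>2 * L / 2))"
        using exp_ge_add_one_self[of 1] by (intro mult_right_mono) auto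
      also have "\<dots> = exp (1 - C\<^sup>2 * L / 2)" by (simp add: exp_add[symmetric])
      also have "\<dots> \<le> exp (- ((C / 16 - 8) * L))"
      proof -
        have "1 * 1 \<le> (C\<^sup>2 / 2 - C / 16 + 8) * L" using CC C1 L1 by (intro mult_mono) linarith+
        then show ?thesis by (simp add: algebra_simps)
      qed
      finally show ?thesis .
    qed
    then have "measure (obs origin) (\<Union>B\<in>\<B>. rej B) \<le> exp (- (C / 16 - 8 - 1))"
      unfolding L_def using C144 by (intro union_level rejm) auto
    then show ?thesis using level by simp
  qed
  have null: "measure (obs origin) A \<le> \<eta> / 2"
  proof -
    interpret prob_space "obs origin" by (rule prob_space_obs_law)
    have "measure (obs origin) A \<le> measure (obs origin) A1 + measure (obs origin) (\<Union>B\<in>\<B>. rej B)"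
      unfolding A_def using A1m rejm finite_blocks
      by (intro measure_Un_le) (auto simp: sets_obs_law)
    then show ?thesis using null1 null2 by linarith
  qed
  have alt: "measure (obs \<theta>) (euclid p - A) \<le> \<eta> / 2" if \<theta>: "\<theta> \<in> sparse_alt p s ?\<epsilon>" for \<theta>
  proof -
    interpret prob_space "obs \<theta>" by (rule prob_space_obs_law)
    define E where "E = (\<Sum>B\<in>\<B>. energy \<theta> B)"
    have supp: "card {i \<in> {..<p}. \<theta> i \<noteq> 0} \<le> s" and norm: "?\<epsilon> \<le> L2_set \<theta> {..<p}"
      using \<theta> by (auto simp: sparse_alt_def)
    have E: "c\<^sup>2 * (\<psi> + u) \<le> E"
    proof -
      have "?\<epsilon>\<^sup>2 \<le> (L2_set \<theta> {..<p})\<^sup>2" using norm c0 \<psi>0 u0 by (intro power_mono) auto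
      then show ?thesis using \<psi>0 u0 by (simp add: E_def sum_energy power_mult_distrib)
    qed
    have reduce: "measure (obs \<theta>) (euclid p - A) \<le> e"
      if "measure (obs \<theta>) (euclid p - T) \<le> e" "T \<subseteq> A" "T \<in> sets (borel_euclid p)" for T e
    proof -
      have "euclid p - T \<in> sets (obs \<theta>)"
        using sets.compl_sets[of T "obs \<theta>"] that(3) by (simp add: sets_obs_law)
      then have "measure (obs \<theta>) (euclid p - A) \<le> measure (obs \<theta>) (euclid p - T)"
        using that(2) by (intro finite_measure_mono) auto
      then show ?thesis using that(1) by linarith
    qed
    show ?thesis
    \<comment> \<open>Either the global pair test sees the signal, or the test of the block given by the dichotomy does.\<close>
    proof (cases "(\<Sum>B\<in>\<B>. energy \<theta> B - mean_energy \<theta> B) < E / 4")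
      case False
      have "2 * C * S1 \<le> (\<Sum>B\<in>\<B>. block_gain \<tau>1 \<theta> B)"
      proof -
        have "(\<Sum>B\<in>\<B>. (energy \<theta> B - mean_energy \<theta> B) / (2 * a) - real (card (supp \<theta> B)) * \<tau>1) \<le> (\<Sum>B\<in>\<B>. block_gain \<tau>1 \<theta> B)"
          by (intro sum_mono block_gain_ge_spread P1)
        moreover have "(\<Sum>B\<in>\<B>. (energy \<theta> B - mean_energy \<theta> B) / (2 * a) - real (card (supp \<theta> B)) * \<tau>1)
          = (\<Sum>B\<in>\<B>. energy \<theta> B - mean_energy \<theta> B) / (2 * a) - real (\<Sum>B\<in>\<B>. card (supp \<theta> B)) * \<tau>1"
          by (simp only: sum_subtractf[of "\<lambda>B. (energy \<theta> B - mean_energy \<theta> B) / (2 * a)"] sum_divide_distrib[symmetric]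
              sum_distrib_right[symmetric] of_nat_sum)
        moreover have "real (\<Sum>B\<in>\<B>. card (supp \<theta> B)) * \<tau>1 \<le> 8 * S1"
        proof -
          have "real (\<Sum>B\<in>\<B>. card (supp \<theta> B)) * \<tau>1 \<le> real s * \<tau>1"
            unfolding sum_supp using supp P1(1) by (intro mult_right_mono) auto
          then show ?thesis using P1(6) by linarith
        qed
        moreover have "(2 * C + 8) * S1 \<le> (\<Sum>B\<in>\<B>. energy \<theta> B - mean_energy \<theta> B) / (2 * a)"
        proof -
          have "(16 * C + 64) * (a * S1) \<le> c\<^sup>2 * (\<psi> + u)"
            using c16 C1 P1(5) u0 a_pos S1 by (intro mult_mono) auto
          then have "(16 * C + 64) * (a * S1) / 4 \<le> (\<Sum>B\<in>\<B>. energy \<theta> B - mean_energy \<theta> B)"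
            using E False by linarith
          then have "(16 * C + 64) * (a * S1) / 4 / (2 * a) \<le> (\<Sum>B\<in>\<B>. energy \<theta> B - mean_energy \<theta> B) / (2 * a)"
            using a_pos by (intro divide_right_mono) auto
          moreover have "(16 * C + 64) * (a * S1) / 4 / (2 * a) = (2 * C + 8) * S1"
            using a_pos by (simp add: field_simps)
          ultimately show ?thesis by simp
        qed
        moreover have "(2 * C + 8) * S1 = 2 * C * S1 + 8 * S1" by (simp add: distrib_right)
        ultimately show ?thesis by linarith
      qed
      then have "measure (obs \<theta>) {x \<in> euclid p. pair_stat \<B> \<tau>1 x \<le> C * S1} \<le> 6240 / C"
        by (intro pair_test_power[OF order_refl \<B>0 q2 P1(1,2) order_refl P1(4) C1(1)])
      moreover have "euclid p - A1 = {x \<in> euclid p. pair_stat \<B> \<tau>1 x \<le> C * S1}"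
        unfolding A1_def by (rule Diff_Collect_less)
      ultimately have "measure (obs \<theta>) (euclid p - A1) \<le> \<eta> / 2" using power by simp
      then show ?thesis by (rule reduce[OF _ _ A1m]) (simp add: A_def)
    next
      case True
      have "card {i \<in> {..<p}. \<theta> i \<noteq> 0} < q" using supp s by linarith
      from energy_dichotomy[OF this True[unfolded E_def]] obtain B where B: "B \<in> \<B>" "E / 2 \<le> mean_energy \<theta> B"
        unfolding E_def by blast
      have cu: "c\<^sup>2 * u \<le> E"
      proof -
        have "c\<^sup>2 * u \<le> c\<^sup>2 * (\<psi> + u)" using \<psi>0 by (intro mult_left_mono) auto
        then show ?thesis using E by linarith
      qed
      have "measure (obs \<theta>) (euclid p - rej B) \<le> \<eta> / 2"
      proof (cases "a * (real q / d) * bs \<le> V * L")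
        case first: True
        have u1: "u = a * (real q / d) * bs" using first by (simp add: u_eq)
        define k where "k = real (card (supp \<theta> B))"
        have ks: "k \<le> real s"
        proof -
          have "card (supp \<theta> B) \<le> (\<Sum>B\<in>\<B>. card (supp \<theta> B))" using B finite_blocks by (intro member_le_sum) auto
          then show ?thesis unfolding k_def using supp unfolding sum_supp by linarith
        qed
        have kd: "d \<le> real q - k" using ks by (simp add: d_def)
        have "2 * C * S2 \<le> block_gain \<tau>2 \<theta> B"
        proof -
          have e1: "(16 * C + 64) / 4 * (real q / d * S2) \<le> energy \<theta> B / (2 * a)"
          proof -
            have "(16 * C + 64) * (a * (real q / d) * S2) \<le> c\<^sup>2 * u"
              unfolding u1 using c16 C1 P2(5) a_pos S2 q0 d0 by (intro mult_mono) auto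
            also have "\<dots> \<le> 2 * energy \<theta> B" using cu B(2) mean_energy_le_energy[OF B(1), of \<theta>] by linarith
            finally have "(16 * C + 64) * (a * (real q / d) * S2) / (4 * a) \<le> 2 * energy \<theta> B / (4 * a)"
              using a_pos by (intro divide_right_mono) auto
            moreover have "(16 * C + 64) * (a * (real q / d) * S2) / (4 * a) = (16 * C + 64) / 4 * (real q / d * S2)"
            proof -
              have "x * (A * y * z) / (4 * A) = x / 4 * (y * z)" if "A \<noteq> 0" for x y z A :: real
                using that by simp
              then show ?thesis using a_pos by (metis less_irrefl)
            qed
            moreover have "2 * energy \<theta> B / (4 * a) = energy \<theta> B / (2 * a)"
              using a_pos by (simp add: frac_eq_eq)
            ultimately show ?thesis by (simp only:)
          qed
          have e2: "k * \<tau>2 \<le> 8 * (real q / d * S2)"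
          proof -
            have "k * \<tau>2 \<le> real q * \<tau>2" using ks s P2(1) by (intro mult_right_mono) auto
            also have "\<dots> = real q / d * (d * \<tau>2)" using d0 by simp
            also have "\<dots> \<le> real q / d * (8 * S2)" using P2(6) q0 d0 by (intro mult_left_mono) auto
            finally show ?thesis by (simp only: mult.left_commute)
          qed
          have W: "0 \<le> real q / d * S2" using q0 d0 S2 by simp
          have e3: "2 * C * (real q / d * S2) \<le> energy \<theta> B / (2 * a) - k * \<tau>2"
          proof -
            have "2 * C * w \<le> e - t" if "(16 * C + 64) / 4 * w \<le> e" "t \<le> 8 * w" "0 \<le> w" for w e t
            proof -
              have "(16 * C + 64) / 4 * w = 2 * C * w + 2 * C * w + 16 * w" by (simp add: field_simps)
              moreover have "0 \<le> 2 * C * w" using C1 that by simp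
              ultimately show ?thesis using that by linarith
            qed
            from this[OF e1 e2 W] show ?thesis .
          qed
          have e4: "0 \<le> energy \<theta> B / (2 * a) - k * \<tau>2"
          proof -
            have "0 \<le> 2 * C * (real q / d * S2)" by (rule mult_nonneg_nonneg[OF _ W]) (use C1 in simp)
            then show ?thesis using e3 by linarith
          qed
          have "2 * C * S2 = d / real q * (2 * C * (real q / d * S2))" using q0 d0 by simp
          also have "\<dots> \<le> d / real q * (energy \<theta> B / (2 * a) - k * \<tau>2)"
            using e3 d0 q0 by (intro mult_left_mono) auto
          also have "\<dots> \<le> (real q - k) / real q * (energy \<theta> B / (2 * a) - k * \<tau>2)"
            using e4 kd q0 by (intro mult_right_mono divide_right_mono) auto
          also have "\<dots> \<le> block_gain \<tau>2 \<theta> B" unfolding k_def by (rule block_gain_ge_zeros[OF B(1) P2(1)])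
          finally show ?thesis .
        qed
        then have "measure (obs \<theta>) {x \<in> euclid p. pair_stat {B} \<tau>2 x \<le> C * S2} \<le> 6240 / C"
          using B(1) P2(4) by (intro pair_test_power[OF _ _ q2 P2(1,2) L1 _ C1(1)]) (auto simp: card_pairs)
        moreover have "euclid p - rej B = {x \<in> euclid p. pair_stat {B} \<tau>2 x \<le> C * S2}"
          unfolding rej_def if_P[OF first] by (rule Diff_Collect_less)
        ultimately show ?thesis using power by simp
      next
        case second: False
        have u2: "u = V * L" using second by (simp add: u_eq)
        have "16 * C\<^sup>2 * (V * L) \<le> c\<^sup>2 * (V * L)" using c2 V_pos L1 by (intro mult_right_mono) auto
        then have "8 * C\<^sup>2 * (V * L) \<le> mean_energy \<theta> B" using cu B(2) unfolding u2 by linarith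
        moreover have "0 \<le> C\<^sup>2 * (V * L)" using V_pos L1 by simp
        ultimately have "4 * C\<^sup>2 * (V * L) \<le> mean_energy \<theta> B" by linarith
        from mean_test_power[OF B(1) L1 C1(2) this]
        have "measure (obs \<theta>) {x \<in> euclid p. \<bar>block_sum B x\<bar> \<le> C * sqrt (real q * V * L)} \<le> exp (- (C\<^sup>2 * L / 2))" .
        moreover have "euclid p - rej B = {x \<in> euclid p. \<bar>block_sum B x\<bar> \<le> C * sqrt (real q * V * L)}"
          unfolding rej_def if_not_P[OF second] by (rule Diff_Collect_less)
        moreover have "exp (- (C\<^sup>2 * L / 2)) \<le> exp (- (C / 16 - 9))"
        proof -
          have "C * 1 \<le> C\<^sup>2 * L" using CC L1 C1 by (intro mult_mono) auto
          then have "C / 16 - 9 \<le> C\<^sup>2 * L / 2" using C1 by linarith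
          then show ?thesis by simp
        qed
        ultimately have "measure (obs \<theta>) (euclid p - rej B) \<le> exp (- (C / 16 - 9))" by (metis order_trans)
        then show ?thesis using level \<eta> by linarith
      qed
      moreover have "rej B \<subseteq> A" using B(1) by (auto simp only: A_def)
      ultimately show ?thesis by (rule reduce[OF _ _ rejm[OF B(1)]])
    qed
  qed
  have "minimax_risk p s \<gamma> \<B> ?\<epsilon> \<le> \<eta> / 2 + \<eta> / 2"
    by (rule minimax_risk_le[OF s(1) Am null alt])
  then show ?thesis by (simp add: \<psi>_def u_def)
qed

text \<open>For s above the square root of p, signals with about the square root of p nonzero coordinates are as hard to detect.\<close>

lemma minimax_risk_ge_psi1:
  assumes s: "1 \<le> s" and \<eta>: "0 < \<eta>" "\<eta> < 1"
    and \<epsilon>: "0 \<le> \<epsilon>" "\<epsilon>\<^sup>2 \<le> ln (1 + \<eta>\<^sup>2) / 6 * psi1_sq p s \<gamma>"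
  shows "1 - \<eta> \<le> minimax_risk p s \<gamma> \<B> \<epsilon>"
proof -
  define c where "c = ln (1 + \<eta>\<^sup>2) / 2"
  have "1 \<le> p" using p_eq q_pos R_pos by simp
  then have p1: "1 \<le> real p" by simp
  have \<eta>2: "0 < \<eta>\<^sup>2" "\<eta>\<^sup>2 < 1" using \<eta> by (auto simp: power_less_one_iff)
  have "0 < ln (1 + \<eta>\<^sup>2)" using \<eta>2 by (intro ln_gt_zero) simp
  then have c0: "0 < c" by (simp add: c_def)
  have c1: "c \<le> 1" using ln_add_one_self_le_self[of "\<eta>\<^sup>2"] \<eta>2 by (simp add: c_def)
  have c2: "2 * c \<le> ln (1 + \<eta>\<^sup>2)" by (simp add: c_def)
  have lnc: "c * ln (1 + x) \<le> ln (1 + c * x)" if "0 \<le> x" for x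
  proof -
    have "exp (c * ln (1 + x)) \<le> 1 + c * x" using c0 c1 that by (intro exp_mult_le_one_plus) auto
    then have "ln (exp (c * ln (1 + x))) \<le> ln (1 + c * x)" by (subst ln_le_cancel_iff) (use c0 that in \<open>auto intro: add_pos_nonneg\<close>)
    then show ?thesis by simp
  qed
  have \<epsilon>': "\<epsilon>\<^sup>2 \<le> c / 3 * psi1_sq p s \<gamma>" using \<epsilon>(2) by (simp add: c_def)
  show ?thesis
  proof (cases "real s < sqrt (real p)")
    case True
    have "\<epsilon>\<^sup>2 \<le> c / 3 * (a * real s * ln (1 + real p / (real s)\<^sup>2))" using \<epsilon>' True by (simp add: psi1_sq_def)
    also have "\<dots> \<le> c * (a * real s * ln (1 + real p / (real s)\<^sup>2))"
      using c0 a_pos by (intro mult_right_mono) auto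
    also have "\<dots> = a * real s * (c * ln (1 + real p / (real s)\<^sup>2))" by simp
    also have "\<dots> \<le> a * real s * ln (1 + c * (real p / (real s)\<^sup>2))"
      using a_pos by (intro mult_left_mono lnc) auto
    finally show ?thesis
      using s True by (intro minimax_risk_ge_independent[OF s order_refl _ c0 c2 \<eta>(1) \<epsilon>(1)]) auto
  next
    case False
    \<comment> \<open>With n close to the square root of p, the logarithm in the bound for n nonzero coordinates is of constant order.\<close>
    define n where "n = nat \<lfloor>sqrt (real p)\<rfloor>"
    have sp: "1 \<le> sqrt (real p)" using p1 by simp
    have n: "real n \<le> sqrt (real p)" "sqrt (real p) < real n + 1"
    proof -
      have "real n = real_of_int \<lfloor>sqrt (real p)\<rfloor>" using sp by (simp add: n_def)
      then show "real n \<le> sqrt (real p)" "sqrt (real p) < real n + 1"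
        using floor_correct[of "sqrt (real p)"] by simp_all
    qed
    have n1: "1 \<le> n" using n sp by linarith
    have ns: "n \<le> s" using n False by linarith
    have nhalf: "sqrt (real p) \<le> 2 * real n" using n n1 by linarith
    have "(real n)\<^sup>2 \<le> real p" using power_mono[OF n(1), of 2] by simp
    then have x: "1 \<le> real p / (real n)\<^sup>2" using n1 by (simp add: divide_simps)
    then have "ln 2 \<le> ln (1 + real p / (real n)\<^sup>2)" by (subst ln_le_cancel_iff) auto
    then have l: "2 / 3 \<le> ln (1 + real p / (real n)\<^sup>2)" using ln2_ge_two_thirds by linarith
    have "\<epsilon>\<^sup>2 \<le> c / 3 * (a * sqrt (real p))" using \<epsilon>' False by (simp add: psi1_sq_def)
    also have "\<dots> \<le> c / 3 * (a * (2 * real n))"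
      using c0 a_pos nhalf by (intro mult_left_mono) auto
    also have "\<dots> = a * real n * (c * (2 / 3))" by simp
    also have "\<dots> \<le> a * real n * (c * ln (1 + real p / (real n)\<^sup>2))"
      using a_pos c0 l by (intro mult_left_mono) auto
    also have "\<dots> \<le> a * real n * ln (1 + c * (real p / (real n)\<^sup>2))"
      using a_pos by (intro mult_left_mono lnc) auto
    finally show ?thesis
      by (intro minimax_risk_ge_independent[OF n1 ns n(1) c0 c2 \<eta>(1) \<epsilon>(1)]) auto
  qed
qed

lemma minimax_risk_ge_rate:
  assumes s: "1 \<le> s" "s < q" "q < 4 * s" and \<eta>: "0 < \<eta>" "\<eta> < 1"
    and c: "0 < c" "c\<^sup>2 \<le> min (ln (1 + \<eta>\<^sup>2) / 6) (\<eta>\<^sup>2 / 290) / 2"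
  shows "1 - \<eta> \<le> minimax_risk p s \<gamma> \<B> (c * sqrt (psi1_sq p s \<gamma> + upsilon_sq p s \<gamma> R))"
proof -
  let ?\<psi> = "psi1_sq p s \<gamma>" and ?u = "upsilon_sq p s \<gamma> R"
  have \<psi>0: "0 \<le> ?\<psi>" by (rule psi1_sq_nonneg)
  have u0: "0 \<le> ?u"
  proof -
    have "0 \<le> block_scale (real q) (real q - real s) (real R)" using s R_pos by (intro block_scale_nonneg) auto
    moreover have "0 \<le> ln (real R)" using R_pos by simp
    ultimately show ?thesis
      unfolding upsilon_sq_eq[OF p_eq R_pos q_pos s(2)] using a_pos V_pos s by (simp add: V_def)
  qed
  have c\<psi>: "2 * c\<^sup>2 \<le> ln (1 + \<eta>\<^sup>2) / 6" and cu: "2 * c\<^sup>2 \<le> \<eta>\<^sup>2 / 290" using c(2) by auto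
  have \<epsilon>0: "0 \<le> c * sqrt (?\<psi> + ?u)" using c \<psi>0 u0 by simp
  have \<epsilon>2: "(c * sqrt (?\<psi> + ?u))\<^sup>2 = c\<^sup>2 * (?\<psi> + ?u)" using \<psi>0 u0 by (simp add: power_mult_distrib)
  show ?thesis
  proof (cases "?u \<le> ?\<psi>")
    case True
    have "c\<^sup>2 * (?\<psi> + ?u) \<le> c\<^sup>2 * (2 * ?\<psi>)" using True by (intro mult_left_mono) auto
    also have "\<dots> = 2 * c\<^sup>2 * ?\<psi>" by simp
    also have "\<dots> \<le> ln (1 + \<eta>\<^sup>2) / 6 * ?\<psi>" using c\<psi> \<psi>0 by (intro mult_right_mono)
    finally show ?thesis using \<epsilon>2 by (intro minimax_risk_ge_psi1[OF s(1) \<eta> \<epsilon>0]) simp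
  next
    case False
    have \<eta>2: "0 < \<eta>\<^sup>2" "\<eta>\<^sup>2 < 1" using \<eta> by (auto simp: power_less_one_iff)
    have "c\<^sup>2 * (?\<psi> + ?u) \<le> c\<^sup>2 * (2 * ?u)" using False by (intro mult_left_mono) auto
    also have "\<dots> = 2 * c\<^sup>2 * ?u" by simp
    also have "\<dots> \<le> \<eta>\<^sup>2 / 290 * ?u" using cu u0 by (intro mult_right_mono)
    finally show ?thesis
      using \<epsilon>2 \<eta>2 by (intro minimax_risk_ge_upsilon[OF s _ _ _ _ \<eta>(1) \<epsilon>0, where c = "\<eta>\<^sup>2 / 290"]) auto
  qed
qed

end

theorem theorem5:
  shows "minimax_separation_rate
    (\<lambda>p s \<gamma> R. 1 \<le> p \<and> 1 \<le> s \<and> 1 \<le> R \<and> R \<le> p \<and> R dvd p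
       \<and> real p / (4 * real R) < real s \<and> real s < real p / real R
       \<and> 0 \<le> \<gamma> \<and> \<gamma> < 1)
    (\<lambda>p s \<gamma> R. sqrt (psi1_sq p s \<gamma> + upsilon_sq p s \<gamma> R))"
proof -
  have model: "block_model p R (p div R) \<gamma> \<B> \<and> s < p div R \<and> p div R < 4 * s"
    if "1 \<le> p \<and> 1 \<le> s \<and> 1 \<le> R \<and> R \<le> p \<and> R dvd p
       \<and> real p / (4 * real R) < real s \<and> real s < real p / real R \<and> 0 \<le> \<gamma> \<and> \<gamma> < 1"
      "equal_groups p R \<B>" for p s R \<gamma> \<B>
  proof -
    have pq: "p = (p div R) * R" using that by simp
    have pr: "real p / real R = real (p div R)" using that by (simp add: real_of_nat_div)
    have q1: "1 \<le> p div R" using that by (simp add: Suc_le_eq div_greater_zero_iff)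
    have "real s < real (p div R)" "real (p div R) < 4 * real s"
      using that unfolding pr[symmetric] by (auto simp: field_simps)
    then have "s < p div R" "p div R < 4 * s" by linarith+
    moreover have "block_model p R (p div R) \<gamma> \<B>"
      using that pq q1 by (intro block_model.intro) auto
    ultimately show ?thesis by blast
  qed
  show ?thesis
    unfolding minimax_separation_rate_def
  proof (intro conjI ballI)
    fix \<eta> :: real assume "\<eta> \<in> {0<..<1}"
    then have \<eta>: "0 < \<eta>" "\<eta> < 1" by auto
    let ?C = "4 * (12480 / \<eta> + 144) + 8"
    show "\<exists>C\<^sub>\<eta>>0. \<forall>p s \<gamma> R \<B>. 1 \<le> p \<and> 1 \<le> s \<and> 1 \<le> R \<and> R \<le> p \<and> R dvd p
       \<and> real p / (4 * real R) < real s \<and> real s < real p / real R \<and> 0 \<le> \<gamma> \<and> \<gamma> < 1 \<longrightarrow>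
       equal_groups p R \<B> \<longrightarrow>
        (\<forall>C>C\<^sub>\<eta>. minimax_risk p s \<gamma> \<B> (C * sqrt (psi1_sq p s \<gamma> + upsilon_sq p s \<gamma> R)) \<le> \<eta>)"
    proof (intro exI[of _ ?C] conjI allI impI)
      show "0 < ?C" using \<eta> by (simp add: add_pos_pos)
      fix p s and \<gamma> :: real and R \<B> C
      assume D: "1 \<le> p \<and> 1 \<le> s \<and> 1 \<le> R \<and> R \<le> p \<and> R dvd p
       \<and> real p / (4 * real R) < real s \<and> real s < real p / real R \<and> 0 \<le> \<gamma> \<and> \<gamma> < 1"
        and G: "equal_groups p R \<B>" and C: "?C < C"
      from model[OF D G] show "minimax_risk p s \<gamma> \<B> (C * sqrt (psi1_sq p s \<gamma> + upsilon_sq p s \<gamma> R)) \<le> \<eta>"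
        using D C \<eta> by (intro block_model.minimax_risk_le_rate) auto
    qed
  next
    fix \<eta> :: real assume "\<eta> \<in> {0<..<1}"
    then have \<eta>: "0 < \<eta>" "\<eta> < 1" by auto
    let ?m = "min (ln (1 + \<eta>\<^sup>2) / 6) (\<eta>\<^sup>2 / 290) / 2"
    have "0 < \<eta>\<^sup>2" using \<eta> by simp
    moreover from this have "0 < ln (1 + \<eta>\<^sup>2)" by (intro ln_gt_zero) simp
    ultimately have m0: "0 < ?m" by simp
    show "\<exists>c\<^sub>\<eta>>0. \<forall>p s \<gamma> R \<B>. 1 \<le> p \<and> 1 \<le> s \<and> 1 \<le> R \<and> R \<le> p \<and> R dvd p
       \<and> real p / (4 * real R) < real s \<and> real s < real p / real R \<and> 0 \<le> \<gamma> \<and> \<gamma> < 1 \<longrightarrow>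
       equal_groups p R \<B> \<longrightarrow>
        (\<forall>c. 0 < c \<and> c < c\<^sub>\<eta> \<longrightarrow> 1 - \<eta> \<le> minimax_risk p s \<gamma> \<B> (c * sqrt (psi1_sq p s \<gamma> + upsilon_sq p s \<gamma> R)))"
    proof (intro exI[of _ "sqrt ?m"] conjI allI impI)
      show "0 < sqrt ?m" using m0 by (subst real_sqrt_gt_0_iff)
      fix p s and \<gamma> :: real and R \<B> c
      assume D: "1 \<le> p \<and> 1 \<le> s \<and> 1 \<le> R \<and> R \<le> p \<and> R dvd p
       \<and> real p / (4 * real R) < real s \<and> real s < real p / real R \<and> 0 \<le> \<gamma> \<and> \<gamma> < 1"
        and G: "equal_groups p R \<B>" and c: "0 < c \<and> c < sqrt ?m"
      have "c\<^sup>2 \<le> (sqrt ?m)\<^sup>2" using c by (intro power_mono) auto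
      also have "(sqrt ?m)\<^sup>2 = ?m" using m0 by (intro real_sqrt_pow2) simp
      finally have c2: "c\<^sup>2 \<le> ?m" .
      from model[OF D G] show "1 - \<eta> \<le> minimax_risk p s \<gamma> \<B> (c * sqrt (psi1_sq p s \<gamma> + upsilon_sq p s \<gamma> R))"
        using D c c2 \<eta> by (intro block_model.minimax_risk_ge_rate) auto
    qed
  qed
qed

end
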